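(* Let $\mu>0$ and let $\Omega$ be an optimal domain, with boundary parametrized by arc length as $s\in[0,2\pi]\mapsto(x(s),y(s))$, $x'=\cos\theta$, $y'=\sin\theta$, normalized so that $x(0)=y(0)=0$. Then $\theta\in W^{2,\infty}(0,2\pi)$ and there exist real numbers $\lambda_1,\lambda_2,c$ such that for all $s\in[0,2\pi]$ $$\theta'(s)=\frac{\mu}{2}\left(\frac{\lambda_1^2+\lambda_2^2}{\mu^2}+\frac{2c}{\mu}-\Big[x(s)-\frac{\lambda_2}{\mu}\Big]^2-\Big[y(s)+\frac{\lambda_1}{\mu}\Big]^2\right)^-,$$ where $(a)^-=\max(-a,0)$ denotes the negative part of a real number $a$.
   Context: Let $\mathcal{C}$ be the class of bounded open convex sets $\Omega\subset\mathbb{R}^2$ whose boundary, of length $P=P(\Omega)$, is parametrized by arc length $s\in[0,P]\mapsto(x(s),y(s))$ with $x'(s)=\cos\theta(s)$, $y'(s)=\sin\theta(s)$, where the tangent angle $\theta$ belongs to $W^{1,2}(0,P)$, satisfies $\theta'\ge 0$ a.e., $\theta(P)=\theta(0)+2\pi$, and $\int_0^P\cos\theta\,ds=\int_0^P\sin\theta\,ds=0$. The curvature is $k=\theta'$, $E(\Omega)=\frac12\int_0^P k^2\,ds$, $A$ is area, $P$ perimeter, $J_\mu=E+\mu A$. An optimal domain is a set $\Omega\in\mathcal{C}$ with $P(\Omega)=2\pi$ minimizing $J_\mu$ among all sets of $\mathcal{C}$ with perimeter $2\pi$. *)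

theory Defs
  imports "HOL-Analysis.Analysis"
begin

definition curve :: "(real \<Rightarrow> real) \<Rightarrow> real \<times> real \<Rightarrow> real \<Rightarrow> real \<times> real" where
  "curve \<theta> p0 s = (fst p0 + (LBINT t=0..s. cos (\<theta> t)), snd p0 + (LBINT t=0..s. sin (\<theta> t)))"

definition W12_with_deriv :: "(real \<Rightarrow> real) \<Rightarrow> real \<Rightarrow> (real \<Rightarrow> real) \<Rightarrow> bool" where
  "W12_with_deriv \<theta> P k \<longleftrightarrow>
     set_integrable lborel {0..P} k \<and>
     set_integrable lborel {0..P} (\<lambda>s. (k s)\<^sup>2) \<and>
     (\<forall>s\<in>{0..P}. \<theta> s = \<theta> 0 + (LBINT t=0..s. k t))"

definition admissible :: "(real \<times> real) set \<Rightarrow> real \<Rightarrow> (real \<Rightarrow> real) \<Rightarrow> (real \<Rightarrow> real) \<Rightarrow> bool" where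
  "admissible \<Omega> P \<theta> k \<longleftrightarrow>
     open \<Omega> \<and> bounded \<Omega> \<and> convex \<Omega> \<and> P > 0 \<and>
     W12_with_deriv \<theta> P k \<and>
     (AE s in lborel. s \<in> {0..P} \<longrightarrow> k s \<ge> 0) \<and>
     \<theta> P = \<theta> 0 + 2 * pi \<and>
     (LBINT s=0..P. cos (\<theta> s)) = 0 \<and> (LBINT s=0..P. sin (\<theta> s)) = 0 \<and>
     (\<exists>p0. frontier \<Omega> = curve \<theta> p0 ` {0..P})"

definition energy :: "real \<Rightarrow> (real \<Rightarrow> real) \<Rightarrow> real" where
  "energy P k = (1/2) * (LBINT s=0..P. (k s)\<^sup>2)"

definition area :: "(real \<times> real) set \<Rightarrow> real" where
  "area \<Omega> = measure lborel \<Omega>"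

definition J :: "real \<Rightarrow> (real \<times> real) set \<Rightarrow> real \<Rightarrow> (real \<Rightarrow> real) \<Rightarrow> real" where
  "J \<mu> \<Omega> P k = energy P k + \<mu> * area \<Omega>"

definition optimal_domain :: "real \<Rightarrow> (real \<times> real) set \<Rightarrow> (real \<Rightarrow> real) \<Rightarrow> (real \<Rightarrow> real) \<Rightarrow> bool" where
  "optimal_domain \<mu> \<Omega> \<theta> k \<longleftrightarrow>
     admissible \<Omega> (2 * pi) \<theta> k \<and>
     (\<forall>\<Omega>' \<theta>' k'. admissible \<Omega>' (2 * pi) \<theta>' k' \<longrightarrow> J \<mu> \<Omega> (2 * pi) k \<le> J \<mu> \<Omega>' (2 * pi) k')"

definition W2inf :: "(real \<Rightarrow> real) \<Rightarrow> real \<Rightarrow> real \<Rightarrow> bool" where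
  "W2inf f a b \<longleftrightarrow> (\<exists>g L. (\<forall>s\<in>{a..b}. (f has_real_derivative g s) (at s within {a..b})) \<and>
                         L-lipschitz_on {a..b} g)"

definition neg_part :: "real \<Rightarrow> real" where
  "neg_part a = max (- a) 0"

end

theory Submission
  imports Defs
begin

text \<open>
  The area enclosed by an arc-length parametrised closed convex arc is \<open>- \<integral> y x'\<close>, and every
  such arc bounds a convex domain, so optimality is a statement about tangent angles only.

  The closing conditions are nonlinear in the angle \<open>\<theta>\<close> but linear in the speed of a
  parametrisation. Given a nonnegative density \<open>\<psi>\<close> of total mass \<open>2 * pi\<close>, replace \<open>k\<close> by
  \<open>(1 - t) * k + t * \<psi>\<close> and restore closedness with a speed \<open>\<sigma> = 1 + a * e1 + b * e2\<close>, where
  \<open>e1\<close>, \<open>e2\<close> have mean zero (so the perimeter is kept) and are dual to \<open>cos \<theta>\<close>, \<open>sin \<theta>\<close>;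
  the coefficients solve a linear 2x2 system. The first variation of \<open>J\<close> along these
  competitors is \<open>\<integral> (\<psi> - k) (k - g)\<close> with
  \<open>g = \<mu>/2 * (x\<^sup>2 + y\<^sup>2) + l1 * y - l2 * x\<close>, the multipliers \<open>l1\<close>, \<open>l2\<close> being the coefficients
  produced by the correction of the speed. Its nonnegativity for all \<open>\<psi>\<close> forces
  \<open>k = max (g - c) 0\<close> almost everywhere.
\<close>

section \<open>Closed convex arcs\<close>

text \<open>The sign constraint on the curvature is the obstacle. Where \<open>k\<close> vanishes it
  can only be increased, and repairing the closing conditions through \<open>k\<close> could make it
  negative. A positive speed \<open>\<sigma>\<close> divides the curvature and leaves its sign
  alone, so the repair is free of the constraint. The price is that the energy becomes the integral
  of \<open>\<kappa>\<^sup>2 / \<sigma>\<close>, which is why the multipliers contain a term in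
  \<open>k\<^sup>2\<close> besides the area term. A convex combination of \<open>k\<close> and
  \<open>\<psi>\<close> is available only for \<open>t\<close> between 0 and 1, so minimality yields
  an inequality and all expansions are taken as \<open>t\<close> tends to 0 from the right.
  Minimality compares sets, not angles. Every competitor needs an actual domain, the interior of the
  convex hull of its arc, whose frontier must be shown to be the arc itself, and area is Lebesgue
  measure. Directions matter modulo \<open>2 * pi\<close> while angle functions are real valued. The
  geometric arguments therefore first move the starting point, so that the angles fill one interval
  placed conveniently around the direction under study.\<close>

lemma has_real_derivative_periodic_extension:
  fixes f F :: "real \<Rightarrow> real"
  assumes T: "0 < T" and f: "continuous_on {0..T} f" and per: "f T = f 0"
    and F: "\<And>s. s \<in> {0..T} \<Longrightarrow> (F has_real_derivative f s) (at s within {0..T})"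
    and v: "v \<in> {0..2*T}"
  shows "((\<lambda>v. if v \<le> T then F v else F (v - T) + F T - F 0) has_real_derivative
      (if v \<le> T then f v else f (v - T))) (at v within {0..2*T})"
proof -
  define fe where "fe = (\<lambda>v. if v \<le> T then f v else f (v - T))"
  \<comment> \<open>A primitive of the glued continuous density is differentiable across
    \<open>T\<close> without any matching of one-sided derivatives. Each branch differs from it by a
    constant, read off at 0 and at \<open>T\<close>.\<close>
  define G where "G = (\<lambda>v. F 0 + integral {0..v} fe)"
  have "continuous_on ({0..T} \<union> {T..2*T}) fe"
    unfolding fe_def
  proof (intro continuous_on_cases)
    show "continuous_on {T..2*T} (\<lambda>v. f (v - T))"
      by (rule continuous_on_compose2[OF f]) (auto intro!: continuous_intros)
  qed (use f per in auto)
  moreover have "{0..T} \<union> {T..2*T} = {0..2*T}" using T by auto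
  ultimately have fe: "continuous_on {0..2*T} fe" by simp
  have G: "(G has_real_derivative fe s) (at s within {0..2*T})" if "s \<in> {0..2*T}" for s
    unfolding G_def using integral_has_real_derivative[OF fe that]
    by (auto intro!: derivative_eq_intros)
  have G1: "G s = F s" if "s \<in> {0..T}" for s
  proof -
    have "\<exists>c. \<forall>s\<in>{0..T}. G s - F s = c"
    proof (rule has_field_derivative_zero_constant)
      show "((\<lambda>s. G s - F s) has_real_derivative 0) (at s within {0..T})" if s: "s \<in> {0..T}" for s
      proof -
        have "(G has_real_derivative fe s) (at s within {0..T})"
          by (rule DERIV_subset[OF G]) (use s in auto)
        from DERIV_diff[OF this F[OF s]] show ?thesis using s by (simp add: fe_def)
      qed
    qed auto
    then obtain c where c: "\<And>s. s \<in> {0..T} \<Longrightarrow> G s - F s = c" by blast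
    have "c = 0" using c[of 0] T by (simp add: G_def)
    with c[OF that] show ?thesis by simp
  qed
  have G2: "G s = F (s - T) + F T - F 0" if s0: "s \<in> {T..2*T}" for s
  proof -
    have "\<exists>c. \<forall>s\<in>{T..2*T}. G s - F (s - T) = c"
    proof (rule has_field_derivative_zero_constant)
      show "((\<lambda>s. G s - F (s - T)) has_real_derivative 0) (at s within {T..2*T})"
        if s: "s \<in> {T..2*T}" for s
      proof -
        have "(G has_real_derivative fe s) (at s within {T..2*T})"
          by (rule DERIV_subset[OF G]) (use s T in auto)
        moreover have "((F \<circ> (\<lambda>s. s - T)) has_real_derivative f (s - T) * 1) (at s within {T..2*T})"
        proof (rule DERIV_image_chain)
          have "(\<lambda>s. s - T) ` {T..2*T} = {0..T}"
            by (auto simp: image_iff intro!: bexI[of _ "_ + T"])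
          then show "(F has_real_derivative f (s - T)) (at (s - T) within (\<lambda>s. s - T) ` {T..2*T})"
            using F[of "s - T"] s by simp
        qed (auto intro!: derivative_eq_intros)
        moreover have "fe s = f (s - T)"
          using s per by (cases "s = T") (auto simp: fe_def)
        ultimately show ?thesis
          using DERIV_diff by (fastforce simp: o_def)
      qed
    qed auto
    then obtain c where c: "\<And>s. s \<in> {T..2*T} \<Longrightarrow> G s - F (s - T) = c" by blast
    have "c = F T - F 0" using c[of T] G1[of T] T by simp
    with c[OF s0] show ?thesis by simp
  qed
  have "((\<lambda>v. if v \<le> T then F v else F (v - T) + F T - F 0) has_real_derivative fe v)
      (at v within {0..2*T})"
    by (rule has_field_derivative_transform_within[OF G[OF v] zero_less_one v]) (use G1 G2 in auto)
  then show ?thesis by (simp add: fe_def)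
qed

text \<open>Curvature is deliberately absent: hull, supporting lines and area depend only on a
  continuous nondecreasing angle of total turn \<open>2 * pi\<close>. The same geometry thus serves
  the optimal domain and every competitor.\<close>

definition convex_arc :: "real \<Rightarrow> (real \<Rightarrow> real) \<Rightarrow> (real \<Rightarrow> real) \<Rightarrow> (real \<Rightarrow> real) \<Rightarrow> bool" where
  "convex_arc T \<theta> x y \<longleftrightarrow> 0 < T \<and> continuous_on {0..T} \<theta> \<and> mono_on {0..T} \<theta> \<and>
     \<theta> T = \<theta> 0 + 2 * pi \<and> x T = x 0 \<and> y T = y 0 \<and>
     (\<forall>s\<in>{0..T}. (x has_real_derivative cos (\<theta> s)) (at s within {0..T})) \<and>
     (\<forall>s\<in>{0..T}. (y has_real_derivative sin (\<theta> s)) (at s within {0..T}))"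

text \<open>Position and tangent direction: exactly what is unchanged when the starting point of a closed
  arc is moved.\<close>

definition arc_data :: "(real \<Rightarrow> real) \<Rightarrow> (real \<Rightarrow> real) \<Rightarrow> (real \<Rightarrow> real) \<Rightarrow> real \<Rightarrow> real \<times> real \<times> real \<times> real" where
  "arc_data \<theta> x y s = (x s, y s, cos (\<theta> s), sin (\<theta> s))"

lemma convex_arcD:
  assumes "convex_arc T \<theta> x y"
  shows "0 < T" "continuous_on {0..T} \<theta>" "mono_on {0..T} \<theta>" "\<theta> T = \<theta> 0 + 2 * pi"
    "x T = x 0" "y T = y 0"
    "\<And>s. s \<in> {0..T} \<Longrightarrow> (x has_real_derivative cos (\<theta> s)) (at s within {0..T})"
    "\<And>s. s \<in> {0..T} \<Longrightarrow> (y has_real_derivative sin (\<theta> s)) (at s within {0..T})"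
    "continuous_on {0..T} x" "continuous_on {0..T} y"
  using assms unfolding convex_arc_def
  by (auto intro!: DERIV_continuous_on)

text \<open>Moving the starting point is what allows the initial angle to be chosen later. The
  integral in the last clause is minus the enclosed area, so it has to be carried along.\<close>

lemma convex_arc_shift:
  assumes arc: "convex_arc T \<theta> x y" and p: "p \<in> {0..T}"
  obtains \<theta>' x' y' where "convex_arc T \<theta>' x' y'" "\<theta>' 0 = \<theta> p"
    "arc_data \<theta>' x' y' ` {0..T} = arc_data \<theta> x y ` {0..T}"
    "integral {0..T} (\<lambda>s. y' s * cos (\<theta>' s)) = integral {0..T} (\<lambda>s. y s * cos (\<theta> s))"
proof
  note a = convex_arcD[OF arc]
  \<comment> \<open>One operator covers all cases because it continues \<open>F\<close> past
    \<open>T\<close> with the increment \<open>F T - F 0\<close>: this is \<open>2 * pi\<close> for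
    the angle and 0 for the two coordinates.\<close>
  define ext where "ext = (\<lambda>(F::real\<Rightarrow>real) v. if v \<le> T then F v else F (v - T) + F T - F 0)"
  have ext_deriv: "((\<lambda>s. ext F (s + p)) has_real_derivative
      (if s + p \<le> T then f (s + p) else f (s + p - T))) (at s within {0..T})"
    if "continuous_on {0..T} f" "f T = f 0" "s \<in> {0..T}"
      "\<And>s. s \<in> {0..T} \<Longrightarrow> (F has_real_derivative f s) (at s within {0..T})" for f F s
  proof -
    have "(ext F has_real_derivative (if s + p \<le> T then f (s + p) else f (s + p - T)))
        (at (s + p) within {0..2*T})"
      unfolding ext_def
      by (rule has_real_derivative_periodic_extension) (use that p a(1) in auto)
    then have "(ext F has_real_derivative (if s + p \<le> T then f (s + p) else f (s + p - T)))
        (at (s + p) within (\<lambda>s. s + p) ` {0..T})"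
      by (rule DERIV_subset) (use p in auto)
    then have "((ext F \<circ> (\<lambda>s. s + p)) has_real_derivative
        (if s + p \<le> T then f (s + p) else f (s + p - T)) * 1) (at s within {0..T})"
      by (rule DERIV_image_chain) (auto intro!: derivative_eq_intros)
    then show ?thesis by (simp add: o_def)
  qed
  let ?t = "\<lambda>s. ext \<theta> (s + p)" and ?x = "\<lambda>s. ext x (s + p)" and ?y = "\<lambda>s. ext y (s + p)"
  have t: "?t s = (if s + p \<le> T then \<theta> (s + p) else \<theta> (s + p - T) + 2 * pi)" for s
    using a(4) by (simp add: ext_def)
  have x: "?x s = (if s + p \<le> T then x (s + p) else x (s + p - T))" for s
    using a(5) by (simp add: ext_def)
  have y: "?y s = (if s + p \<le> T then y (s + p) else y (s + p - T))" for s
    using a(6) by (simp add: ext_def)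
  have cs: "cos (?t s) = (if s + p \<le> T then cos (\<theta> (s + p)) else cos (\<theta> (s + p - T)))"
    "sin (?t s) = (if s + p \<le> T then sin (\<theta> (s + p)) else sin (\<theta> (s + p - T)))" for s
    unfolding t by simp_all
  have "convex_arc T ?t ?x ?y"
    unfolding convex_arc_def
  proof (intro conjI ballI)
    have "continuous_on ({0..T-p} \<union> {T-p..T})
        (\<lambda>s. if s \<le> T - p then \<theta> (s + p) else \<theta> (s + p - T) + 2 * pi)"
    proof (intro continuous_on_cases)
      show "continuous_on {0..T-p} (\<lambda>s. \<theta> (s + p))"
        by (rule continuous_on_compose2[OF a(2)]) (use p in \<open>auto intro!: continuous_intros\<close>)
      show "continuous_on {T-p..T} (\<lambda>s. \<theta> (s + p - T) + 2 * pi)"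
        by (rule continuous_on_add[OF continuous_on_compose2[OF a(2)]])
          (use p in \<open>auto intro!: continuous_intros\<close>)
      show "\<forall>s. s \<in> {0..T - p} \<and> \<not> s \<le> T - p \<or> s \<in> {T - p..T} \<and> s \<le> T - p \<longrightarrow>
        \<theta> (s + p) = \<theta> (s + p - T) + 2 * pi"
      proof (intro allI impI)
        fix s assume "s \<in> {0..T - p} \<and> \<not> s \<le> T - p \<or> s \<in> {T - p..T} \<and> s \<le> T - p"
        then have "s = T - p" by auto
        then show "\<theta> (s + p) = \<theta> (s + p - T) + 2 * pi" using a(4) by simp
      qed
    qed auto
    moreover have "{0..T-p} \<union> {T-p..T} = {0..T}" using p by auto
    ultimately show "continuous_on {0..T} ?t" unfolding t by (simp add: le_diff_eq)
    show "mono_on {0..T} ?t"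
    proof (rule mono_onI)
      fix r s assume rs: "r \<in> {0..T}" "s \<in> {0..T}" "r \<le> s"
      have 1: "\<theta> (r + p) \<le> \<theta> (s + p - T) + 2 * pi" if "r + p \<le> T" "s + p > T"
      proof -
        have "\<theta> (r + p) \<le> \<theta> T" "\<theta> 0 \<le> \<theta> (s + p - T)"
          using that rs p by (auto intro!: mono_onD[OF a(3)])
        then show ?thesis using a(4) by simp
      qed
      show "?t r \<le> ?t s"
        unfolding t using rs p 1 by (auto intro!: mono_onD[OF a(3)])
    qed
    show "?t T = ?t 0 + 2 * pi" "?x T = ?x 0" "?y T = ?y 0"
      using a p by (auto simp: ext_def)
    fix s assume s: "s \<in> {0..T}"
    show "(?x has_real_derivative cos (?t s)) (at s within {0..T})"
      unfolding cs by (rule ext_deriv[where f = "\<lambda>s. cos (\<theta> s)"]) (use a s in \<open>auto intro!: continuous_intros\<close>)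
    show "(?y has_real_derivative sin (?t s)) (at s within {0..T})"
      unfolding cs by (rule ext_deriv[where f = "\<lambda>s. sin (\<theta> s)"]) (use a s in \<open>auto intro!: continuous_intros\<close>)
  qed (use a in auto)
  then show "convex_arc T ?t ?x ?y" .
  show "?t 0 = \<theta> p" using t[of 0] p by simp
  have d: "arc_data ?t ?x ?y s = (if s + p \<le> T then arc_data \<theta> x y (s + p) else arc_data \<theta> x y (s + p - T))" for s
    unfolding arc_data_def x y cs by simp
  show "arc_data ?t ?x ?y ` {0..T} = arc_data \<theta> x y ` {0..T}"
  proof (intro equalityI subsetI)
    fix z assume "z \<in> arc_data ?t ?x ?y ` {0..T}"
    then obtain s where s: "s \<in> {0..T}" and z: "z = arc_data ?t ?x ?y s" by auto
    show "z \<in> arc_data \<theta> x y ` {0..T}" unfolding z d using s p by auto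
  next
    fix z assume "z \<in> arc_data \<theta> x y ` {0..T}"
    then obtain s where s: "s \<in> {0..T}" and z: "z = arc_data \<theta> x y s" by auto
    have T0: "arc_data \<theta> x y T = arc_data \<theta> x y 0" unfolding arc_data_def using a by simp
    show "z \<in> arc_data ?t ?x ?y ` {0..T}"
    proof (cases "p \<le> s")
      case True
      show ?thesis by (rule image_eqI[of _ _ "s - p"]) (use s p True in \<open>auto simp: d z\<close>)
    next
      case False
      show ?thesis by (rule image_eqI[of _ _ "s + T - p"]) (use s p False T0 in \<open>auto simp: d z\<close>)
    qed
  qed
  \<comment> \<open>The shifted integral is the increment of \<open>ext F\<close> over one full
    turn, and such an increment does not depend on where the turn starts.\<close>
  define F where "F = (\<lambda>v. integral {0..v} (\<lambda>s. y s * cos (\<theta> s)))"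
  have cont: "continuous_on {0..T} (\<lambda>s. y s * cos (\<theta> s))"
    using a by (auto intro!: continuous_intros)
  have F: "(F has_real_derivative y s * cos (\<theta> s)) (at s within {0..T})" if "s \<in> {0..T}" for s
    unfolding F_def by (rule integral_has_real_derivative[OF cont that])
  have "((\<lambda>s. ext F (s + p)) has_real_derivative ?y s * cos (?t s)) (at s within {0..T})" if "s \<in> {0..T}" for s
    using ext_deriv[OF cont _ that F] a by (simp add: y cs if_distrib split: if_splits)
  then have "((\<lambda>s. ?y s * cos (?t s)) has_integral ext F (T + p) - ext F (0 + p)) {0..T}"
    by (intro fundamental_theorem_of_calculus) (use a in \<open>auto simp: has_real_derivative_iff_has_vector_derivative[symmetric]\<close>)
  moreover have "ext F (T + p) - ext F (0 + p) = F T"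
    using p a(1) by (auto simp: ext_def F_def)
  ultimately show "integral {0..T} (\<lambda>s. ?y s * cos (?t s)) = integral {0..T} (\<lambda>s. y s * cos (\<theta> s))"
    by (simp add: F_def integral_unique)
qed

section \<open>Normalised starting angle and supporting lines\<close>

lemma has_real_derivative_nonneg_imp_nondecreasing:
  fixes f :: "real \<Rightarrow> real"
  assumes "a \<le> b"
    and d: "\<And>x. x \<in> {a..b} \<Longrightarrow> (f has_real_derivative f' x) (at x within {a..b})"
    and nn: "\<And>x. x \<in> {a..b} \<Longrightarrow> 0 \<le> f' x"
  shows "f a \<le> f b"
proof (rule DERIV_nonneg_imp_increasing_open[OF \<open>a \<le> b\<close>])
  show "continuous_on {a..b} f" using d by (rule DERIV_continuous_on)
  fix x assume x: "a < x" "x < b"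
  then have "at x within {a..b} = at x" by (intro at_within_interior) auto
  with d[of x] nn[of x] x show "\<exists>y. (f has_real_derivative y) (at x) \<and> 0 \<le> y" by auto
qed

lemma convex_arc_attains_angle:
  assumes arc: "convex_arc T \<theta> x y" and "\<theta> 0 \<le> g" "g \<le> \<theta> 0 + 2 * pi"
  obtains p where "p \<in> {0..T}" "\<theta> p = g"
  using IVT'[of \<theta> 0 g T] convex_arcD[OF arc] assms by auto

text \<open>Subtracting a multiple of \<open>2 * pi\<close>, found with a floor, brings
  \<open>g\<close> into the range of the angle. The start is moved to a point where this value is
  attained and the multiple is added back, which position and direction do not notice.\<close>

lemma convex_arc_normalize:
  assumes arc: "convex_arc T \<theta> x y"
  obtains \<theta>' x' y' where "convex_arc T \<theta>' x' y'" "\<theta>' 0 = g"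
    "arc_data \<theta>' x' y' ` {0..T} = arc_data \<theta> x y ` {0..T}"
    "integral {0..T} (\<lambda>s. y' s * cos (\<theta>' s)) = integral {0..T} (\<lambda>s. y s * cos (\<theta> s))"
proof -
  define n where "n = \<lfloor>(g - \<theta> 0) / (2 * pi)\<rfloor>"
  define g' where "g' = g - 2 * pi * of_int n"
  have "of_int n \<le> (g - \<theta> 0) / (2 * pi)" "(g - \<theta> 0) / (2 * pi) < of_int n + 1"
    unfolding n_def by (auto simp: floor_correct)
  then have "\<theta> 0 \<le> g'" "g' \<le> \<theta> 0 + 2 * pi"
    by (auto simp: g'_def field_simps)
  then obtain p where p: "p \<in> {0..T}" "\<theta> p = g'" using convex_arc_attains_angle[OF arc] by blast
  obtain \<theta>' x' y' where s: "convex_arc T \<theta>' x' y'" "\<theta>' 0 = \<theta> p"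
    "arc_data \<theta>' x' y' ` {0..T} = arc_data \<theta> x y ` {0..T}"
    "integral {0..T} (\<lambda>s. y' s * cos (\<theta>' s)) = integral {0..T} (\<lambda>s. y s * cos (\<theta> s))"
    by (rule convex_arc_shift[OF arc p(1)])
  define \<theta>2 where "\<theta>2 = (\<lambda>s. \<theta>' s + 2 * pi * of_int n)"
  have c: "cos (\<theta>2 s) = cos (\<theta>' s)" "sin (\<theta>2 s) = sin (\<theta>' s)" for s
    unfolding \<theta>2_def by (simp_all add: cos_add sin_add)
  show ?thesis
  proof
    show "convex_arc T \<theta>2 x' y'"
      using s(1) unfolding convex_arc_def c
      by (auto simp: \<theta>2_def intro!: continuous_intros mono_onI dest: mono_onD)
    show "\<theta>2 0 = g" using s p by (simp add: \<theta>2_def g'_def)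
    have d: "arc_data \<theta>2 x' y' = arc_data \<theta>' x' y'" by (rule ext) (simp add: arc_data_def c)
    show "arc_data \<theta>2 x' y' ` {0..T} = arc_data \<theta> x y ` {0..T}" unfolding d by (rule s)
    show "integral {0..T} (\<lambda>s. y' s * cos (\<theta>2 s)) = integral {0..T} (\<lambda>s. y s * cos (\<theta> s))"
      using s by (simp add: c)
  qed
qed

text \<open>The function is the inner product of the position with \<open>(- sin g, cos g)\<close>,
  that is, the height to the left of a line of direction \<open>g\<close>.\<close>

lemma convex_arc_height_deriv:
  assumes arc: "convex_arc T \<theta> x y" and s: "s \<in> {0..T}"
  shows "((\<lambda>s. cos g * y s - sin g * x s) has_real_derivative sin (\<theta> s - g)) (at s within {0..T})"
  using convex_arcD(7,8)[OF arc s] by (auto intro!: derivative_eq_intros simp: sin_diff)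

text \<open>With this start the angle stays between \<open>g - pi\<close> and \<open>g + pi\<close>,
  so the height decreases while the angle is at most \<open>g\<close> and increases afterwards. If
  the minimum is attained again at \<open>v\<close>, the height is constant between \<open>u\<close>
  and \<open>v\<close>, and its derivative would have to vanish there.\<close>

lemma convex_arc_height_min_aux:
  assumes arc: "convex_arc T \<theta> x y" and start: "\<theta> 0 = g - pi"
    and u: "u \<in> {0..T}" "\<theta> u = g" and v: "v \<in> {0..T}"
  defines "f \<equiv> \<lambda>s. cos g * y s - sin g * x s"
  shows "f u \<le> f v" "f u = f v \<Longrightarrow> \<theta> v = g"
proof -
  note a = convex_arcD[OF arc]
  have f: "(f has_real_derivative sin (\<theta> s - g)) (at s within A)" if "s \<in> A" "A \<subseteq> {0..T}" for s A
    unfolding f_def using convex_arc_height_deriv[OF arc] that DERIV_subset by blast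
  have rng: "g - pi \<le> \<theta> s" "\<theta> s \<le> g + pi" if "s \<in> {0..T}" for s
    using mono_onD[OF a(3), of 0 s] mono_onD[OF a(3), of s T] a that start by auto
  have up: "f r \<le> f s" if "r \<in> {0..T}" "s \<in> {0..T}" "r \<le> s" "\<theta> r \<ge> g" for r s
  proof (rule has_real_derivative_nonneg_imp_nondecreasing[of r s f])
    fix z assume z: "z \<in> {r..s}"
    show "(f has_real_derivative sin (\<theta> z - g)) (at z within {r..s})"
      by (rule f) (use that z in auto)
    show "0 \<le> sin (\<theta> z - g)"
      using rng[of z] mono_onD[OF a(3), of r z] z that by (intro sin_ge_zero) auto
  qed (use that in auto)
  have down: "f s \<le> f r" if "r \<in> {0..T}" "s \<in> {0..T}" "r \<le> s" "\<theta> s \<le> g" for r s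
  proof -
    have "- f r \<le> - f s"
    proof (rule has_real_derivative_nonneg_imp_nondecreasing[of r s "\<lambda>s. - f s"])
      fix z assume z: "z \<in> {r..s}"
      show "((\<lambda>s. - f s) has_real_derivative - sin (\<theta> z - g)) (at z within {r..s})"
        by (rule DERIV_minus, rule f) (use that z in auto)
      have "0 \<le> sin (g - \<theta> z)"
        using rng[of z] mono_onD[OF a(3), of z s] z that by (intro sin_ge_zero) auto
      then show "0 \<le> - sin (\<theta> z - g)" by (metis minus_diff_eq sin_minus)
    qed (use that in auto)
    then show ?thesis by simp
  qed
  show le: "f u \<le> f v" using up[of u v] down[of v u] u v by (cases "u \<le> v") auto
  assume eq: "f u = f v"
  show "\<theta> v = g"
  proof (rule ccontr)
    assume neq: "\<theta> v \<noteq> g"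
    define a where "a = min u v"
    define b where "b = max u v"
    have ab: "a \<le> b" "{a..b} \<subseteq> {0..T}" using u v by (auto simp: a_def b_def)
    \<comment> \<open>The midpoint value is used because \<open>\<theta> v\<close> itself may be
      \<open>g - pi\<close> or \<open>g + pi\<close>, where the sine vanishes as well. Half of a
      nonzero difference of size at most \<open>pi\<close> has nonzero sine.\<close>
    have "\<exists>w. w \<in> {a..b} \<and> \<theta> w = (g + \<theta> v) / 2"
    proof (cases "u \<le> v")
      case True
      then have "\<theta> u \<le> \<theta> v" using mono_onD[OF convex_arcD(3)[OF arc] u(1) v] by simp
      then show ?thesis
        using IVT'[of \<theta> u "(g + \<theta> v) / 2" v] True u continuous_on_subset[OF convex_arcD(2)[OF arc] ab(2)]
        by (auto simp: a_def b_def)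
    next
      case False
      then have "\<theta> v \<le> \<theta> u" using mono_onD[OF convex_arcD(3)[OF arc] v u(1)] by simp
      then show ?thesis
        using IVT'[of \<theta> v "(g + \<theta> v) / 2" u] False u continuous_on_subset[OF convex_arcD(2)[OF arc] ab(2)]
        by (auto simp: a_def b_def)
    qed
    then obtain w where w: "w \<in> {a..b}" "\<theta> w = (g + \<theta> v) / 2" by blast
    have wne: "w \<noteq> u" "w \<noteq> v" using w u neq by auto
    then have ws: "w \<in> {a<..<b}" using w by (auto simp: a_def b_def min_def max_def split: if_splits)
    have const: "f s = f u" if s: "s \<in> {a<..<b}" for s
    proof (cases "u \<le> v")
      case True
      then have "f u \<le> f s" "f s \<le> f v"
        using s u v mono_onD[OF convex_arcD(3)[OF arc], of u s] by (auto simp: a_def b_def intro!: up)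
      then show ?thesis using eq by simp
    next
      case False
      then have "f u \<le> f s" "f s \<le> f v"
        using s u v mono_onD[OF convex_arcD(3)[OF arc], of s u] by (auto simp: a_def b_def intro!: down)
      then show ?thesis using eq by simp
    qed
    have 1: "(f has_real_derivative sin (\<theta> w - g)) (at w)"
    proof -
      have "(f has_real_derivative sin (\<theta> w - g)) (at w within {a<..<b})"
        by (rule f) (use ws ab in auto)
      then show ?thesis using at_within_open[OF ws] by simp
    qed
    have "((\<lambda>_. f u) has_real_derivative 0) (at w)" by simp
    then have 2: "(f has_real_derivative 0) (at w)"
      by (rule has_field_derivative_transform_within_open[of _ _ _ "{a<..<b}"]) (use ws const in auto)
    have z: "sin (\<theta> w - g) = 0" using DERIV_unique[OF 1 2] .
    have d: "\<theta> w - g = (\<theta> v - g) / 2" using w by (simp add: field_simps)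
    show False
    proof (cases "\<theta> v > g")
      case True
      then show False using sin_gt_zero[of "(\<theta> v - g) / 2"] rng[OF v] pi_gt_zero z d by simp
    next
      case False
      with neq have "\<theta> v < g" by simp
      then have "0 < - ((\<theta> v - g) / 2)" "- ((\<theta> v - g) / 2) < pi"
        using rng[OF v] pi_gt_zero by (simp, simp add: field_simps)
      from sin_gt_zero[OF this] show False using z d unfolding sin_minus by simp
    qed
  qed
qed

text \<open>The arc is restarted at angle \<open>\<theta> u - pi\<close>. In the resulting range
  only the value \<open>\<theta> u\<close> has the direction of \<open>\<theta> u\<close>, so the
  point \<open>u\<close> becomes the minimum of the height. Contact is described through
  \<open>cos\<close> and \<open>sin\<close> because the angle itself changes under the
  restart.\<close>

lemma convex_arc_support:
  assumes arc: "convex_arc T \<theta> x y" and u: "u \<in> {0..T}" and v: "v \<in> {0..T}"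
  shows "cos (\<theta> u) * (y v - y u) - sin (\<theta> u) * (x v - x u) \<ge> 0"
    and "cos (\<theta> u) * (y v - y u) - sin (\<theta> u) * (x v - x u) = 0 \<Longrightarrow>
      cos (\<theta> v) = cos (\<theta> u) \<and> sin (\<theta> v) = sin (\<theta> u)"
proof -
  let ?g = "\<theta> u"
  obtain \<theta>' x' y' where s: "convex_arc T \<theta>' x' y'" "\<theta>' 0 = ?g - pi"
    "arc_data \<theta>' x' y' ` {0..T} = arc_data \<theta> x y ` {0..T}"
    using convex_arc_normalize[OF arc] by metis
  have "arc_data \<theta> x y u \<in> arc_data \<theta>' x' y' ` {0..T}" "arc_data \<theta> x y v \<in> arc_data \<theta>' x' y' ` {0..T}"
    using s(3) u v by auto
  then obtain u' v' where uv: "u' \<in> {0..T}" "v' \<in> {0..T}"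
    "x' u' = x u" "y' u' = y u" "cos (\<theta>' u') = cos ?g" "sin (\<theta>' u') = sin ?g"
    "x' v' = x v" "y' v' = y v" "cos (\<theta>' v') = cos (\<theta> v)" "sin (\<theta>' v') = sin (\<theta> v)"
    by (auto simp: arc_data_def)
  have "\<theta>' u' = ?g"
  proof -
    note a = convex_arcD[OF s(1)]
    have "?g - pi \<le> \<theta>' u'" "\<theta>' u' \<le> ?g + pi"
      using mono_onD[OF a(3), of 0 u'] mono_onD[OF a(3), of u' T] a uv s(2) by auto
    then have b: "- pi \<le> \<theta>' u' - ?g" "\<theta>' u' - ?g \<le> pi" by auto
    have c: "cos (\<theta>' u' - ?g) = 1" unfolding cos_diff uv(5,6)
      by (metis power2_eq_square sin_cos_squared_add2)
    show ?thesis
    proof (cases "\<theta>' u' \<ge> ?g")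
      case True
      then show ?thesis using cos_inj_pi[of "\<theta>' u' - ?g" 0] b c by simp
    next
      case False
      moreover have "cos (?g - \<theta>' u') = 1" using c by (metis cos_minus minus_diff_eq)
      ultimately show ?thesis using cos_inj_pi[of "?g - \<theta>' u'" 0] b by simp
    qed
  qed
  note m = convex_arc_height_min_aux[OF s(1,2) uv(1) this uv(2)]
  show "cos (\<theta> u) * (y v - y u) - sin (\<theta> u) * (x v - x u) \<ge> 0"
    using m(1) uv by (simp add: algebra_simps)
  assume "cos (\<theta> u) * (y v - y u) - sin (\<theta> u) * (x v - x u) = 0"
  then have "\<theta>' v' = ?g" using m(2) uv by (simp add: algebra_simps)
  then show "cos (\<theta> v) = cos (\<theta> u) \<and> sin (\<theta> v) = sin (\<theta> u)" using uv by simp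
qed

section \<open>Flat pieces of the arc and faces of its convex hull\<close>

lemma convex_arc_attains_direction:
  assumes arc: "convex_arc T \<theta> x y"
  obtains u where "u \<in> {0..T}" "cos (\<theta> u) = cos g" "sin (\<theta> u) = sin g"
proof -
  obtain \<theta>' x' y' where s: "convex_arc T \<theta>' x' y'" "\<theta>' 0 = g"
    "arc_data \<theta>' x' y' ` {0..T} = arc_data \<theta> x y ` {0..T}"
    using convex_arc_normalize[OF arc] by metis
  have "0 \<in> {0..T}" using convex_arcD(1)[OF arc] by simp
  then have "arc_data \<theta>' x' y' 0 \<in> arc_data \<theta> x y ` {0..T}" using s(3) by auto
  then show thesis using s(2) that by (auto simp: arc_data_def)
qed

text \<open>In this form the inner product of \<open>a\<close> with a position is \<open>r\<close>
  times the height belonging to direction \<open>g\<close>, so every hyperplane can be compared with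
  a tangent line.\<close>

lemma normal_vector_angle:
  fixes a :: "real \<times> real"
  assumes "a \<noteq> 0"
  obtains r g where "0 < r" "a = (- r * sin g, r * cos g)"
proof -
  define r where "r = norm a"
  have r: "0 < r" "r\<^sup>2 = (fst a)\<^sup>2 + (snd a)\<^sup>2"
    using assms by (simp add: r_def, simp add: r_def norm_prod_def)
  have "(snd a / r)\<^sup>2 + (- fst a / r)\<^sup>2 = ((fst a)\<^sup>2 + (snd a)\<^sup>2) / r\<^sup>2"
    by (simp add: power_divide add_divide_distrib)
  then have "(snd a / r)\<^sup>2 + (- fst a / r)\<^sup>2 = 1" using r(1) unfolding r(2)[symmetric] by simp
  then obtain g where "snd a / r = cos g" "- fst a / r = sin g"
    using sincos_total_2pi_le by metis
  with r that[of r g] show thesis by (cases a) (auto simp: field_simps)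
qed

text \<open>By monotonicity the parameters with angle \<open>g\<close> form an interval, on which
  the arc moves at unit speed in a fixed direction. The image is a translated linear image of that
  interval.\<close>

lemma convex_arc_flat_convex_aux:
  assumes arc: "convex_arc T \<theta> x y"
  shows "convex ((\<lambda>s. (x s, y s)) ` {s\<in>{0..T}. \<theta> s = g})"
proof -
  note a = convex_arcD[OF arc]
  let ?I = "{s\<in>{0..T}. \<theta> s = g}"
  have I: "convex ?I"
    unfolding is_interval_convex_1[symmetric] is_interval_1
  proof (intro ballI allI impI)
    fix r s t assume "r \<in> ?I" "s \<in> ?I" "r \<le> t \<and> t \<le> s"
    then show "t \<in> ?I" using mono_onD[OF a(3), of r t] mono_onD[OF a(3), of t s] by auto
  qed
  have "\<exists>c. \<forall>s\<in>?I. x s - s * cos g = c"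
    by (rule has_field_derivative_zero_constant[OF I])
      (auto intro!: derivative_eq_intros DERIV_subset[OF a(7)])
  moreover have "\<exists>c. \<forall>s\<in>?I. y s - s * sin g = c"
    by (rule has_field_derivative_zero_constant[OF I])
      (auto intro!: derivative_eq_intros DERIV_subset[OF a(8)])
  ultimately obtain c d where cd: "\<And>s. s \<in> ?I \<Longrightarrow> x s - s * cos g = c \<and> y s - s * sin g = d" by metis
  then have "(\<lambda>s. (x s, y s)) ` ?I = (\<lambda>s. (c, d) + s *\<^sub>R (cos g, sin g)) ` ?I"
    by (intro image_cong) (auto simp: algebra_simps)
  also have "\<dots> = (+) (c, d) ` ((\<lambda>s. s *\<^sub>R (cos g, sin g)) ` ?I)" by (simp only: image_image)
  also have "convex \<dots>"
    by (rule convex_translation, rule convex_linear_image[OF _ I]) (auto intro!: linearI simp: algebra_simps)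
  finally show ?thesis .
qed

text \<open>Restarting at \<open>g - pi\<close> puts direction \<open>g\<close> in the middle of the
  angle range, where it corresponds to the single value \<open>g\<close>. A start at
  \<open>g\<close> would split the flat piece between the two ends of the parameter
  interval.\<close>

lemma convex_arc_flat_convex:
  assumes arc: "convex_arc T \<theta> x y"
  shows "convex ((\<lambda>s. (x s, y s)) ` {s\<in>{0..T}. cos (\<theta> s) = cos g \<and> sin (\<theta> s) = sin g})"
proof -
  obtain \<theta>' x' y' where s: "convex_arc T \<theta>' x' y'" "\<theta>' 0 = g - pi"
    "arc_data \<theta>' x' y' ` {0..T} = arc_data \<theta> x y ` {0..T}"
    using convex_arc_normalize[OF arc] by metis
  note a = convex_arcD[OF s(1)]
  have iff: "cos (\<theta>' u) = cos g \<and> sin (\<theta>' u) = sin g \<longleftrightarrow> \<theta>' u = g" if u: "u \<in> {0..T}" for u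
  proof
    assume "cos (\<theta>' u) = cos g \<and> sin (\<theta>' u) = sin g"
    then have "cos (\<theta>' u - g) = 1" unfolding cos_diff
      by (metis power2_eq_square sin_cos_squared_add2)
    moreover then have "cos (g - \<theta>' u) = 1" by (metis cos_minus minus_diff_eq)
    moreover have "g - pi \<le> \<theta>' u" "\<theta>' u \<le> g + pi"
      using mono_onD[OF a(3), of 0 u] mono_onD[OF a(3), of u T] a u s(2) by auto
    ultimately show "\<theta>' u = g"
      using cos_inj_pi[of "\<theta>' u - g" 0] cos_inj_pi[of "g - \<theta>' u" 0] by (cases "g \<le> \<theta>' u") auto
  qed auto
  have img: "(\<lambda>s. (x s, y s)) ` {s\<in>{0..T}. cos (\<theta> s) = cos g \<and> sin (\<theta> s) = sin g} =
      {(a, b) | a b. (a, b, cos g, sin g) \<in> arc_data \<theta> x y ` {0..T}}" for \<theta> x y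
    by (force simp: arc_data_def)
  have "(\<lambda>s. (x s, y s)) ` {s\<in>{0..T}. cos (\<theta> s) = cos g \<and> sin (\<theta> s) = sin g} =
      (\<lambda>s. (x' s, y' s)) ` {s\<in>{0..T}. cos (\<theta>' s) = cos g \<and> sin (\<theta>' s) = sin g}"
    unfolding img s(3) ..
  also have "{s\<in>{0..T}. cos (\<theta>' s) = cos g \<and> sin (\<theta>' s) = sin g} = {s\<in>{0..T}. \<theta>' s = g}"
    using iff by blast
  finally show ?thesis using convex_arc_flat_convex_aux[OF s(1)] by simp
qed

text \<open>Supporting tangent lines keep the arc out of the interior of the hull. Conversely, a
  boundary point of the hull lies on a supporting line, and the corresponding face is the hull of
  the arc points on that line. These all share one tangent direction, so they lie on a flat piece of
  the arc, which is already convex and hence contains the face.\<close>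

lemma convex_arc_bounds_domain:
  assumes arc: "convex_arc T \<theta> x y"
  defines "S \<equiv> (\<lambda>s. (x s, y s)) ` {0..T}"
  shows "open (interior (convex hull S))" "bounded (interior (convex hull S))"
    "convex (interior (convex hull S))" "frontier (interior (convex hull S)) = S"
proof -
  note a = convex_arcD[OF arc]
  let ?K = "convex hull S"
  have compS: "compact S" unfolding S_def
    by (intro compact_continuous_image) (use a in \<open>auto intro!: continuous_intros\<close>)
  then have compK: "compact ?K" by (rule compact_convex_hull)
  have convK: "convex ?K" by simp
  show "open (interior ?K)" "convex (interior ?K)" by (auto intro: convex_interior)
  show "bounded (interior ?K)"
    using compK compact_imp_bounded bounded_subset interior_subset by blast
  have low: "(- r * sin (\<theta> u), r * cos (\<theta> u)) \<bullet> (x u, y u) \<le> (- r * sin (\<theta> u), r * cos (\<theta> u)) \<bullet> p"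
    if "0 < r" "u \<in> {0..T}" "p \<in> ?K" for r u p
  proof -
    let ?n = "(- r * sin (\<theta> u), r * cos (\<theta> u))"
    have "S \<subseteq> {p. ?n \<bullet> p \<ge> ?n \<bullet> (x u, y u)}"
    proof
      fix p assume "p \<in> S"
      then obtain v where v: "v \<in> {0..T}" "p = (x v, y v)" by (auto simp: S_def)
      have "0 \<le> r * (cos (\<theta> u) * (y v - y u) - sin (\<theta> u) * (x v - x u))"
        using convex_arc_support(1)[OF arc that(2) v(1)] that(1) by simp
      then show "p \<in> {p. ?n \<bullet> p \<ge> ?n \<bullet> (x u, y u)}"
        by (simp add: v algebra_simps)
    qed
    then have "?K \<subseteq> {p. ?n \<bullet> p \<ge> ?n \<bullet> (x u, y u)}"
      by (rule hull_minimal) (rule convex_halfspace_ge)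
    then show ?thesis using that by auto
  qed
  \<comment> \<open>If the hull lay in a line of direction \<open>g\<close>, the arc points of
    directions \<open>g\<close> and \<open>g + pi\<close> would be at the same height. Contact with
    a tangent line forces equal directions, a contradiction.\<close>
  have ne: "interior ?K \<noteq> {}"
  proof
    assume "interior ?K = {}"
    then obtain n b where n: "n \<noteq> 0" "?K \<subseteq> {p. n \<bullet> p = b}"
      using empty_interior_subset_hyperplane[OF convK] by metis
    obtain r g where r: "0 < r" "n = (- r * sin g, r * cos g)" using normal_vector_angle[OF n(1)] .
    obtain u where u: "u \<in> {0..T}" "cos (\<theta> u) = cos g" "sin (\<theta> u) = sin g"
      using convex_arc_attains_direction[OF arc] .
    obtain v where v: "v \<in> {0..T}" "cos (\<theta> v) = cos (g + pi)" "sin (\<theta> v) = sin (g + pi)"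
      using convex_arc_attains_direction[OF arc] .
    have "(x u, y u) \<in> ?K" "(x v, y v) \<in> ?K" using u v by (auto simp: S_def intro!: hull_inc)
    then have "n \<bullet> (x u, y u) = n \<bullet> (x v, y v)" using n by auto
    then have "r * (cos g * (y v - y u) - sin g * (x v - x u)) = 0" by (simp add: r algebra_simps)
    then have "cos (\<theta> u) * (y v - y u) - sin (\<theta> u) * (x v - x u) = 0" using r u by simp
    from convex_arc_support(2)[OF arc u(1) v(1) this] have "- cos g = cos g" "- sin g = sin g"
      using u v by simp_all
    then have "cos g = 0" "sin g = 0" by auto
    then show False using sin_cos_squared_add[of g] by simp
  qed
  have fr: "frontier (interior ?K) = ?K - interior ?K"
    using convex_closure_interior[OF convK ne] compK
    by (simp add: frontier_def compact_imp_closed)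
  show "frontier (interior ?K) = S"
    unfolding fr
  proof (intro equalityI subsetI)
    fix p assume "p \<in> S"
    then obtain u where u: "u \<in> {0..T}" "p = (x u, y u)" by (auto simp: S_def)
    let ?n = "(- 1 * sin (\<theta> u), 1 * cos (\<theta> u))"
    have nz: "?n \<noteq> 0"
    proof
      assume "?n = 0"
      then have "sin (\<theta> u) = 0" "cos (\<theta> u) = 0" by (simp_all add: zero_prod_def)
      then show False using sin_cos_squared_add[of "\<theta> u"] by simp
    qed
    have "?K \<subseteq> {q. ?n \<bullet> q \<ge> ?n \<bullet> p}" using low[OF zero_less_one u(1)] u(2) by auto
    then have "interior ?K \<subseteq> {q. ?n \<bullet> q > ?n \<bullet> p}"
      using interior_mono interior_halfspace_ge[OF nz] by metis
    then have "p \<notin> interior ?K" by auto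
    with \<open>p \<in> S\<close> show "p \<in> ?K - interior ?K" by (auto intro: hull_inc)
  next
    fix p assume p: "p \<in> ?K - interior ?K"
    then have "p \<notin> rel_interior ?K" using rel_interior_nonempty_interior[OF ne] by simp
    then obtain n where n: "n \<noteq> 0" "\<And>q. q \<in> ?K \<Longrightarrow> n \<bullet> p \<le> n \<bullet> q"
      using supporting_hyperplane_rel_boundary[OF convK, of p] p by (metis Diff_iff)
    obtain r g where r: "0 < r" "n = (- r * sin g, r * cos g)" using normal_vector_angle[OF n(1)] .
    obtain u where u: "u \<in> {0..T}" "cos (\<theta> u) = cos g" "sin (\<theta> u) = sin g"
      using convex_arc_attains_direction[OF arc] .
    define b where "b = n \<bullet> p"
    have uK: "(x u, y u) \<in> ?K" using u by (auto simp: S_def intro!: hull_inc)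
    have b: "n \<bullet> (x u, y u) = b"
      using low[OF r(1) u(1), of p] n(2)[OF uK] p by (simp add: b_def r u)
    \<comment> \<open>A face of the hull of a compact set is the hull of a subset of that set. This
      is what reduces the boundary point \<open>p\<close>, which need not be extreme, to points of
      the arc.\<close>
    have "(?K \<inter> {q. n \<bullet> q = b}) face_of ?K"
      by (rule face_of_Int_supporting_hyperplane_ge[OF convK]) (simp add: b_def n(2))
    then obtain S' where S': "S' \<subseteq> S" "?K \<inter> {q. n \<bullet> q = b} = convex hull S'"
      using face_of_convex_hull_subset[OF compS] by metis
    let ?M = "(\<lambda>s. (x s, y s)) ` {s\<in>{0..T}. cos (\<theta> s) = cos g \<and> sin (\<theta> s) = sin g}"
    have "S' \<subseteq> ?M"
    proof
      fix q assume q: "q \<in> S'"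
      then obtain v where v: "v \<in> {0..T}" "q = (x v, y v)" using S' by (auto simp: S_def)
      have "n \<bullet> q = b" using q S'(2) hull_inc[of q S' convex] by auto
      then have "r * (cos g * (y v - y u) - sin g * (x v - x u)) = 0"
        using b by (simp add: r v algebra_simps)
      then have "cos (\<theta> u) * (y v - y u) - sin (\<theta> u) * (x v - x u) = 0" using r u by simp
      from convex_arc_support(2)[OF arc u(1) v(1) this] show "q \<in> ?M" using u v by auto
    qed
    then have "convex hull S' \<subseteq> ?M" by (rule hull_minimal) (rule convex_arc_flat_convex[OF arc])
    moreover have "p \<in> convex hull S'" using S'(2) p by (auto simp: b_def)
    ultimately show "p \<in> S" by (auto simp: S_def)
  qed
qed

section \<open>Area enclosed by a convex arc\<close>

lemma convex_open_slice:
  fixes \<Omega> :: "(real \<times> real) set"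
  assumes "open \<Omega>" "bounded \<Omega>" "convex \<Omega>" and ne: "(z, w) \<in> \<Omega>"
  obtains a b where "a < b" "Pair z -` \<Omega> = {a<..<b}" "(z, a) \<in> frontier \<Omega>" "(z, b) \<in> frontier \<Omega>"
proof -
  let ?W = "Pair z -` \<Omega>"
  have W: "open ?W" by (rule open_vimage[OF assms(1)]) (auto intro!: continuous_intros)
  have "is_interval ?W"
    unfolding is_interval_convex_1
  proof (rule convexI)
    fix x y u v :: real assume "x \<in> ?W" "y \<in> ?W" "0 \<le> u" "0 \<le> v" "u + v = 1"
    moreover from this have "u *\<^sub>R (z, x) + v *\<^sub>R (z, y) \<in> \<Omega>"
      using convexD[OF assms(3), of "(z, x)" "(z, y)" u v] by auto
    moreover have "u *\<^sub>R (z, x) + v *\<^sub>R (z, y) = (z, u *\<^sub>R x + v *\<^sub>R y)"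
      using \<open>u + v = 1\<close> by (simp add: distrib_right[symmetric])
    ultimately show "u *\<^sub>R x + v *\<^sub>R y \<in> ?W" by simp
  qed
  then have int: "t \<in> ?W" if "r \<in> ?W" "s \<in> ?W" "r \<le> t" "t \<le> s" for r s t
    using that unfolding is_interval_1 by blast
  have "bounded (snd ` \<Omega>)" by (rule bounded_snd[OF assms(2)])
  then have bdd: "bounded ?W" by (rule bounded_subset) force
  then have bd: "bdd_above ?W" "bdd_below ?W" by (auto intro: bounded_imp_bdd_above bounded_imp_bdd_below)
  have wW: "w \<in> ?W" using ne by simp
  define a where "a = Inf ?W"
  define b where "b = Sup ?W"
  have ab: "a \<le> t" "t \<le> b" if "t \<in> ?W" for t
    using that bd by (auto simp: a_def b_def intro: cInf_lower cSup_upper)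
  have notin: "a \<notin> ?W" "b \<notin> ?W"
  proof -
    show "a \<notin> ?W"
    proof
      assume "a \<in> ?W"
      then obtain e where "0 < e" "ball a e \<subseteq> ?W" using W open_contains_ball by blast
      then have "a - e / 2 \<in> ?W" by (auto simp: dist_real_def subset_eq)
      then show False using ab[of "a - e / 2"] \<open>0 < e\<close> by simp
    qed
    show "b \<notin> ?W"
    proof
      assume "b \<in> ?W"
      then obtain e where "0 < e" "ball b e \<subseteq> ?W" using W open_contains_ball by blast
      then have "b + e / 2 \<in> ?W" by (auto simp: dist_real_def subset_eq)
      then show False using ab[of "b + e / 2"] \<open>0 < e\<close> by simp
    qed
  qed
  have eq: "?W = {a<..<b}"
  proof (intro equalityI subsetI)
    fix t assume "t \<in> ?W"
    then show "t \<in> {a<..<b}" using ab notin by (metis greaterThanLessThan_iff order_le_less)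
  next
    fix t assume t: "t \<in> {a<..<b}"
    obtain r where r: "r \<in> ?W" "r < t" using cInf_lessD[of ?W t] t wW by (auto simp: a_def)
    obtain s where s: "s \<in> ?W" "t < s" using less_cSupD[of ?W t] t wW by (auto simp: b_def)
    show "t \<in> ?W" by (rule int[OF r(1) s(1)]) (use r s in auto)
  qed
  have cl: "(z, t) \<in> closure \<Omega>" if "t \<in> closure ?W" for t
  proof -
    have "Pair z ` closure ?W \<subseteq> closure \<Omega>"
      by (rule image_closure_subset) (use closure_subset in \<open>auto intro!: continuous_intros\<close>)
    then show ?thesis using that by auto
  qed
  have "a \<in> closure ?W" "b \<in> closure ?W"
    using bd wW closure_contains_Inf[of ?W] closure_contains_Sup[of ?W] by (auto simp: a_def b_def)
  then have "(z, a) \<in> frontier \<Omega>" "(z, b) \<in> frontier \<Omega>"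
    using cl notin assms(1) by (auto simp: frontier_def interior_open)
  then show thesis using that[of a b] eq wW by auto
qed

lemma cos_sign_shifted_period:
  assumes "- (pi/2) \<le> t" "t \<le> 3 * pi / 2"
  shows "t \<le> pi/2 \<Longrightarrow> 0 \<le> cos t" "pi/2 \<le> t \<Longrightarrow> cos t \<le> 0"
proof -
  show "t \<le> pi/2 \<Longrightarrow> 0 \<le> cos t" using assms by (intro cos_ge_zero) auto
  assume "pi/2 \<le> t"
  then have "0 \<le> cos (t - pi)" using assms by (intro cos_ge_zero) auto
  then show "cos t \<le> 0" by simp
qed

text \<open>Starting at angle \<open>- (pi/2)\<close> means starting at a leftmost point. Until the
  angle reaches \<open>pi/2\<close> the abscissa does not decrease and the arc runs along the lower
  boundary; afterwards it returns along the upper one. Vertical slices are the intervals between the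
  two graphs, and the substitution of the abscissa by arc length, with Jacobian
  \<open>\<bar>cos (\<theta> s)\<bar>\<close>, turns their total length into the line integral.
  Parameters with \<open>cos (\<theta> s) = 0\<close> contribute nothing.\<close>

lemma convex_arc_area_aux:
  assumes arc: "convex_arc T \<theta> x y" and start: "\<theta> 0 = - (pi/2)"
    and \<Omega>: "open \<Omega>" "bounded \<Omega>" "convex \<Omega>" "frontier \<Omega> = (\<lambda>s. (x s, y s)) ` {0..T}"
  shows "measure lborel \<Omega> = - integral {0..T} (\<lambda>s. y s * cos (\<theta> s))"
proof -
  note a = convex_arcD[OF arc]
  note sup = convex_arc_support[OF arc]
  have T0: "0 \<in> {0..T}" "T \<in> {0..T}" using a by auto
  have rng: "- (pi/2) \<le> \<theta> s" "\<theta> s \<le> 3 * pi / 2" if "s \<in> {0..T}" for s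
    using mono_onD[OF a(3), of 0 s] mono_onD[OF a(3), of s T] a that start by auto
  obtain q where q: "q \<in> {0..T}" "\<theta> q = pi/2"
    using convex_arc_attains_angle[OF arc, of "pi/2"] start by auto
  have x0: "x 0 \<le> x s" and xq: "x s \<le> x q" if "s \<in> {0..T}" for s
    using sup(1)[OF T0(1) that] sup(1)[OF q(1) that] by (simp_all add: start q)
  \<comment> \<open>A point with vertical tangent lies on an extreme vertical line, by the
    supporting property applied at that point. A point on an extreme vertical line has vertical
    tangent, by the contact case applied at \<open>0\<close> and at \<open>q\<close>.\<close>
  have strict: "cos (\<theta> s) \<noteq> 0 \<longleftrightarrow> x s \<in> {x 0<..<x q}" if s: "s \<in> {0..T}" for s
  proof
    assume c: "cos (\<theta> s) \<noteq> 0"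
    have "x s \<noteq> x 0" "x s \<noteq> x q"
      using sup(2)[OF T0(1) s] sup(2)[OF q(1) s] c by (auto simp: start q)
    then show "x s \<in> {x 0<..<x q}" using x0[OF s] xq[OF s] by auto
  next
    assume x: "x s \<in> {x 0<..<x q}"
    show "cos (\<theta> s) \<noteq> 0"
    proof
      assume c: "cos (\<theta> s) = 0"
      then have "(sin (\<theta> s))\<^sup>2 = 1" using sin_cos_squared_add[of "\<theta> s"] by simp
      then consider "sin (\<theta> s) = 1" | "sin (\<theta> s) = -1" by (auto simp: power2_eq_1_iff)
      then show False
        using sup(1)[OF s q(1)] sup(1)[OF s T0(1)] x c by cases auto
    qed
  qed
  define S1 where "S1 = {s\<in>{0..T}. 0 < cos (\<theta> s)}"
  define S2 where "S2 = {s\<in>{0..T}. cos (\<theta> s) < 0}"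
  have S1: "x ` S1 = {x 0<..<x q}"
  proof (intro equalityI subsetI)
    fix z assume "z \<in> x ` S1" then show "z \<in> {x 0<..<x q}" using strict by (force simp: S1_def)
  next
    fix z assume z: "z \<in> {x 0<..<x q}"
    obtain s where s: "0 \<le> s" "s \<le> q" "x s = z"
      using IVT'[of x 0 z q] z q continuous_on_subset[OF a(9), of "{0..q}"] by auto
    have sT: "s \<in> {0..T}" using s q by auto
    have "\<theta> s \<le> pi/2" using mono_onD[OF a(3) sT q(1)] s q by simp
    then have "0 \<le> cos (\<theta> s)" using cos_sign_shifted_period rng[OF sT] by auto
    then show "z \<in> x ` S1" using strict[OF sT] s z sT by (auto simp: S1_def intro!: image_eqI[of _ _ s])
  qed
  have S2: "x ` S2 = {x 0<..<x q}"
  proof (intro equalityI subsetI)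
    fix z assume "z \<in> x ` S2" then show "z \<in> {x 0<..<x q}" using strict by (force simp: S2_def)
  next
    fix z assume z: "z \<in> {x 0<..<x q}"
    obtain s where s: "q \<le> s" "s \<le> T" "x s = z"
      using IVT2'[of x T z q] z q a(5) continuous_on_subset[OF a(9), of "{q..T}"] by auto
    have sT: "s \<in> {0..T}" using s q by auto
    have "\<theta> s \<ge> pi/2" using mono_onD[OF a(3) q(1) sT] s q by simp
    then have "cos (\<theta> s) \<le> 0" using cos_sign_shifted_period rng[OF sT] by auto
    then show "z \<in> x ` S2" using strict[OF sT] s z sT by (auto simp: S2_def intro!: image_eqI[of _ _ s])
  qed
  have S1lt: "\<theta> s < pi/2" if "s \<in> S1" for s
    using cos_sign_shifted_period(2)[of "\<theta> s"] rng[of s] that by (force simp: S1_def)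
  have S2gt: "pi/2 < \<theta> s" if "s \<in> S2" for s
    using cos_sign_shifted_period(1)[of "\<theta> s"] rng[of s] that by (force simp: S2_def)
  \<comment> \<open>The factor \<open>e\<close> is the sign of the cosine on a branch, 1 on the
    lower and -1 on the upper one. Equal abscissas at \<open>s\<close> and \<open>r\<close> make the
    abscissa constant in between, which is how injectivity on each branch will be
    contradicted.\<close>
  have const: "cos (\<theta> t) = 0" if st: "s \<in> {0..T}" "r \<in> {0..T}" "s < t" "t < r" "x s = x r"
    and mono: "\<And>t. t \<in> {s..r} \<Longrightarrow> 0 \<le> e * cos (\<theta> t)" and e: "e \<noteq> 0" for s r t e
  proof -
    have d: "((\<lambda>s. e * x s) has_real_derivative e * cos (\<theta> t)) (at t within A)"
      if "t \<in> A" "A \<subseteq> {0..T}" for t A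
      by (rule DERIV_cmult, rule DERIV_subset[OF a(7)]) (use that in auto)
    have le: "e * x s' \<le> e * x r'" if "s \<le> s'" "s' \<le> r'" "r' \<le> r" for s' r'
      by (rule has_real_derivative_nonneg_imp_nondecreasing[of s' r' "\<lambda>s. e * x s" "\<lambda>s. e * cos (\<theta> s)"])
        (use that st in \<open>auto intro!: d mono\<close>)
    have c: "e * x t = e * x s" if "t \<in> {s<..<r}" for t
      using le[of s t] le[of t r] that st by auto
    have "((\<lambda>_. e * x s) has_real_derivative 0) (at t)" by simp
    then have 1: "((\<lambda>s. e * x s) has_real_derivative 0) (at t)"
      by (rule has_field_derivative_transform_within_open[of _ _ _ "{s<..<r}"]) (simp, use st in simp, rule c[symmetric])
    have "((\<lambda>s. e * x s) has_real_derivative e * cos (\<theta> t)) (at t within {s<..<r})"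
      by (rule d) (use st in auto)
    moreover have "at t within {s<..<r} = at t" by (rule at_within_open) (use st in auto)
    ultimately have "((\<lambda>s. e * x s) has_real_derivative e * cos (\<theta> t)) (at t)" by simp
    from DERIV_unique[OF this 1] e show ?thesis by simp
  qed
  have inj1: "inj_on x S1"
  proof (rule linorder_inj_onI)
    fix s r assume sr: "s < r" "s \<in> S1" "r \<in> S1"
    have th: "\<theta> t \<le> pi/2" if "t \<in> {s..r}" for t
      using mono_onD[OF a(3), of t r] S1lt[OF sr(3)] that sr by (auto simp: S1_def)
    show "x s \<noteq> x r"
    proof
      assume eq: "x s = x r"
      define t where "t = (s + r) / 2"
      have t: "s < t" "t < r" using sr by (auto simp: t_def)
      have tT: "t \<in> {0..T}" using t sr by (auto simp: S1_def)
      have "cos (\<theta> t) = 0"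
        by (rule const[of s r t 1]) (use sr t eq th rng cos_sign_shifted_period in \<open>auto simp: S1_def\<close>)
      moreover have "\<theta> s \<le> \<theta> t" "\<theta> t \<le> \<theta> r" using mono_onD[OF a(3)] sr t tT by (auto simp: S1_def)
      moreover have "- (pi/2) < \<theta> s"
      proof -
        have "\<theta> s \<noteq> - (pi/2)" using sr by (auto simp: S1_def)
        then show ?thesis using rng[of s] sr by (auto simp: S1_def)
      qed
      ultimately show False using cos_gt_zero_pi[of "\<theta> t"] S1lt[OF sr(3)] by auto
    qed
  qed auto
  have inj2: "inj_on x S2"
  proof (rule linorder_inj_onI)
    fix s r assume sr: "s < r" "s \<in> S2" "r \<in> S2"
    have th: "\<theta> t \<ge> pi/2" if "t \<in> {s..r}" for t
      using mono_onD[OF a(3), of s t] S2gt[OF sr(2)] that sr by (auto simp: S2_def)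
    show "x s \<noteq> x r"
    proof
      assume eq: "x s = x r"
      define t where "t = (s + r) / 2"
      have t: "s < t" "t < r" using sr by (auto simp: t_def)
      have tT: "t \<in> {0..T}" using t sr by (auto simp: S2_def)
      have "cos (\<theta> t) = 0"
        by (rule const[of s r t "-1"]) (use sr t eq th rng cos_sign_shifted_period in \<open>auto simp: S2_def\<close>)
      then have "cos (\<theta> t - pi) = 0" by simp
      moreover have "\<theta> s \<le> \<theta> t" "\<theta> t \<le> \<theta> r" using mono_onD[OF a(3)] sr t tT by (auto simp: S2_def)
      moreover have "\<theta> r < 3 * pi / 2"
      proof -
        have "\<theta> r \<noteq> 3 * pi / 2"
        proof
          assume "\<theta> r = 3 * pi / 2"
          then have "\<theta> r = pi/2 + pi" by simp
          then have "cos (\<theta> r) = 0" by (simp only: cos_periodic_pi cos_pi_half minus_zero)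
          then show False using sr by (auto simp: S2_def)
        qed
        then show ?thesis using rng[of r] sr by (auto simp: S2_def)
      qed
      ultimately show False using cos_gt_zero_pi[of "\<theta> t - pi"] S2gt[OF sr(2)] by auto
    qed
  qed auto
  define i1 where "i1 = inv_into S1 x"
  define i2 where "i2 = inv_into S2 x"
  have i1: "i1 z \<in> S1" "x (i1 z) = z" and i2: "i2 z \<in> S2" "x (i2 z) = z" if "z \<in> {x 0<..<x q}" for z
    using that inv_into_into[of z x S1] f_inv_into_f[of z x S1]
      inv_into_into[of z x S2] f_inv_into_f[of z x S2] S1 S2 by (auto simp: i1_def i2_def)
  have slice: "Pair z -` \<Omega> = {y (i1 z)<..<y (i2 z)} \<and> y (i1 z) \<le> y (i2 z)" if z: "z \<in> {x 0<..<x q}" for z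
  proof -
    \<comment> \<open>Closure points of the domain lie strictly on both sides of the vertical line
      over \<open>z\<close>; by openness so do points of the domain, and its projection is an
      interval.\<close>
    have "z \<in> fst ` \<Omega>"
    proof -
      have cl: "(x 0, y 0) \<in> closure \<Omega>" "(x q, y q) \<in> closure \<Omega>"
        using \<Omega>(4) T0 q by (auto simp: frontier_def)
      have op: "open (fst -` {..<z} :: (real \<times> real) set)" "open (fst -` {z<..} :: (real \<times> real) set)"
        by (auto intro!: open_vimage_fst)
      have "(x 0, y 0) \<in> fst -` {..<z} \<inter> closure \<Omega>" "(x q, y q) \<in> fst -` {z<..} \<inter> closure \<Omega>"
        using cl z by auto
      then have "fst -` {..<z} \<inter> \<Omega> \<noteq> {}" "fst -` {z<..} \<inter> \<Omega> \<noteq> {}"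
        using open_Int_closure_eq_empty[OF op(1), of \<Omega>] open_Int_closure_eq_empty[OF op(2), of \<Omega>]
        by (metis empty_iff)+
      then obtain p r where pr: "p \<in> fst ` \<Omega>" "p < z" "r \<in> fst ` \<Omega>" "z < r" by auto
      have "is_interval (fst ` \<Omega>)"
        unfolding is_interval_convex_1 by (rule convex_linear_image[OF _ \<Omega>(3)]) (rule linear_fst)
      then show ?thesis using pr unfolding is_interval_1 by (metis less_imp_le)
    qed
    then obtain w where "(z, w) \<in> \<Omega>" by auto
    from convex_open_slice[OF \<Omega>(1-3) this] obtain c d where cd: "c < d" "Pair z -` \<Omega> = {c<..<d}"
      "(z, c) \<in> frontier \<Omega>" "(z, d) \<in> frontier \<Omega>" by metis
    \<comment> \<open>At most two frontier points lie over \<open>z\<close>, one per branch. The two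
      distinct ends of the slice must therefore be these points.\<close>
    have pt: "w = y (i1 z) \<or> w = y (i2 z)" if fr: "(z, w) \<in> frontier \<Omega>" for w
    proof -
      obtain s where s: "s \<in> {0..T}" "z = x s" "w = y s" using fr \<Omega>(4) by auto
      then have "cos (\<theta> s) \<noteq> 0" using strict z by auto
      then have "s \<in> S1 \<or> s \<in> S2" using s by (auto simp: S1_def S2_def linorder_neq_iff)
      then consider "s \<in> S1" | "s \<in> S2" by blast
      then show ?thesis
      proof cases
        case 1
        then have "s = i1 z" using inj_onD[OF inj1, of s "i1 z"] i1[OF z] s by auto
        then show ?thesis using s by simp
      next
        case 2
        then have "s = i2 z" using inj_onD[OF inj2, of s "i2 z"] i2[OF z] s by auto
        then show ?thesis using s by simp
      qed
    qed
    have "0 \<le> cos (\<theta> (i1 z)) * (y (i2 z) - y (i1 z))"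
      using sup(1)[of "i1 z" "i2 z"] i1[OF z] i2[OF z] by (auto simp: S1_def S2_def)
    then have le: "y (i1 z) \<le> y (i2 z)" using i1[OF z] by (auto simp: S1_def zero_le_mult_iff)
    then show ?thesis using pt[OF cd(3)] pt[OF cd(4)] cd by auto
  qed
  have empty: "Pair z -` \<Omega> = {}" if "z < x 0 \<or> x q < z" for z
  proof (rule ccontr)
    assume "Pair z -` \<Omega> \<noteq> {}"
    then obtain w where "(z, w) \<in> \<Omega>" by auto
    from convex_open_slice[OF \<Omega>(1-3) this] obtain c where "(z, c) \<in> frontier \<Omega>" by metis
    then show False using \<Omega>(4) that x0 xq by force
  qed
  define h where "h = (\<lambda>s. y s * cos (\<theta> s))"
  have hc: "continuous_on {0..T} h" unfolding h_def using a by (auto intro!: continuous_intros)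
  have habs: "h absolutely_integrable_on {0..T}" using absolutely_integrable_continuous_real[OF hc] .
  have meas: "S1 \<in> sets lebesgue" "S2 \<in> sets lebesgue"
  proof -
    have cc: "continuous_on {0..T} (\<lambda>s. cos (\<theta> s))" using a by (auto intro!: continuous_intros)
    have *: "{0..T} \<inter> (\<lambda>s. cos (\<theta> s)) -` U \<in> sets lebesgue" if "open U" for U
    proof -
      have "openin (top_of_set {0..T}) ({0..T} \<inter> (\<lambda>s. cos (\<theta> s)) -` U)"
        by (rule continuous_openin_preimage_gen[OF cc that])
      then obtain V where "open V" "{0..T} \<inter> (\<lambda>s. cos (\<theta> s)) -` U = {0..T} \<inter> V"
        using openin_open by blast
      then show ?thesis by auto
    qed
    have "S1 = {0..T} \<inter> (\<lambda>s. cos (\<theta> s)) -` {0<..}" "S2 = {0..T} \<inter> (\<lambda>s. cos (\<theta> s)) -` {..<0}"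
      by (auto simp: S1_def S2_def)
    then show "S1 \<in> sets lebesgue" "S2 \<in> sets lebesgue" using *[of "{0<..}"] *[of "{..<0}"] by auto
  qed
  have sub: "S1 \<subseteq> {0..T}" "S2 \<subseteq> {0..T}" by (auto simp: S1_def S2_def)
  have h1: "h absolutely_integrable_on S1" and h2: "h absolutely_integrable_on S2"
    using set_integrable_subset[OF habs] meas sub by auto
  have H1: "((\<lambda>z. y (i1 z)) has_integral integral S1 h) {x 0<..<x q}"
  proof -
    have e: "\<bar>cos (\<theta> s)\<bar> * y (i1 (x s)) = h s" if "s \<in> S1" for s
      using that inv_into_f_f[OF inj1 that] by (auto simp: h_def i1_def S1_def)
    have "(\<lambda>s. \<bar>cos (\<theta> s)\<bar> * y (i1 (x s))) absolutely_integrable_on S1 \<and>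
        integral S1 (\<lambda>s. \<bar>cos (\<theta> s)\<bar> * y (i1 (x s))) = integral S1 h"
      using h1 e by (simp cong: set_integrable_cong integral_cong)
    then have "(\<lambda>z. y (i1 z)) absolutely_integrable_on (x ` S1) \<and> integral (x ` S1) (\<lambda>z. y (i1 z)) = integral S1 h"
      using has_absolute_integral_change_of_variables_1'[OF meas(1) _ inj1, of "\<lambda>s. cos (\<theta> s)" "\<lambda>z. y (i1 z)"]
        DERIV_subset[OF a(7)] sub by blast
    then show ?thesis unfolding S1
      using integrable_integral absolutely_integrable_on_def by (metis set_lebesgue_integral_eq_integral(1))
  qed
  \<comment> \<open>On the upper branch the cosine is negative, so the absolute Jacobian turns
    \<open>h\<close> into \<open>- h\<close>. This sign produces the difference of the two
    graphs.\<close>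
  have H2: "((\<lambda>z. y (i2 z)) has_integral - integral S2 h) {x 0<..<x q}"
  proof -
    have e: "\<bar>cos (\<theta> s)\<bar> * y (i2 (x s)) = - h s" if "s \<in> S2" for s
      using that inv_into_f_f[OF inj2 that] by (auto simp: h_def i2_def S2_def)
    have "(\<lambda>s. - h s) absolutely_integrable_on S2" using h2 by (simp add: set_integrable_def)
    then have "(\<lambda>s. \<bar>cos (\<theta> s)\<bar> * y (i2 (x s))) absolutely_integrable_on S2 \<and>
        integral S2 (\<lambda>s. \<bar>cos (\<theta> s)\<bar> * y (i2 (x s))) = - integral S2 h"
      using e by (simp cong: set_integrable_cong integral_cong)
    then have "(\<lambda>z. y (i2 z)) absolutely_integrable_on (x ` S2) \<and> integral (x ` S2) (\<lambda>z. y (i2 z)) = - integral S2 h"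
      using has_absolute_integral_change_of_variables_1'[OF meas(2) _ inj2, of "\<lambda>s. cos (\<theta> s)" "\<lambda>z. y (i2 z)"]
        DERIV_subset[OF a(7)] sub by blast
    then show ?thesis unfolding S2
      using integrable_integral absolutely_integrable_on_def by (metis set_lebesgue_integral_eq_integral(1))
  qed
  have tot: "integral {0..T} h = integral S1 h + integral S2 h"
  proof (rule integral_unique)
    have "((\<lambda>s. if s \<in> S1 then h s else 0) has_integral integral S1 h) {0..T}"
      "((\<lambda>s. if s \<in> S2 then h s else 0) has_integral integral S2 h) {0..T}"
      using h1 h2 sub by (auto simp: has_integral_restrict integrable_integral set_lebesgue_integral_eq_integral(1))
    from has_integral_add[OF this] show "(h has_integral integral S1 h + integral S2 h) {0..T}"
      by (rule has_integral_eq[rotated]) (auto simp: S1_def S2_def h_def)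
  qed
  define D where "D = (\<lambda>z. y (i2 z) - y (i1 z))"
  have D: "(D has_integral - integral {0..T} h) {x 0<..<x q}"
    using has_integral_diff[OF H2 H1] by (simp add: tot D_def add.commute[of "integral S1 h"])
  have Dnn: "0 \<le> D z" if "z \<in> {x 0<..<x q}" for z using slice[OF that] by (simp add: D_def)
  have "emeasure lborel \<Omega> = emeasure (lborel \<Otimes>\<^sub>M lborel) \<Omega>" by (simp add: lborel_prod)
  also have "\<dots> = (\<integral>\<^sup>+z. emeasure lborel (Pair z -` \<Omega>) \<partial>lborel)"
    by (rule lborel.emeasure_pair_measure_alt) (use \<Omega>(1) in \<open>simp only: lborel_prod sets_lborel borel_open\<close>)
  also have "\<dots> = (\<integral>\<^sup>+z. ennreal (indicator {x 0<..<x q} z * D z) \<partial>lborel)"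
  proof (rule nn_integral_cong_AE)
    \<comment> \<open>The two extreme abscissas are covered neither by \<open>slice\<close> nor by
      \<open>empty\<close>; they form a null set.\<close>
    have "AE z in lborel. z \<noteq> x 0" "AE z in lborel. z \<noteq> x q" by (rule AE_lborel_singleton)+
    then show "AE z in lborel. emeasure lborel (Pair z -` \<Omega>) = ennreal (indicator {x 0<..<x q} z * D z)"
    proof eventually_elim
      fix z assume "z \<noteq> x 0" "z \<noteq> x q"
      then consider "z \<in> {x 0<..<x q}" | "z < x 0 \<or> x q < z" by fastforce
      then show "emeasure lborel (Pair z -` \<Omega>) = ennreal (indicator {x 0<..<x q} z * D z)"
      proof cases
        case 1
        then show ?thesis using slice[OF 1] by (simp add: D_def)
      next
        case 2
        then show ?thesis using empty[OF 2] by auto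
      qed
    qed
  qed
  also have "\<dots> = ennreal (- integral {0..T} h)"
    by (rule nn_integral_has_integral_lebesgue[OF Dnn D])
  finally show ?thesis
    using has_integral_nonneg[OF D Dnn] by (simp add: measure_def h_def)
qed

lemma convex_arc_area:
  assumes arc: "convex_arc T \<theta> x y"
    and \<Omega>: "open \<Omega>" "bounded \<Omega>" "convex \<Omega>" "frontier \<Omega> = (\<lambda>s. (x s, y s)) ` {0..T}"
  shows "measure lborel \<Omega> = - integral {0..T} (\<lambda>s. y s * cos (\<theta> s))"
proof -
  obtain \<theta>' x' y' where s: "convex_arc T \<theta>' x' y'" "\<theta>' 0 = - (pi/2)"
    "arc_data \<theta>' x' y' ` {0..T} = arc_data \<theta> x y ` {0..T}"
    "integral {0..T} (\<lambda>s. y' s * cos (\<theta>' s)) = integral {0..T} (\<lambda>s. y s * cos (\<theta> s))"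
    by (rule convex_arc_normalize[OF arc])
  have img: "(\<lambda>s. (x s, y s)) ` {0..T} = (\<lambda>(a, b, _). (a, b)) ` arc_data \<theta> x y ` {0..T}" for \<theta> x y
    unfolding image_image arc_data_def by simp
  have "frontier \<Omega> = (\<lambda>s. (x' s, y' s)) ` {0..T}"
    using \<Omega>(4) img[of x y \<theta>] img[of x' y' \<theta>'] s(3) by simp
  from convex_arc_area_aux[OF s(1,2) \<Omega>(1-3) this] s(4) show ?thesis by simp
qed

section \<open>Competitors with non-unit speed\<close>

lemma continuous_on_Icc_bound:
  fixes f :: "real \<Rightarrow> real"
  assumes "continuous_on {a..b} f"
  obtains B where "0 \<le> B" "\<And>u. u \<in> {a..b} \<Longrightarrow> \<bar>f u\<bar> \<le> B"
proof -
  obtain B where B: "\<And>u. u \<in> {a..b} \<Longrightarrow> \<bar>f u\<bar> \<le> B"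
    using compact_imp_bounded[OF compact_continuous_image[OF assms compact_Icc]]
    unfolding bounded_iff by (metis image_eqI real_norm_def)
  have "\<bar>f u\<bar> \<le> \<bar>B\<bar>" if "u \<in> {a..b}" for u using B[OF that] by simp
  then show thesis using that[of "\<bar>B\<bar>"] by simp
qed

lemma set_integrable_mult_continuous:
  fixes w h :: "real \<Rightarrow> real"
  assumes w: "set_integrable lborel {a..b} w" and h: "continuous_on {a..b} h"
  shows "set_integrable lborel {a..b} (\<lambda>s. w s * h s)"
proof -
  obtain C where C: "\<And>s. s \<in> {a..b} \<Longrightarrow> \<bar>h s\<bar> \<le> C"
    using continuous_on_Icc_bound[OF h] by blast
  have wi: "integrable lborel (\<lambda>s. C * \<bar>indicator {a..b} s *\<^sub>R w s\<bar>)"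
    using w by (simp add: set_integrable_def)
  have hm: "(\<lambda>s. indicator {a..b} s *\<^sub>R h s) \<in> borel_measurable borel"
    by (rule borel_measurable_continuous_on_indicator[OF _ h]) simp
  have "(\<lambda>s. (indicator {a..b} s *\<^sub>R w s) * (indicator {a..b} s *\<^sub>R h s)) \<in> borel_measurable lborel"
    using w hm by (intro borel_measurable_times) (auto simp: set_integrable_def)
  then have "(\<lambda>s. indicator {a..b} s *\<^sub>R (w s * h s)) \<in> borel_measurable lborel"
    by (rule measurable_cong[THEN iffD1, rotated]) (simp add: indicator_def)
  then show ?thesis
    unfolding set_integrable_def
    by (rule Bochner_Integration.integrable_bound[OF wi])
      (auto simp: abs_mult indicator_def mult.commute[of "\<bar>w _\<bar>"]
        intro!: AE_I2 mult_right_mono order_trans[OF C abs_ge_self])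
qed

lemma LBINT_eq_integral_continuous:
  fixes f :: "real \<Rightarrow> real"
  assumes "continuous_on {0..T} f" "s \<in> {0..T}"
  shows "(LBINT t=0..s. f t) = integral {0..s} f"
  using interval_integral_eq_integral[of 0 s f] assms
    borel_integrable_atLeastAtMost'[of 0 s f] continuous_on_subset[OF assms(1), of "{0..s}"]
  by (auto simp: zero_ereal_def)

lemma LBINT_eq_integral_subinterval:
  fixes f :: "real \<Rightarrow> real"
  assumes "set_integrable lborel {0..T} f" "s \<in> {0..T}"
  shows "(LBINT t=0..s. f t) = integral {0..s} f"
  using interval_integral_eq_integral[of 0 s f] assms set_integrable_subset[OF assms(1), of "{0..s}"]
  by (auto simp: zero_ereal_def)

lemma LBINT_has_real_derivative:
  fixes f :: "real \<Rightarrow> real"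
  assumes f: "continuous_on {0..T} f" and s: "s \<in> {0..T}"
  shows "((\<lambda>s. LBINT t=0..s. f t) has_real_derivative f s) (at s within {0..T})"
  by (rule has_field_derivative_transform_within[OF integral_has_real_derivative[OF f s] zero_less_one s])
    (simp add: LBINT_eq_integral_continuous[OF f])

lemma LBINT_FTC:
  fixes f F :: "real \<Rightarrow> real"
  assumes f: "continuous_on {0..T} f" and s: "s \<in> {0..T}"
    and F: "\<And>s. s \<in> {0..T} \<Longrightarrow> (F has_real_derivative f s) (at s within {0..T})"
  shows "(LBINT t=0..s. f t) = F s - F 0"
proof -
  have "(f has_integral F s - F 0) {0..s}"
    by (rule fundamental_theorem_of_calculus)
      (use s DERIV_subset[OF F] in \<open>auto simp: has_real_derivative_iff_has_vector_derivative[symmetric]\<close>)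
  then show ?thesis using LBINT_eq_integral_continuous[OF f s] by (simp add: integral_unique)
qed

lemma convex_arc_curve:
  assumes arc: "convex_arc T \<theta> x y" and s: "s \<in> {0..T}"
  shows "(LBINT t=0..s. cos (\<theta> t)) = x s - x 0" "(LBINT t=0..s. sin (\<theta> t)) = y s - y 0"
    "curve \<theta> (x 0, y 0) s = (x s, y s)"
proof -
  note a = convex_arcD[OF arc]
  show "(LBINT t=0..s. cos (\<theta> t)) = x s - x 0"
    by (rule LBINT_FTC[OF _ s a(7)]) (use a in \<open>auto intro!: continuous_intros\<close>)
  moreover show "(LBINT t=0..s. sin (\<theta> t)) = y s - y 0"
    by (rule LBINT_FTC[OF _ s a(8)]) (use a in \<open>auto intro!: continuous_intros\<close>)
  ultimately show "curve \<theta> (x 0, y 0) s = (x s, y s)" by (simp add: curve_def)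
qed

text \<open>The map \<open>v\<close> is the inverse of the arc length function of a curve with speed
  \<open>\<sigma>\<close>; total length \<open>T\<close> keeps the parameter interval.\<close>

lemma arc_length_reparametrization:
  fixes \<sigma> :: "real \<Rightarrow> real"
  assumes T: "0 < T" and cont: "continuous_on {0..T} \<sigma>"
    and pos: "\<And>u. u \<in> {0..T} \<Longrightarrow> 0 < \<sigma> u" and tot: "integral {0..T} \<sigma> = T"
  obtains v where "v 0 = 0" "v T = T" "v ` {0..T} = {0..T}"
    "\<And>s. s \<in> {0..T} \<Longrightarrow> (v has_real_derivative 1 / \<sigma> (v s)) (at s)"
proof -
  \<comment> \<open>Clamping the argument extends the speed continuously and positively beyond the
    interval. The arc length function is then strictly increasing on a neighbourhood of
    \<open>{0..T}\<close>, and its inverse has two-sided derivatives also at 0 and \<open>T\<close>,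
    as the substitution rule used later demands.\<close>
  define se where "se = (\<lambda>u. \<sigma> (max 0 (min T u)))"
  have se: "continuous_on UNIV se" unfolding se_def
    by (rule continuous_on_compose2[OF cont]) (use T in \<open>auto intro!: continuous_intros\<close>)
  have sepos: "0 < se u" for u unfolding se_def using T by (intro pos) auto
  let ?I = "{-1..T+1}"
  define S where "S = (\<lambda>u. integral {-1..u} se - integral {-1..0} se)"
  have Sw: "(S has_real_derivative se u) (at u within ?I)" if "u \<in> ?I" for u
    unfolding S_def using integral_has_real_derivative[OF continuous_on_subset[OF se] that]
    by (auto intro!: derivative_eq_intros)
  have Sd: "(S has_real_derivative se u) (at u)" if "u \<in> {-1<..<T+1}" for u
  proof -
    have "at u within ?I = at u" by (rule at_within_interior) (use that in auto)
    then show ?thesis using Sw[of u] that by auto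
  qed
  have Sc: "continuous_on ?I S" using Sw by (rule DERIV_continuous_on)
  have mono: "S a < S b" if "a \<in> ?I" "b \<in> ?I" "a < b" for a b
  proof (rule DERIV_pos_imp_increasing_open[OF \<open>a < b\<close>])
    show "\<exists>y. (S has_real_derivative y) (at x) \<and> 0 < y" if "a < x" "x < b" for x
      using Sd[of x] sepos[of x] that \<open>a \<in> ?I\<close> \<open>b \<in> ?I\<close> by auto
    show "continuous_on {a..b} S" by (rule continuous_on_subset[OF Sc]) (use that in auto)
  qed
  have S0: "S 0 = 0" by (simp add: S_def)
  have "integral {-1..0} se + integral {0..T} se = integral {-1..T} se"
    by (rule Henstock_Kurzweil_Integration.integral_combine)
      (use T in \<open>auto intro!: integrable_continuous_real continuous_on_subset[OF se]\<close>)
  moreover have "integral {0..T} se = integral {0..T} \<sigma>"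
    by (rule integral_cong) (simp add: se_def)
  ultimately have ST: "S T = T" using tot by (simp add: S_def)
  have inj: "inj_on S ?I"
    by (rule linorder_inj_onI) (use mono in \<open>auto simp: less_imp_neq\<close>)
  define v where "v = inv_into ?I S"
  have vS: "v (S u) = u" if "u \<in> ?I" for u unfolding v_def using inj that by simp
  have img: "{S (-1)..S (T+1)} \<subseteq> S ` ?I"
    using IVT'[of S "-1" _ "T+1"] Sc T by fastforce
  have Sv: "S (v s) = s" "v s \<in> ?I" if "s \<in> {S (-1)..S (T+1)}" for s
  proof -
    have "s \<in> S ` ?I" using that img by blast
    then show "S (v s) = s" "v s \<in> ?I" unfolding v_def by (rule f_inv_into_f, rule inv_into_into)
  qed
  have ends: "S (-1) < 0" "T < S (T+1)" using mono[of "-1" 0] mono[of T "T+1"] S0 ST T by auto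
  have v0T: "v 0 = 0" "v T = T" using vS[of 0] vS[of T] S0 ST T by auto
  have vrange: "v s \<in> {0..T}" if s: "s \<in> {0..T}" for s
  proof (rule ccontr)
    assume "v s \<notin> {0..T}"
    have in1: "S (v s) = s" "v s \<in> ?I" using Sv[of s] s ends by auto
    consider "v s < 0" | "T < v s" using \<open>v s \<notin> {0..T}\<close> by fastforce
    then show False
      using mono[of "v s" 0] mono[of T "v s"] in1 S0 ST s T by cases auto
  qed
  have vc: "continuous_on (S ` ?I) v"
    by (rule continuous_on_inv[OF Sc]) (use vS in auto)
  show thesis
  proof
    show "v 0 = 0" "v T = T" by (rule v0T)+
    show "v ` {0..T} = {0..T}"
    proof (intro equalityI subsetI)
      fix u assume u: "u \<in> {0..T}"
      have "S u \<in> {0..T}"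
      proof -
        have "S 0 \<le> S u" using mono[of 0 u] u by (cases "u = 0") auto
        moreover have "S u \<le> S T" using mono[of u T] u T by (cases "u = T") auto
        ultimately show ?thesis using S0 ST by simp
      qed
      then show "u \<in> v ` {0..T}" using vS[of u] u by (auto intro!: image_eqI[of _ _ "S u"])
    qed (use vrange in auto)
    fix s assume s: "s \<in> {0..T}"
    have "isCont v s"
    proof (rule continuous_on_interior[OF vc])
      have "s \<in> {S (-1)<..<S (T+1)}" using s ends by auto
      then have "s \<in> interior {S (-1)..S (T+1)}" by simp
      then show "s \<in> interior (S ` ?I)" using interior_mono[OF img] by blast
    qed
    moreover have "(S has_real_derivative se (v s)) (at (v s))"
      by (rule Sd) (use vrange[OF s] T in auto)
    ultimately have "(v has_real_derivative inverse (se (v s))) (at s)"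
      using sepos[of "v s"] Sv s ends
      by (intro DERIV_inverse_function[where f = S and a = "S (-1)" and b = "S (T+1)"]) auto
    moreover have "se (v s) = \<sigma> (v s)" using vrange[OF s] by (simp add: se_def)
    ultimately show "(v has_real_derivative 1 / \<sigma> (v s)) (at s)" by (simp add: inverse_eq_divide)
  qed
qed

text \<open>In arc length the curvature of a curve with angle density \<open>\<kappa>\<close> and
  speed \<open>\<sigma>\<close> is \<open>\<kappa> / \<sigma>\<close>, and the length element is
  \<open>\<sigma>\<close> times the old one. Energy and area are expressed in the old parameter, so
  the expansions below never see the reparametrisation, which depends on the competitor.\<close>

lemma admissible_competitor:
  fixes \<kappa> \<Theta> \<sigma> X Y :: "real \<Rightarrow> real"
  assumes T: "0 < T"
    and \<kappa>: "\<And>u. 0 \<le> \<kappa> u" "set_integrable lborel {0..T} \<kappa>" "set_integrable lborel {0..T} (\<lambda>u. (\<kappa> u)\<^sup>2)"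
    and \<Theta>: "\<And>u. u \<in> {0..T} \<Longrightarrow> \<Theta> u = \<Theta> 0 + integral {0..u} \<kappa>" "\<Theta> T = \<Theta> 0 + 2 * pi"
    and \<sigma>: "continuous_on {0..T} \<sigma>" "\<And>u. u \<in> {0..T} \<Longrightarrow> 0 < \<sigma> u" "integral {0..T} \<sigma> = T"
    and X: "\<And>u. u \<in> {0..T} \<Longrightarrow> (X has_real_derivative \<sigma> u * cos (\<Theta> u)) (at u within {0..T})" "X T = X 0"
    and Y: "\<And>u. u \<in> {0..T} \<Longrightarrow> (Y has_real_derivative \<sigma> u * sin (\<Theta> u)) (at u within {0..T})" "Y T = Y 0"
  obtains \<Omega>' \<theta>' k' where "admissible \<Omega>' T \<theta>' k'"
    "energy T k' = 1 / 2 * integral {0..T} (\<lambda>u. (\<kappa> u)\<^sup>2 * (1 / \<sigma> u))"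
    "area \<Omega>' = - integral {0..T} (\<lambda>u. Y u * (\<sigma> u * cos (\<Theta> u)))"
proof -
  obtain v where v: "v 0 = 0" "v T = T" "v ` {0..T} = {0..T}"
    "\<And>s. s \<in> {0..T} \<Longrightarrow> (v has_real_derivative 1 / \<sigma> (v s)) (at s)"
    using arc_length_reparametrization[OF T \<sigma>] by blast
  have vr: "v s \<in> {0..T}" if "s \<in> {0..T}" for s using v(3) that by blast
  have vc: "continuous_on {0..T} v"
    by (rule DERIV_continuous_on[OF has_field_derivative_at_within]) (use v(4) in auto)
  have cv: "continuous_on {0..T} (\<lambda>s. f (v s))" if "continuous_on {0..T} f" for f :: "real \<Rightarrow> real"
    by (rule continuous_on_compose2[OF that vc]) (use v(3) in auto)
  have vmono: "v r \<le> v s" if "r \<in> {0..T}" "s \<in> {0..T}" "r \<le> s" for r s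
  proof (rule has_real_derivative_nonneg_imp_nondecreasing[OF that(3)])
    fix u assume "u \<in> {r..s}"
    then have u: "u \<in> {0..T}" using that by auto
    show "(v has_real_derivative 1 / \<sigma> (v u)) (at u within {r..s})"
      by (rule has_field_derivative_at_within[OF v(4)[OF u]])
    show "0 \<le> 1 / \<sigma> (v u)" using \<sigma>(2)[OF vr[OF u]] by simp
  qed
  have \<sigma>nz: "\<sigma> u \<noteq> 0" if "u \<in> {0..T}" for u using \<sigma>(2)[OF that] by simp
  have ic: "continuous_on {0..T} (\<lambda>u. 1 / \<sigma> u)"
    by (intro continuous_intros \<sigma>(1) ballI \<sigma>nz)
  have subst: "set_integrable lborel {0..s} (\<lambda>r. f (v r) * (1 / \<sigma> (v r)))"
      "(LBINT t=0..v s. f t) = (LBINT t=0..s. f (v t) * (1 / \<sigma> (v t)))"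
    if f: "set_integrable lborel {0..T} f" and s: "s \<in> {0..T}" for f s
  proof -
    have 1: "set_integrable lborel {v 0..v s} f"
      by (rule set_integrable_subset[OF f]) (use vr[OF s] v in auto)
    have 2: "(v has_real_derivative 1 / \<sigma> (v x)) (at x)" if "x \<in> {0..s}" for x
      using v(4) that s by auto
    have 3: "continuous_on {0..s} (\<lambda>x. 1 / \<sigma> (v x))"
      by (rule continuous_on_subset[OF cv[OF ic]]) (use s in auto)
    have 4: "0 \<le> 1 / \<sigma> (v x)" if "x \<in> {0..s}" for x
      using \<sigma>(2)[OF vr[of x]] that s by auto
    have 5: "0 \<le> s" using s by simp
    show "set_integrable lborel {0..s} (\<lambda>r. f (v r) * (1 / \<sigma> (v r)))"
      by (rule interval_integral_substitution(1)[OF 1 2 3 4 5])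
    show "(LBINT t=0..v s. f t) = (LBINT t=0..s. f (v t) * (1 / \<sigma> (v t)))"
      using interval_integral_substitution(2)[OF 1 2 3 4 5] v(1) by (simp add: zero_ereal_def)
  qed
  define \<theta>' where "\<theta>' = (\<lambda>s. \<Theta> (v s))"
  define k' where "k' = (\<lambda>s. \<kappa> (v s) * (1 / \<sigma> (v s)))"
  define x' where "x' = (\<lambda>s. X (v s))"
  define y' where "y' = (\<lambda>s. Y (v s))"
  have T': "T \<in> {0..T}" using T by simp
  have \<kappa>int: "\<kappa> integrable_on {0..T}" using set_borel_integral_eq_integral(1)[OF \<kappa>(2)] .
  have \<Theta>c: "continuous_on {0..T} \<Theta>"
  proof -
    have "continuous_on {0..T} (\<lambda>u. \<Theta> 0 + integral {0..u} \<kappa>)"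
      by (intro continuous_intros indefinite_integral_continuous_1 \<kappa>int)
    then show ?thesis by (rule continuous_on_eq) (rule \<Theta>(1)[symmetric])
  qed
  have \<Theta>m: "mono_on {0..T} \<Theta>"
  proof (rule mono_onI)
    fix r s assume rs: "r \<in> {0..T}" "s \<in> {0..T}" "r \<le> s"
    have "integral {0..r} \<kappa> \<le> integral {0..s} \<kappa>"
      by (rule integral_subset_le) (use rs \<kappa>(1) integrable_on_subinterval[OF \<kappa>int] in auto)
    then show "\<Theta> r \<le> \<Theta> s" using \<Theta>(1)[OF rs(1)] \<Theta>(1)[OF rs(2)] by simp
  qed
  have chain: "((\<lambda>s. F (v s)) has_real_derivative g (v s)) (at s within {0..T})"
    if F: "\<And>u. u \<in> {0..T} \<Longrightarrow> (F has_real_derivative \<sigma> u * g u) (at u within {0..T})" and s: "s \<in> {0..T}"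
    for F g s
  proof -
    have "((F \<circ> v) has_real_derivative (\<sigma> (v s) * g (v s)) * (1 / \<sigma> (v s))) (at s within {0..T})"
      by (rule DERIV_image_chain)
        (use F vr[OF s] v(3) v(4)[OF s] in \<open>auto intro: has_field_derivative_at_within\<close>)
    then show ?thesis using \<sigma>(2)[OF vr[OF s]] by (simp add: o_def)
  qed
  have arc: "convex_arc T \<theta>' x' y'"
    unfolding convex_arc_def \<theta>'_def x'_def y'_def
    using T cv[OF \<Theta>c] \<Theta>(2) v(1,2) X(2) Y(2) chain[OF X(1)] chain[OF Y(1)]
    by (auto intro!: mono_onI mono_onD[OF \<Theta>m] vmono simp: vr[simplified])
  define \<Omega>' where "\<Omega>' = interior (convex hull ((\<lambda>s. (x' s, y' s)) ` {0..T}))"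
  note dom = convex_arc_bounds_domain[OF arc, folded \<Omega>'_def]
  \<comment> \<open>One factor \<open>1 / \<sigma>\<close> is kept apart because it is the
    derivative of \<open>v\<close> and is consumed by the substitution; the other one stays in the
    energy.\<close>
  have k'2: "(k' s)\<^sup>2 = ((\<kappa> (v s))\<^sup>2 * (1 / \<sigma> (v s))) * (1 / \<sigma> (v s))" for s
    by (simp add: k'_def power2_eq_square)
  have f2: "set_integrable lborel {0..T} (\<lambda>u. (\<kappa> u)\<^sup>2 * (1 / \<sigma> u))"
    by (rule set_integrable_mult_continuous[OF \<kappa>(3) ic])
  have adm: "admissible \<Omega>' T \<theta>' k'"
    unfolding admissible_def W12_with_deriv_def
  proof (intro conjI ballI AE_I2 impI)
    show "set_integrable lborel {0..T} k'" unfolding k'_def by (rule subst(1)[OF \<kappa>(2) T'])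
    show "set_integrable lborel {0..T} (\<lambda>s. (k' s)\<^sup>2)" unfolding k'2 by (rule subst(1)[OF f2 T'])
    fix s assume s: "s \<in> {0..T}"
    have "\<theta>' s = \<Theta> 0 + integral {0..v s} \<kappa>" unfolding \<theta>'_def using \<Theta>(1)[OF vr[OF s]] .
    also have "integral {0..v s} \<kappa> = (LBINT t=0..v s. \<kappa> t)"
      by (rule LBINT_eq_integral_subinterval[OF \<kappa>(2) vr[OF s], symmetric])
    also have "\<dots> = (LBINT t=0..s. k' t)" unfolding k'_def by (rule subst(2)[OF \<kappa>(2) s])
    finally show "\<theta>' s = \<theta>' 0 + (LBINT t=0..s. k' t)" using v(1) by (simp add: \<theta>'_def)
  next
    fix s assume s: "s \<in> {0..T}"
    show "0 \<le> k' s" unfolding k'_def using \<kappa>(1) \<sigma>(2)[OF vr[OF s]] by simp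
  next
    show "(LBINT s=0..T. cos (\<theta>' s)) = 0" "(LBINT s=0..T. sin (\<theta>' s)) = 0"
      using convex_arc_curve[OF arc T'] convex_arcD[OF arc] by auto
    show "\<exists>p0. frontier \<Omega>' = curve \<theta>' p0 ` {0..T}"
      unfolding dom(4)
      by (intro exI[of _ "(x' 0, y' 0)"] image_cong refl convex_arc_curve(3)[OF arc, symmetric])
  qed (use dom T convex_arcD[OF arc] in auto)
  have en: "energy T k' = 1 / 2 * integral {0..T} (\<lambda>u. (\<kappa> u)\<^sup>2 * (1 / \<sigma> u))"
    unfolding energy_def k'2 subst(2)[OF f2 T', symmetric] v(2)
    using LBINT_eq_integral_subinterval[OF f2 T'] by simp
  have ar: "area \<Omega>' = - integral {0..T} (\<lambda>u. Y u * (\<sigma> u * cos (\<Theta> u)))"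
  proof -
    have Yc: "continuous_on {0..T} Y" using Y(1) by (rule DERIV_continuous_on)
    have hc: "continuous_on {0..T} (\<lambda>u. Y u * (\<sigma> u * cos (\<Theta> u)))"
      by (intro continuous_intros Yc \<sigma>(1) \<Theta>c)
    have hi: "set_integrable lborel {0..T} (\<lambda>u. Y u * (\<sigma> u * cos (\<Theta> u)))"
      by (rule borel_integrable_atLeastAtMost'[OF hc])
    have "integral {0..T} (\<lambda>u. Y u * (\<sigma> u * cos (\<Theta> u))) = (LBINT t=0..v T. Y t * (\<sigma> t * cos (\<Theta> t)))"
      using LBINT_eq_integral_subinterval[OF hi T'] v(2) by simp
    also have "\<dots> = (LBINT t=0..T. (Y (v t) * (\<sigma> (v t) * cos (\<Theta> (v t)))) * (1 / \<sigma> (v t)))"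
      by (rule subst(2)[OF hi T'])
    also have "\<dots> = integral {0..T} (\<lambda>t. (Y (v t) * (\<sigma> (v t) * cos (\<Theta> (v t)))) * (1 / \<sigma> (v t)))"
      by (rule LBINT_eq_integral_subinterval[OF subst(1)[OF hi T'] T'])
    also have "\<dots> = integral {0..T} (\<lambda>s. y' s * cos (\<theta>' s))"
      by (rule integral_cong) (simp add: y'_def \<theta>'_def \<sigma>nz[OF vr])
    finally show ?thesis using convex_arc_area[OF arc dom(1-4)] by (simp add: area_def)
  qed
  show thesis by (rule that[OF adm en ar])
qed

section \<open>Uniform first-order expansions\<close>

text \<open>The primitive of \<open>w\<close> is only absolutely continuous. The defect \<open>D\<close> satisfies \<open>|D b - D a| \<le> 2 C (b - a) (N b - N a)\<close> with
  \<open>N\<close> the continuous primitive of \<open>|w|\<close>, hence has derivative zero everywhere.\<close>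

lemma integral_by_parts_indefinite:
  fixes w G \<gamma> :: "real \<Rightarrow> real"
  assumes T: "0 \<le> T" and w: "set_integrable lborel {0..T} w"
    and G: "\<And>u. u \<in> {0..T} \<Longrightarrow> (G has_real_derivative \<gamma> u) (at u within {0..T})"
    and \<gamma>: "continuous_on {0..T} \<gamma>"
  shows "integral {0..T} (\<lambda>u. integral {0..u} w * \<gamma> u) = integral {0..T} w * G T - integral {0..T} (\<lambda>u. w u * G u)"
proof -
  define \<phi> where "\<phi> = (\<lambda>u. integral {0..u} w)"
  define N where "N = (\<lambda>u. integral {0..u} (\<lambda>s. \<bar>w s\<bar>))"
  have Gc: "continuous_on {0..T} G" using G by (rule DERIV_continuous_on)
  have wi: "w integrable_on {0..T}" using set_borel_integral_eq_integral(1)[OF w] .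
  have awi: "(\<lambda>s. \<bar>w s\<bar>) integrable_on {0..T}"
    using set_borel_integral_eq_integral(1)[OF set_integrable_abs[OF w]] .
  have \<phi>c: "continuous_on {0..T} \<phi>" unfolding \<phi>_def by (rule indefinite_integral_continuous_1[OF wi])
  have Nc: "continuous_on {0..T} N" unfolding N_def by (rule indefinite_integral_continuous_1[OF awi])
  have \<phi>\<gamma>: "(\<lambda>u. \<phi> u * \<gamma> u) integrable_on {0..T}"
    by (intro integrable_continuous_real continuous_intros \<phi>c \<gamma>)
  have wG: "(\<lambda>u. w u * G u) integrable_on {0..T}"
    using set_borel_integral_eq_integral(1)[OF set_integrable_mult_continuous[OF w Gc]] .
  obtain C where C: "0 \<le> C" "\<And>u. u \<in> {0..T} \<Longrightarrow> \<bar>\<gamma> u\<bar> \<le> C"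
    using continuous_on_Icc_bound[OF \<gamma>] by blast
  define D where "D = (\<lambda>u. integral {0..u} (\<lambda>s. \<phi> s * \<gamma> s) + integral {0..u} (\<lambda>s. w s * G s) - \<phi> u * G u)"
  have split: "integral {0..b} f = integral {0..a} f + integral {a..b} f"
    if "f integrable_on {0..T}" "a \<in> {0..T}" "b \<in> {0..T}" "a \<le> b" for f :: "real \<Rightarrow> real" and a b
    by (rule Henstock_Kurzweil_Integration.integral_combine[symmetric])
      (use that integrable_on_subinterval[OF that(1), of 0 b] in auto)
  have bound: "\<bar>D b - D a\<bar> \<le> 2 * C * (b - a) * (N b - N a)" if ab: "a \<in> {0..T}" "b \<in> {0..T}" "a \<le> b" for a b
  proof -
    have sub: "{a..b} \<subseteq> {0..T}" using ab by auto
    note i = integrable_on_subinterval[OF _ sub]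
    have Gab: "G b - G s = integral {s..b} \<gamma>" if "s \<in> {a..b}" for s
      by (rule sym, rule integral_unique, rule fundamental_theorem_of_calculus)
        (use that ab DERIV_subset[OF G] in \<open>auto simp: has_real_derivative_iff_has_vector_derivative[symmetric]\<close>)
    have \<gamma>i: "\<gamma> integrable_on {a..b}" by (rule integrable_continuous_real, rule continuous_on_subset[OF \<gamma> sub])
    \<comment> \<open>The increment of \<open>\<phi> * G\<close> is split with \<open>G\<close>
      frozen at \<open>b\<close> and \<open>\<phi>\<close> frozen at \<open>a\<close>. Each
      remaining integrand then contains the variation of one factor, which yields the product of
      \<open>b - a\<close> and \<open>N b - N a\<close>.\<close>
    have "D b - D a = integral {a..b} (\<lambda>s. \<phi> s * \<gamma> s) + integral {a..b} (\<lambda>s. w s * G s)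
        - (integral {a..b} w * G b + \<phi> a * integral {a..b} \<gamma>)"
      using split[OF \<phi>\<gamma> ab] split[OF wG ab] split[OF wi ab] Gab[of a] ab
      by (simp add: D_def \<phi>_def algebra_simps)
    also have "\<dots> = integral {a..b} (\<lambda>s. \<phi> s * \<gamma> s - \<phi> a * \<gamma> s) + integral {a..b} (\<lambda>s. w s * G s - w s * G b)"
      using i[OF \<phi>\<gamma>] i[OF wG] i[OF wi] \<gamma>i
      by (subst (1 2) integral_diff) (auto intro: integrable_on_mult_left integrable_on_mult_right)
    also have "\<dots> = integral {a..b} (\<lambda>s. (\<phi> s - \<phi> a) * \<gamma> s) + integral {a..b} (\<lambda>s. w s * (G s - G b))"
      by (simp add: algebra_simps)
    finally have eq: "D b - D a = \<dots>" .
    have Nab: "N b - N a = integral {a..b} (\<lambda>s. \<bar>w s\<bar>)" using split[OF awi ab] by (simp add: N_def)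
    have 1: "\<bar>integral {a..b} (\<lambda>s. (\<phi> s - \<phi> a) * \<gamma> s)\<bar> \<le> C * (b - a) * (N b - N a)"
    proof -
      have "norm (integral {a..b} (\<lambda>s. (\<phi> s - \<phi> a) * \<gamma> s)) \<le> integral {a..b} (\<lambda>s. (N b - N a) * C)"
      proof (rule integral_norm_bound_integral)
        show "(\<lambda>s. (\<phi> s - \<phi> a) * \<gamma> s) integrable_on {a..b}"
          by (intro integrable_continuous_real continuous_intros continuous_on_subset[OF \<phi>c sub] continuous_on_subset[OF \<gamma> sub])
        fix s assume s: "s \<in> {a..b}"
        have sT: "s \<in> {0..T}" using s sub by auto
        have "\<bar>\<phi> s - \<phi> a\<bar> = \<bar>integral {a..s} w\<bar>" using split[OF wi ab(1) sT] s by (simp add: \<phi>_def)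
        also have "\<dots> \<le> integral {a..s} (\<lambda>s. \<bar>w s\<bar>)"
          using integral_norm_bound_integral[of w "{a..s}" "\<lambda>s. \<bar>w s\<bar>"]
            integrable_on_subinterval[OF wi, of a s] integrable_on_subinterval[OF awi, of a s] s sT ab by auto
        also have "\<dots> \<le> integral {a..b} (\<lambda>s. \<bar>w s\<bar>)"
          by (rule integral_subset_le)
            (use integrable_on_subinterval[OF awi, of a s] integrable_on_subinterval[OF awi, of a b] s sT ab in auto)
        finally have "\<bar>\<phi> s - \<phi> a\<bar> \<le> N b - N a" using Nab by simp
        then show "norm ((\<phi> s - \<phi> a) * \<gamma> s) \<le> (N b - N a) * C"
          using C(2)[OF sT] by (auto simp: abs_mult intro!: mult_mono)
      qed auto
      then show ?thesis using ab by (simp add: algebra_simps)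
    qed
    have 2: "\<bar>integral {a..b} (\<lambda>s. w s * (G s - G b))\<bar> \<le> C * (b - a) * (N b - N a)"
    proof -
      have "norm (integral {a..b} (\<lambda>s. w s * (G s - G b))) \<le> integral {a..b} (\<lambda>s. \<bar>w s\<bar> * (C * (b - a)))"
      proof (rule integral_norm_bound_integral)
        have "(\<lambda>s. w s * G s - w s * G b) integrable_on {a..b}"
          by (intro integrable_diff i[OF wG] integrable_on_mult_left i[OF wi])
        then show "(\<lambda>s. w s * (G s - G b)) integrable_on {a..b}" by (simp add: algebra_simps)
        show "(\<lambda>s. \<bar>w s\<bar> * (C * (b - a))) integrable_on {a..b}"
          by (intro integrable_on_mult_left i[OF awi])
        fix s assume s: "s \<in> {a..b}"
        have "\<bar>G s - G b\<bar> = \<bar>integral {s..b} \<gamma>\<bar>" using Gab[OF s] by simp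
        also have "\<dots> \<le> C * (b - s)"
          using integral_norm_bound_integral[of \<gamma> "{s..b}" "\<lambda>_. C"] integrable_on_subinterval[OF \<gamma>i, of s b] s C(2) ab
          by (auto simp: mult.commute)
        also have "\<dots> \<le> C * (b - a)" using s C(1) by (intro mult_left_mono) auto
        finally show "norm (w s * (G s - G b)) \<le> \<bar>w s\<bar> * (C * (b - a))"
          by (auto simp: abs_mult intro!: mult_left_mono)
      qed
      then show ?thesis using Nab by (simp add: mult.commute)
    qed
    show ?thesis using eq 1 2 by linarith
  qed
  have "(D has_real_derivative 0) (at u within {0..T})" if u: "u \<in> {0..T}" for u
    unfolding has_field_derivative_iff
  proof (rule Lim_null_comparison)
    show "\<forall>\<^sub>F s in at u within {0..T}. norm ((D s - D u) / (s - u)) \<le> 2 * C * \<bar>N s - N u\<bar>"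
      unfolding eventually_at_filter
    proof (intro always_eventually allI impI)
      fix s assume "s \<noteq> u" and s: "s \<in> {0..T}"
      have "\<bar>D s - D u\<bar> \<le> 2 * C * \<bar>s - u\<bar> * \<bar>N s - N u\<bar>"
      proof (cases "u \<le> s")
        case True
        have "2 * C * (s - u) * (N s - N u) \<le> 2 * C * \<bar>s - u\<bar> * \<bar>N s - N u\<bar>"
          using True C(1) by (auto intro!: mult_left_mono)
        then show ?thesis using bound[OF u s True] by simp
      next
        case False
        have "2 * C * (u - s) * (N u - N s) \<le> 2 * C * \<bar>s - u\<bar> * \<bar>N s - N u\<bar>"
          using False C(1) by (auto intro!: mult_left_mono)
        then show ?thesis using bound[OF s u] False by (simp add: abs_minus_commute)
      qed
      then show "norm ((D s - D u) / (s - u)) \<le> 2 * C * \<bar>N s - N u\<bar>"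
        using \<open>s \<noteq> u\<close> by (simp add: field_simps)
    qed
    have "((\<lambda>s. N s - N u) \<longlongrightarrow> 0) (at u within {0..T})"
      using Nc u by (simp add: continuous_on_def LIM_zero)
    then show "((\<lambda>s. 2 * C * \<bar>N s - N u\<bar>) \<longlongrightarrow> 0) (at u within {0..T})"
      by (intro tendsto_mult_right_zero tendsto_rabs_zero)
  qed
  then have "\<exists>c. \<forall>u\<in>{0..T}. D u = c"
    by (intro has_field_derivative_zero_constant) auto
  then have "D T = D 0" using T by auto
  then show ?thesis by (simp add: D_def \<phi>_def)
qed

lemma integral_linear_combination:
  fixes f g h :: "real \<Rightarrow> real"
  assumes "f integrable_on A" "g integrable_on A" "h integrable_on A"
  shows "integral A f - integral A g - t * integral A h = integral A (\<lambda>s. f s - g s - t * h s)"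
  using has_integral_diff[OF has_integral_diff[OF assms(1,2)[THEN integrable_integral]]
      has_integral_mult_right[OF integrable_integral[OF assms(3)], of t]]
  by (simp add: integral_unique)

text \<open>The expansion is one-sided in \<open>t\<close> because the competitors exist only for
  small positive \<open>t\<close>. Scalars depending on \<open>t\<close> are treated as functions
  constant in \<open>u\<close>, so one calculus serves both. A uniform quadratic remainder passes
  through sums, products, reciprocals and integrals, and no derivative in \<open>t\<close> has to be
  exchanged with an integral.\<close>

definition first_order :: "real \<Rightarrow> (real \<Rightarrow> real \<Rightarrow> real) \<Rightarrow> (real \<Rightarrow> real) \<Rightarrow> (real \<Rightarrow> real) \<Rightarrow> bool" where
  "first_order T F F0 F1 \<longleftrightarrow> continuous_on {0..T} F0 \<and> continuous_on {0..T} F1 \<and>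
     (\<exists>C. \<forall>\<^sub>F t in at_right 0. continuous_on {0..T} (F t) \<and>
        (\<forall>u\<in>{0..T}. \<bar>F t u - F0 u - t * F1 u\<bar> \<le> C * t\<^sup>2))"

lemma first_orderI:
  assumes "continuous_on {0..T} F0" "continuous_on {0..T} F1" "0 < d"
    "\<And>t. 0 < t \<Longrightarrow> t < d \<Longrightarrow> continuous_on {0..T} (F t)"
    "\<And>t u. 0 < t \<Longrightarrow> t < d \<Longrightarrow> u \<in> {0..T} \<Longrightarrow> \<bar>F t u - F0 u - t * F1 u\<bar> \<le> C * t\<^sup>2"
  shows "first_order T F F0 F1"
  unfolding first_order_def
  by (intro conjI exI[of _ C] eventually_at_rightI[of 0 d]) (use assms in auto)

text \<open>The constants are normalised once: \<open>d\<close> at most 1 lets higher powers of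
  \<open>t\<close> be absorbed, and a single nonnegative \<open>B\<close> bounds both
  coefficients.\<close>

lemma first_orderE:
  assumes "first_order T F F0 F1"
  obtains B C d where "continuous_on {0..T} F0" "continuous_on {0..T} F1" "0 < d" "d \<le> 1" "0 \<le> B" "0 \<le> C"
    "\<forall>u\<in>{0..T}. \<bar>F0 u\<bar> \<le> B" "\<forall>u\<in>{0..T}. \<bar>F1 u\<bar> \<le> B"
    "\<forall>t. 0 < t \<longrightarrow> t < d \<longrightarrow> continuous_on {0..T} (F t)"
    "\<forall>t u. 0 < t \<longrightarrow> t < d \<longrightarrow> u \<in> {0..T} \<longrightarrow> \<bar>F t u - F0 u - t * F1 u\<bar> \<le> C * t\<^sup>2"
proof -
  from assms obtain C where c: "continuous_on {0..T} F0" "continuous_on {0..T} F1" and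
    ev: "\<forall>\<^sub>F t in at_right 0. continuous_on {0..T} (F t) \<and>
        (\<forall>u\<in>{0..T}. \<bar>F t u - F0 u - t * F1 u\<bar> \<le> C * t\<^sup>2)"
    unfolding first_order_def by blast
  obtain b where b: "0 < b" "\<And>t. 0 < t \<Longrightarrow> t < b \<Longrightarrow> continuous_on {0..T} (F t) \<and>
        (\<forall>u\<in>{0..T}. \<bar>F t u - F0 u - t * F1 u\<bar> \<le> C * t\<^sup>2)"
    using ev unfolding eventually_at_right_field by blast
  obtain B0 where B0: "0 \<le> B0" "\<And>u. u \<in> {0..T} \<Longrightarrow> \<bar>F0 u\<bar> \<le> B0" using continuous_on_Icc_bound[OF c(1)] by blast
  obtain B1 where B1: "0 \<le> B1" "\<And>u. u \<in> {0..T} \<Longrightarrow> \<bar>F1 u\<bar> \<le> B1" using continuous_on_Icc_bound[OF c(2)] by blast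
  have C: "\<bar>F t u - F0 u - t * F1 u\<bar> \<le> \<bar>C\<bar> * t\<^sup>2" if "0 < t" "t < b" "u \<in> {0..T}" for t u
  proof -
    have "\<bar>F t u - F0 u - t * F1 u\<bar> \<le> C * t\<^sup>2" using b(2) that by auto
    also have "\<dots> \<le> \<bar>C\<bar> * t\<^sup>2" by (intro mult_right_mono) auto
    finally show ?thesis .
  qed
  have B: "\<bar>F0 u\<bar> \<le> B0 + B1" "\<bar>F1 u\<bar> \<le> B0 + B1" if "u \<in> {0..T}" for u
    using B0(1) B0(2)[OF that] B1(1) B1(2)[OF that] by linarith+
  show thesis
    by (rule that[of "min b 1" "B0 + B1" "\<bar>C\<bar>"]) (use c b C B B0(1) B1(1) in auto)
qed

lemma first_order_const:
  assumes "continuous_on {0..T} f"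
  shows "first_order T (\<lambda>t. f) f (\<lambda>_. 0)"
  by (rule first_orderI[of _ _ _ 1 _ 0]) (use assms in auto)

lemma first_order_param: "first_order T (\<lambda>t _. t) (\<lambda>_. 0) (\<lambda>_. 1)"
  by (rule first_orderI[of _ _ _ 1 _ 0]) auto

lemma first_order_add:
  assumes "first_order T F F0 F1" "first_order T G G0 G1"
  shows "first_order T (\<lambda>t u. F t u + G t u) (\<lambda>u. F0 u + G0 u) (\<lambda>u. F1 u + G1 u)"
proof -
  obtain B C d where F0: "continuous_on {0..T} F0" "continuous_on {0..T} F1" "0 < d" "d \<le> 1" "0 \<le> B" "0 \<le> C"
    "\<forall>u\<in>{0..T}. \<bar>F0 u\<bar> \<le> B" "\<forall>u\<in>{0..T}. \<bar>F1 u\<bar> \<le> B"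
    "\<forall>t. 0 < t \<longrightarrow> t < d \<longrightarrow> continuous_on {0..T} (F t)"
    "\<forall>t u. 0 < t \<longrightarrow> t < d \<longrightarrow> u \<in> {0..T} \<longrightarrow> \<bar>F t u - F0 u - t * F1 u\<bar> \<le> C * t\<^sup>2"
    by (rule first_orderE[OF assms(1)])
  note F = F0[rule_format]
  obtain B' C' d' where G0: "continuous_on {0..T} G0" "continuous_on {0..T} G1" "0 < d'" "d' \<le> 1" "0 \<le> B'" "0 \<le> C'"
    "\<forall>u\<in>{0..T}. \<bar>G0 u\<bar> \<le> B'" "\<forall>u\<in>{0..T}. \<bar>G1 u\<bar> \<le> B'"
    "\<forall>t. 0 < t \<longrightarrow> t < d' \<longrightarrow> continuous_on {0..T} (G t)"
    "\<forall>t u. 0 < t \<longrightarrow> t < d' \<longrightarrow> u \<in> {0..T} \<longrightarrow> \<bar>G t u - G0 u - t * G1 u\<bar> \<le> C' * t\<^sup>2"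
    by (rule first_orderE[OF assms(2)])
  note G = G0[rule_format]
  show ?thesis
  proof (rule first_orderI[of _ _ _ "min d d'" _ "C + C'"])
    fix t u assume t: "0 < t" "t < min d d'" and u: "u \<in> {0..T}"
    have "F t u + G t u - (F0 u + G0 u) - t * (F1 u + G1 u) = (F t u - F0 u - t * F1 u) + (G t u - G0 u - t * G1 u)"
      by (simp add: algebra_simps)
    then show "\<bar>F t u + G t u - (F0 u + G0 u) - t * (F1 u + G1 u)\<bar> \<le> (C + C') * t\<^sup>2"
      using F(10)[of t u] G(10)[of t u] t u unfolding distrib_right by linarith
  qed (use F G in \<open>auto intro!: continuous_intros\<close>)
qed

lemma first_order_cong:
  assumes "first_order T F F0 F1"
    and "\<And>t u. u \<in> {0..T} \<Longrightarrow> G t u = F t u" "\<And>u. u \<in> {0..T} \<Longrightarrow> G0 u = F0 u" "\<And>u. u \<in> {0..T} \<Longrightarrow> G1 u = F1 u"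
  shows "first_order T G G0 G1"
proof -
  have "continuous_on {0..T} G0 \<longleftrightarrow> continuous_on {0..T} F0" "continuous_on {0..T} G1 \<longleftrightarrow> continuous_on {0..T} F1"
    "\<And>t. continuous_on {0..T} (G t) \<longleftrightarrow> continuous_on {0..T} (F t)"
    using assms(2-4) by (auto intro!: continuous_on_cong)
  moreover have "(\<forall>u\<in>{0..T}. \<bar>G t u - G0 u - t * G1 u\<bar> \<le> C * t\<^sup>2) \<longleftrightarrow>
      (\<forall>u\<in>{0..T}. \<bar>F t u - F0 u - t * F1 u\<bar> \<le> C * t\<^sup>2)" for t C
    using assms(2-4) by (intro ball_cong) auto
  ultimately show ?thesis using assms(1) unfolding first_order_def by simp
qed

lemma first_order_mult:
  assumes "first_order T F F0 F1" "first_order T G G0 G1"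
  shows "first_order T (\<lambda>t u. F t u * G t u) (\<lambda>u. F0 u * G0 u) (\<lambda>u. F1 u * G0 u + F0 u * G1 u)"
proof -
  obtain B C d where F0: "continuous_on {0..T} F0" "continuous_on {0..T} F1" "0 < d" "d \<le> 1" "0 \<le> B" "0 \<le> C"
    "\<forall>u\<in>{0..T}. \<bar>F0 u\<bar> \<le> B" "\<forall>u\<in>{0..T}. \<bar>F1 u\<bar> \<le> B"
    "\<forall>t. 0 < t \<longrightarrow> t < d \<longrightarrow> continuous_on {0..T} (F t)"
    "\<forall>t u. 0 < t \<longrightarrow> t < d \<longrightarrow> u \<in> {0..T} \<longrightarrow> \<bar>F t u - F0 u - t * F1 u\<bar> \<le> C * t\<^sup>2"
    by (rule first_orderE[OF assms(1)])
  note F = F0[rule_format]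
  obtain B' C' d' where G0: "continuous_on {0..T} G0" "continuous_on {0..T} G1" "0 < d'" "d' \<le> 1" "0 \<le> B'" "0 \<le> C'"
    "\<forall>u\<in>{0..T}. \<bar>G0 u\<bar> \<le> B'" "\<forall>u\<in>{0..T}. \<bar>G1 u\<bar> \<le> B'"
    "\<forall>t. 0 < t \<longrightarrow> t < d' \<longrightarrow> continuous_on {0..T} (G t)"
    "\<forall>t u. 0 < t \<longrightarrow> t < d' \<longrightarrow> u \<in> {0..T} \<longrightarrow> \<bar>G t u - G0 u - t * G1 u\<bar> \<le> C' * t\<^sup>2"
    by (rule first_orderE[OF assms(2)])
  note G = G0[rule_format]
  show ?thesis
  \<comment> \<open>The summands of the constant bound, in this order, the remainder of
    \<open>F\<close> times \<open>G\<close>, the linear part of \<open>F\<close> times the remainder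
    of \<open>G\<close>, and the cross term of order \<open>t\<^sup>2\<close>.\<close>
  proof (rule first_orderI[of _ _ _ "min d d'" _ "C * (2 * B' + C') + 2 * B * C' + B * B'"])
    fix t u assume t: "0 < t" "t < min d d'" and u: "u \<in> {0..T}"
    define p where "p = F t u - F0 u - t * F1 u"
    define q where "q = G t u - G0 u - t * G1 u"
    have t1: "t \<le> 1" "t\<^sup>2 \<le> 1" using t F(4) by (auto simp: power_le_one)
    have p: "\<bar>p\<bar> \<le> C * t\<^sup>2" and q: "\<bar>q\<bar> \<le> C' * t\<^sup>2" using F(10) G(10) t u by (auto simp: p_def q_def)
    have tG: "\<bar>t * G1 u\<bar> \<le> B'" and tF: "\<bar>t * F1 u\<bar> \<le> B"
      using mult_mono[of "\<bar>t\<bar>" 1 "\<bar>G1 u\<bar>" B'] mult_mono[of "\<bar>t\<bar>" 1 "\<bar>F1 u\<bar>" B] t t1 F(8)[OF u] G(8)[OF u]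
      by (auto simp: abs_mult)
    have "C' * t\<^sup>2 \<le> C'" using t1 G(6) by (simp add: mult_left_le)
    then have Gb: "\<bar>G t u\<bar> \<le> 2 * B' + C'" using q tG G(7)[OF u] unfolding q_def by linarith
    have Fb: "\<bar>F0 u + t * F1 u\<bar> \<le> 2 * B" using tF F(7)[OF u] by linarith
    have e: "F t u * G t u - F0 u * G0 u - t * (F1 u * G0 u + F0 u * G1 u)
        = p * G t u + (F0 u + t * F1 u) * q + t\<^sup>2 * (F1 u * G1 u)"
      unfolding p_def q_def by (simp add: algebra_simps power2_eq_square)
    have 1: "\<bar>p * G t u\<bar> \<le> (C * t\<^sup>2) * (2 * B' + C')" unfolding abs_mult
      using F(6) by (intro mult_mono p Gb) auto
    have 2: "\<bar>(F0 u + t * F1 u) * q\<bar> \<le> (2 * B) * (C' * t\<^sup>2)" unfolding abs_mult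
      using F(5) by (intro mult_mono Fb q) auto
    have 3: "\<bar>t\<^sup>2 * (F1 u * G1 u)\<bar> \<le> t\<^sup>2 * (B * B')" unfolding abs_mult
      using F(5,8) G(8) u by (intro mult_mono) auto
    have "(C * (2 * B' + C') + 2 * B * C' + B * B') * t\<^sup>2 =
        (C * t\<^sup>2) * (2 * B' + C') + (2 * B) * (C' * t\<^sup>2) + t\<^sup>2 * (B * B')" by (simp add: algebra_simps)
    then show "\<bar>F t u * G t u - F0 u * G0 u - t * (F1 u * G0 u + F0 u * G1 u)\<bar>
        \<le> (C * (2 * B' + C') + 2 * B * C' + B * B') * t\<^sup>2"
      unfolding e using 1 2 3 by linarith
  qed (use F G in \<open>auto intro!: continuous_intros\<close>)
qed

lemma first_order_diff:
  assumes "first_order T F F0 F1" "first_order T G G0 G1"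
  shows "first_order T (\<lambda>t u. F t u - G t u) (\<lambda>u. F0 u - G0 u) (\<lambda>u. F1 u - G1 u)"
  by (rule first_order_cong[OF first_order_add[OF assms(1)
        first_order_mult[OF first_order_const[OF continuous_on_const[of _ "-1"]] assms(2)]]]) auto

text \<open>Only the base value 1 is needed: at \<open>t = 0\<close> the curve has unit speed and
  the closing system has determinant 1. The second clause is what makes the competitors legitimate
  for small \<open>t\<close>.\<close>

lemma first_order_inverse:
  assumes "first_order T F (\<lambda>_. 1) F1"
  shows "first_order T (\<lambda>t u. 1 / F t u) (\<lambda>_. 1) (\<lambda>u. - F1 u)"
    and "\<forall>\<^sub>F t in at_right 0. \<forall>u\<in>{0..T}. 0 < F t u"
proof -
  obtain B C d where F0: "continuous_on {0..T} (\<lambda>_. 1::real)" "continuous_on {0..T} F1" "0 < d" "d \<le> 1" "0 \<le> B" "0 \<le> C"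
    "\<forall>u\<in>{0..T}. \<bar>1::real\<bar> \<le> B" "\<forall>u\<in>{0..T}. \<bar>F1 u\<bar> \<le> B"
    "\<forall>t. 0 < t \<longrightarrow> t < d \<longrightarrow> continuous_on {0..T} (F t)"
    "\<forall>t u. 0 < t \<longrightarrow> t < d \<longrightarrow> u \<in> {0..T} \<longrightarrow> \<bar>F t u - 1 - t * F1 u\<bar> \<le> C * t\<^sup>2"
    by (rule first_orderE[OF assms])
  note F = F0[rule_format]
  \<comment> \<open>Since \<open>F t u\<close> deviates from 1 by at most
    \<open>(B + C) * t\<close>, this threshold keeps it above one half. The added 1 keeps the
    denominator positive when \<open>B + C = 0\<close>.\<close>
  define e where "e = min d (1 / (2 * (B + C + 1)))"
  have e: "0 < e" using F by (simp add: e_def)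
  have near: "\<bar>F t u - 1\<bar> \<le> (B + C) * t" "1 / 2 \<le> F t u" if t: "0 < t" "t < e" and u: "u \<in> {0..T}" for t u
  proof -
    have td: "t < d" "t < 1 / (2 * (B + C + 1))" using t by (auto simp: e_def)
    have "\<bar>t * F1 u\<bar> \<le> t * B" using F(8)[OF u] t by (simp add: abs_mult)
    moreover have "C * t\<^sup>2 \<le> C * t" using td(1) F(4,6) t by (intro mult_left_mono) (auto simp: power2_eq_square mult_left_le)
    ultimately show 1: "\<bar>F t u - 1\<bar> \<le> (B + C) * t" using F(10)[OF t(1) td(1) u] unfolding distrib_right
      by (smt (verit) mult.commute)
    have "(B + C) * t \<le> (B + C + 1) * t" using t by simp
    also have "\<dots> \<le> 1 / 2" using td(2) F(5,6) by (simp add: field_simps)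
    finally show "1 / 2 \<le> F t u" using 1 by linarith
  qed
  show "\<forall>\<^sub>F t in at_right 0. \<forall>u\<in>{0..T}. 0 < F t u"
    by (rule eventually_at_rightI[of 0 e]) (use near(2) e in \<open>force+\<close>)
  show "first_order T (\<lambda>t u. 1 / F t u) (\<lambda>_. 1) (\<lambda>u. - F1 u)"
  proof (rule first_orderI[of _ _ _ e _ "2 * (C + B * (B + C))"])
    fix t assume t: "0 < t" "t < e"
    then have td: "t < d" by (simp add: e_def)
    have nz: "F t u \<noteq> 0" if "u \<in> {0..T}" for u using near(2)[OF t that] by auto
    show "continuous_on {0..T} (\<lambda>u. 1 / F t u)"
      by (intro continuous_intros F(9)[OF t(1) td] ballI nz)
    fix u assume u: "u \<in> {0..T}"
    define p where "p = F t u - 1 - t * F1 u"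
    have e1: "1 / F t u - 1 - t * - F1 u = (- p + (t * F1 u) * (F t u - 1)) / F t u"
      unfolding p_def using nz[OF u] by (simp add: field_simps)
    have "\<bar>(t * F1 u) * (F t u - 1)\<bar> \<le> (t * B) * ((B + C) * t)"
      unfolding abs_mult[of "t * F1 u"]
      by (intro mult_mono near(1)[OF t u]) (use F(5) F(8)[OF u] t in \<open>auto simp: abs_mult\<close>)
    moreover have "\<bar>p\<bar> \<le> C * t\<^sup>2" using F(10)[OF t(1) td u] by (simp add: p_def)
    ultimately have n: "\<bar>- p + (t * F1 u) * (F t u - 1)\<bar> \<le> C * t\<^sup>2 + (t * B) * ((B + C) * t)" by linarith
    have "\<bar>1 / F t u - 1 - t * - F1 u\<bar> = \<bar>- p + (t * F1 u) * (F t u - 1)\<bar> / F t u"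
      unfolding e1 using near(2)[OF t u] by (simp add: abs_divide)
    also have "\<dots> \<le> \<bar>- p + (t * F1 u) * (F t u - 1)\<bar> / (1 / 2)"
      using near(2)[OF t u] by (intro divide_left_mono) auto
    also have "\<dots> \<le> 2 * (C + B * (B + C)) * t\<^sup>2" using n by (simp add: algebra_simps power2_eq_square)
    finally show "\<bar>1 / F t u - 1 - t * - F1 u\<bar> \<le> 2 * (C + B * (B + C)) * t\<^sup>2" .
  qed (use F e in \<open>auto intro!: continuous_intros\<close>)
qed

lemma first_order_integral:
  assumes "first_order T F F0 F1"
  shows "first_order T (\<lambda>t u. integral {0..u} (F t)) (\<lambda>u. integral {0..u} F0) (\<lambda>u. integral {0..u} F1)"
proof -
  obtain B C d where F0: "continuous_on {0..T} F0" "continuous_on {0..T} F1" "0 < d" "d \<le> 1" "0 \<le> B" "0 \<le> C"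
    "\<forall>u\<in>{0..T}. \<bar>F0 u\<bar> \<le> B" "\<forall>u\<in>{0..T}. \<bar>F1 u\<bar> \<le> B"
    "\<forall>t. 0 < t \<longrightarrow> t < d \<longrightarrow> continuous_on {0..T} (F t)"
    "\<forall>t u. 0 < t \<longrightarrow> t < d \<longrightarrow> u \<in> {0..T} \<longrightarrow> \<bar>F t u - F0 u - t * F1 u\<bar> \<le> C * t\<^sup>2"
    by (rule first_orderE[OF assms(1)])
  note F = F0[rule_format]
  show ?thesis
  proof (rule first_orderI[of _ _ _ d _ "T * C"])
    fix t u assume t: "0 < t" "t < d" and u: "u \<in> {0..T}"
    have sub: "{0..u} \<subseteq> {0..T}" using u by auto
    have i: "f integrable_on {0..u}" if "continuous_on {0..T} f" for f :: "real \<Rightarrow> real"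
      by (rule integrable_continuous_real, rule continuous_on_subset[OF that sub])
    have ii: "F t integrable_on {0..u}" "F0 integrable_on {0..u}" "F1 integrable_on {0..u}"
      using i F t by auto
    have "integral {0..u} (F t) - integral {0..u} F0 - t * integral {0..u} F1 = integral {0..u} (\<lambda>s. F t s - F0 s - t * F1 s)"
      by (rule integral_linear_combination[OF ii])
    also have "norm \<dots> \<le> integral {0..u} (\<lambda>s. C * t\<^sup>2)"
      by (rule integral_norm_bound_integral)
        (use ii F(10)[OF t] u in \<open>auto intro!: integrable_diff integrable_on_mult_right\<close>)
    also have "\<dots> = u * (C * t\<^sup>2)" using u by simp
    also have "\<dots> \<le> T * (C * t\<^sup>2)" using u F(6) by (intro mult_right_mono) auto
    finally show "\<bar>integral {0..u} (F t) - integral {0..u} F0 - t * integral {0..u} F1\<bar> \<le> T * C * t\<^sup>2"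
      by (simp add: mult.assoc)
  qed (use F in \<open>auto intro!: indefinite_integral_continuous_1 integrable_continuous_real\<close>)
qed

text \<open>Weights such as \<open>k\<^sup>2\<close> are merely integrable and cannot enter a
  calculus of continuous functions. They occur only under the integral, against a continuous
  expansion.\<close>

lemma first_order_weighted_integral:
  assumes "first_order T F F0 F1" and w: "set_integrable lborel {0..T} w"
  shows "first_order T (\<lambda>t _. integral {0..T} (\<lambda>s. w s * F t s)) (\<lambda>_. integral {0..T} (\<lambda>s. w s * F0 s))
    (\<lambda>_. integral {0..T} (\<lambda>s. w s * F1 s))"
proof -
  obtain B C d where F0: "continuous_on {0..T} F0" "continuous_on {0..T} F1" "0 < d" "d \<le> 1" "0 \<le> B" "0 \<le> C"
    "\<forall>u\<in>{0..T}. \<bar>F0 u\<bar> \<le> B" "\<forall>u\<in>{0..T}. \<bar>F1 u\<bar> \<le> B"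
    "\<forall>t. 0 < t \<longrightarrow> t < d \<longrightarrow> continuous_on {0..T} (F t)"
    "\<forall>t u. 0 < t \<longrightarrow> t < d \<longrightarrow> u \<in> {0..T} \<longrightarrow> \<bar>F t u - F0 u - t * F1 u\<bar> \<le> C * t\<^sup>2"
    by (rule first_orderE[OF assms(1)])
  note F = F0[rule_format]
  have i: "(\<lambda>s. w s * f s) integrable_on {0..T}" if "continuous_on {0..T} f" for f
    using set_borel_integral_eq_integral(1)[OF set_integrable_mult_continuous[OF w that]] .
  have aw: "(\<lambda>s. \<bar>w s\<bar>) integrable_on {0..T}"
    using set_borel_integral_eq_integral(1)[OF set_integrable_abs[OF w]] .
  show ?thesis
  proof (rule first_orderI[of _ _ _ d _ "integral {0..T} (\<lambda>s. \<bar>w s\<bar>) * C"])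
    fix t u assume t: "0 < t" "t < d"
    have ii: "(\<lambda>s. w s * F t s) integrable_on {0..T}" "(\<lambda>s. w s * F0 s) integrable_on {0..T}" "(\<lambda>s. w s * F1 s) integrable_on {0..T}"
      using i F t by auto
    have "integral {0..T} (\<lambda>s. w s * F t s) - integral {0..T} (\<lambda>s. w s * F0 s) - t * integral {0..T} (\<lambda>s. w s * F1 s)
        = integral {0..T} (\<lambda>s. w s * F t s - w s * F0 s - t * (w s * F1 s))"
      by (rule integral_linear_combination[OF ii])
    also have "norm \<dots> \<le> integral {0..T} (\<lambda>s. \<bar>w s\<bar> * (C * t\<^sup>2))"
    proof (rule integral_norm_bound_integral)
      fix s assume s: "s \<in> {0..T}"
      have "w s * F t s - w s * F0 s - t * (w s * F1 s) = w s * (F t s - F0 s - t * F1 s)"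
        by (simp add: algebra_simps)
      then show "norm (w s * F t s - w s * F0 s - t * (w s * F1 s)) \<le> \<bar>w s\<bar> * (C * t\<^sup>2)"
        using F(10)[OF t s] by (auto simp: abs_mult intro!: mult_left_mono)
    qed (use ii aw in \<open>auto intro!: integrable_diff integrable_on_mult_left integrable_on_mult_right\<close>)
    finally show "\<bar>integral {0..T} (\<lambda>s. w s * F t s) - integral {0..T} (\<lambda>s. w s * F0 s) - t * integral {0..T} (\<lambda>s. w s * F1 s)\<bar>
        \<le> integral {0..T} (\<lambda>s. \<bar>w s\<bar>) * C * t\<^sup>2"
      by (simp add: mult.assoc)
  qed (use F in auto)
qed

text \<open>The addition formulas leave \<open>cos h - 1\<close> and \<open>sin h - h\<close>, each
  at most \<open>h\<^sup>2 / 2\<close>, multiplied by factors bounded by 1.\<close>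

lemma cos_sin_second_order:
  fixes a h :: real
  shows "\<bar>cos (a + h) - cos a + h * sin a\<bar> \<le> h\<^sup>2" "\<bar>sin (a + h) - sin a - h * cos a\<bar> \<le> h\<^sup>2"
proof -
  have c: "\<bar>cos h - 1\<bar> \<le> h\<^sup>2 / 2"
  proof -
    have "1 - cos h = 2 * (sin (h / 2))\<^sup>2" using cos_double_sin[of "h / 2"] by simp
    moreover have "(sin (h / 2))\<^sup>2 \<le> (h / 2)\<^sup>2"
      using abs_sin_x_le_abs_x[of "h / 2"] by (simp only: abs_le_square_iff)
    ultimately show ?thesis by (simp add: power_divide)
  qed
  have s: "\<bar>sin h - h\<bar> \<le> h\<^sup>2 / 2"
    using Maclaurin_sin_bound[of h 2] by (simp add: sin_coeff_def numeral_2_eq_2 inverse_eq_divide)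
  have b: "\<bar>p * sin a\<bar> \<le> \<bar>p\<bar>" "\<bar>p * cos a\<bar> \<le> \<bar>p\<bar>" for p :: real
    by (auto simp: abs_mult intro!: mult_left_le)
  have "cos (a + h) - cos a + h * sin a = (cos h - 1) * cos a - (sin h - h) * sin a"
    by (simp add: cos_add algebra_simps)
  then show "\<bar>cos (a + h) - cos a + h * sin a\<bar> \<le> h\<^sup>2"
    using b(2)[of "cos h - 1"] b(1)[of "sin h - h"] c s by linarith
  have "sin (a + h) - sin a - h * cos a = (cos h - 1) * sin a + (sin h - h) * cos a"
    by (simp add: sin_add algebra_simps)
  then show "\<bar>sin (a + h) - sin a - h * cos a\<bar> \<le> h\<^sup>2"
    using b(1)[of "cos h - 1"] b(2)[of "sin h - h"] c s by linarith
qed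

lemma first_order_cos_sin:
  assumes "continuous_on {0..T} \<theta>" "continuous_on {0..T} \<phi>"
  shows "first_order T (\<lambda>t u. cos (\<theta> u + t * \<phi> u)) (\<lambda>u. cos (\<theta> u)) (\<lambda>u. - (\<phi> u * sin (\<theta> u)))"
    and "first_order T (\<lambda>t u. sin (\<theta> u + t * \<phi> u)) (\<lambda>u. sin (\<theta> u)) (\<lambda>u. \<phi> u * cos (\<theta> u))"
proof -
  obtain B where B: "0 \<le> B" "\<And>u. u \<in> {0..T} \<Longrightarrow> \<bar>\<phi> u\<bar> \<le> B" using continuous_on_Icc_bound[OF assms(2)] by blast
  have h: "(t * \<phi> u)\<^sup>2 \<le> B\<^sup>2 * t\<^sup>2" if "u \<in> {0..T}" for t u
    using mult_left_mono[OF power_mono[OF B(2)[OF that], of 2], of "t\<^sup>2"]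
    by (simp add: power_mult_distrib mult.commute)
  show "first_order T (\<lambda>t u. cos (\<theta> u + t * \<phi> u)) (\<lambda>u. cos (\<theta> u)) (\<lambda>u. - (\<phi> u * sin (\<theta> u)))"
  proof (rule first_orderI[of _ _ _ 1 _ "B\<^sup>2"])
    fix t u assume "u \<in> {0..T}"
    then show "\<bar>cos (\<theta> u + t * \<phi> u) - cos (\<theta> u) - t * - (\<phi> u * sin (\<theta> u))\<bar> \<le> B\<^sup>2 * t\<^sup>2"
      using order_trans[OF cos_sin_second_order(1)[of "\<theta> u" "t * \<phi> u"] h] by (simp add: mult.assoc)
  qed (use assms in \<open>auto intro!: continuous_intros\<close>)
  show "first_order T (\<lambda>t u. sin (\<theta> u + t * \<phi> u)) (\<lambda>u. sin (\<theta> u)) (\<lambda>u. \<phi> u * cos (\<theta> u))"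
  proof (rule first_orderI[of _ _ _ 1 _ "B\<^sup>2"])
    fix t u assume "u \<in> {0..T}"
    then show "\<bar>sin (\<theta> u + t * \<phi> u) - sin (\<theta> u) - t * (\<phi> u * cos (\<theta> u))\<bar> \<le> B\<^sup>2 * t\<^sup>2"
      using order_trans[OF cos_sin_second_order(2)[of "\<theta> u" "t * \<phi> u"] h] by (simp add: mult.assoc)
  qed (use assms in \<open>auto intro!: continuous_intros\<close>)
qed

lemma first_order_nonneg:
  assumes F: "first_order T F F0 F1" and u: "u \<in> {0..T}"
    and ge: "\<forall>\<^sub>F t in at_right 0. F0 u \<le> F t u"
  shows "0 \<le> F1 u"
proof -
  from F obtain C where "\<forall>\<^sub>F t in at_right 0. continuous_on {0..T} (F t) \<and>
        (\<forall>u\<in>{0..T}. \<bar>F t u - F0 u - t * F1 u\<bar> \<le> C * t\<^sup>2)"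
    unfolding first_order_def by blast
  then have ev: "\<forall>\<^sub>F t in at_right 0. - (C * t) \<le> F1 u"
    using ge eventually_at_right_less[of 0]
  proof eventually_elim
    case (elim t)
    then have "0 \<le> t * F1 u + C * t\<^sup>2" using u by (smt (verit))
    then have "0 \<le> t * (F1 u + C * t)" by (simp add: algebra_simps power2_eq_square)
    then show ?case using elim by (simp add: zero_le_mult_iff)
  qed
  have "((\<lambda>t. - (C * t)) \<longlongrightarrow> - (C * 0)) (at_right 0)" by (intro tendsto_intros)
  then show ?thesis using tendsto_upperbound[OF _ ev] by simp
qed

section \<open>First variation\<close>

lemma set_integrable_square_combination:
  fixes k \<psi> :: "real \<Rightarrow> real"
  assumes "set_integrable lborel A (\<lambda>u. (k u)\<^sup>2)" "set_integrable lborel A (\<lambda>u. k u * \<psi> u)"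
    "set_integrable lborel A (\<lambda>u. (\<psi> u)\<^sup>2)"
  shows "set_integrable lborel A (\<lambda>u. (a * k u + b * \<psi> u)\<^sup>2)"
proof -
  have "set_integrable lborel A (\<lambda>u. a\<^sup>2 * (k u)\<^sup>2 + 2 * a * b * (k u * \<psi> u) + b\<^sup>2 * (\<psi> u)\<^sup>2)"
    by (intro set_integral_add(1) set_integrable_mult_right assms)
  then show ?thesis
    by (rule set_integrable_cong[THEN iffD1, rotated -1]) (auto simp: power2_eq_square algebra_simps)
qed

text \<open>\<open>Q e\<close> is the derivative of the functional when only the speed is changed by
  \<open>e\<close>. The repair of the closing conditions changes the speed at rate
  \<open>a1 * e1 + b1 * e2\<close>, and therefore contributes \<open>Q e1 * a1 + Q e2 * b1\<close>.
  Integration by parts shows that \<open>a1\<close> and \<open>b1\<close> are the integrals of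
  \<open>\<psi> - k\<close> against \<open>- y\<close> and \<open>x\<close>, so this contribution
  merges with the direct effect of changing the curvature into one integral against
  \<open>\<psi> - k\<close>.\<close>

lemma first_variation_nonneg:
  fixes \<mu> T :: real and \<theta> k \<psi> x y e1 e2 :: "real \<Rightarrow> real"
  assumes arc: "convex_arc T \<theta> x y" and x0: "x 0 = 0" and y0: "y 0 = 0"
    and k: "\<And>u. 0 \<le> k u" "set_integrable lborel {0..T} k" "set_integrable lborel {0..T} (\<lambda>u. (k u)\<^sup>2)"
    and \<theta>: "\<And>u. u \<in> {0..T} \<Longrightarrow> \<theta> u = \<theta> 0 + integral {0..u} k"
    and \<psi>: "\<And>u. 0 \<le> \<psi> u" "set_integrable lborel {0..T} \<psi>" "set_integrable lborel {0..T} (\<lambda>u. (\<psi> u)\<^sup>2)"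
      "set_integrable lborel {0..T} (\<lambda>u. k u * \<psi> u)" "integral {0..T} \<psi> = 2 * pi"
    and min: "\<And>\<Omega>' \<theta>' k'. admissible \<Omega>' T \<theta>' k' \<Longrightarrow>
      1 / 2 * integral {0..T} (\<lambda>u. (k u)\<^sup>2) - \<mu> * integral {0..T} (\<lambda>u. y u * cos (\<theta> u)) \<le> J \<mu> \<Omega>' T k'"
    and e: "continuous_on {0..T} e1" "continuous_on {0..T} e2"
      "integral {0..T} e1 = 0" "integral {0..T} e2 = 0"
      "integral {0..T} (\<lambda>u. e1 u * cos (\<theta> u)) = 1" "integral {0..T} (\<lambda>u. e1 u * sin (\<theta> u)) = 0"
      "integral {0..T} (\<lambda>u. e2 u * cos (\<theta> u)) = 0" "integral {0..T} (\<lambda>u. e2 u * sin (\<theta> u)) = 1"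
  defines "Q \<equiv> \<lambda>e. \<mu> * integral {0..T} (\<lambda>u. e u * (x u * sin (\<theta> u) - y u * cos (\<theta> u)))
      - 1 / 2 * integral {0..T} (\<lambda>u. (k u)\<^sup>2 * e u)"
  shows "0 \<le> integral {0..T} (\<lambda>u. (\<psi> u - k u) * (k u - \<mu> / 2 * ((x u)\<^sup>2 + (y u)\<^sup>2) - Q e1 * y u + Q e2 * x u))"
proof -
  note a = convex_arcD[OF arc]
  have T: "0 < T" "T \<in> {0..T}" "0 \<in> {0..T}" using a(1) by auto
  have xT: "x T = 0" "y T = 0" using a x0 y0 by auto
  define w where "w = (\<lambda>u. \<psi> u - k u)"
  define \<phi> where "\<phi> = (\<lambda>u. integral {0..u} w)"
  have w: "set_integrable lborel {0..T} w" unfolding w_def using \<psi>(2) k(2) by (rule set_integral_diff(1))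
  have wi: "w integrable_on {0..T}" and ki: "k integrable_on {0..T}"
    using set_borel_integral_eq_integral(1) w k(2) by blast+
  have kw: "set_integrable lborel {0..T} (\<lambda>u. k u * w u)"
  proof -
    have "set_integrable lborel {0..T} (\<lambda>u. k u * \<psi> u - (k u)\<^sup>2)"
      using \<psi>(4) k(3) by (rule set_integral_diff(1))
    then show ?thesis
      by (rule set_integrable_cong[THEN iffD1, rotated -1]) (auto simp: w_def power2_eq_square algebra_simps)
  qed
  have w2: "set_integrable lborel {0..T} (\<lambda>u. (w u)\<^sup>2)"
    using set_integrable_square_combination[OF k(3) \<psi>(4,3), of "-1" 1] by (simp add: w_def)
  have \<phi>c: "continuous_on {0..T} \<phi>" unfolding \<phi>_def by (rule indefinite_integral_continuous_1[OF wi])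
  have \<phi>T: "\<phi> T = 0"
  proof -
    have "integral {0..T} k = 2 * pi" using \<theta>[OF T(2)] a(4) by simp
    moreover have "\<phi> T = integral {0..T} \<psi> - integral {0..T} k"
      unfolding \<phi>_def w_def by (rule integral_diff)
        (use set_borel_integral_eq_integral(1)[OF \<psi>(2)] ki in auto)
    ultimately show ?thesis using \<psi>(5) by simp
  qed
  have cc: "continuous_on {0..T} (\<lambda>u. cos (\<theta> u))" and sc: "continuous_on {0..T} (\<lambda>u. sin (\<theta> u))"
    using a by (auto intro!: continuous_intros)
  have intx: "integral {0..u} (\<lambda>s. cos (\<theta> s)) = x u" and inty: "integral {0..u} (\<lambda>s. sin (\<theta> s)) = y u"
    if "u \<in> {0..T}" for u
    using convex_arc_curve(1,2)[OF arc that] LBINT_eq_integral_continuous[OF cc that]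
      LBINT_eq_integral_continuous[OF sc that] x0 y0 by auto
  have one: "set_integrable lborel {0..T} (\<lambda>_. 1::real)"
    by (rule borel_integrable_atLeastAtMost') simp
  have e1i: "set_integrable lborel {0..T} e1" and e2i: "set_integrable lborel {0..T} e2"
    using borel_integrable_atLeastAtMost' e(1,2) by auto

  define c where "c = (\<lambda>t u. cos (\<theta> u + t * \<phi> u))"
  define s where "s = (\<lambda>t u. sin (\<theta> u + t * \<phi> u))"
  have foc: "first_order T c (\<lambda>u. cos (\<theta> u)) (\<lambda>u. - (\<phi> u * sin (\<theta> u)))"
    and fos: "first_order T s (\<lambda>u. sin (\<theta> u)) (\<lambda>u. \<phi> u * cos (\<theta> u))"
    unfolding c_def s_def using first_order_cos_sin[OF a(2) \<phi>c] by auto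
  \<comment> \<open>With weight 1 these moments are the closing defects of the unit-speed curve of
    angle \<open>\<theta> + t * \<phi>\<close>; with weights \<open>e1\<close>, \<open>e2\<close>
    they form the matrix of the system for the speed coefficients.\<close>
  define m where "m = (\<lambda>e f (t::real). integral {0..T} (\<lambda>u. e u * f t u) :: real)"
  define a1 where "a1 = integral {0..T} (\<lambda>u. \<phi> u * sin (\<theta> u))"
  define b1 where "b1 = - integral {0..T} (\<lambda>u. \<phi> u * cos (\<theta> u))"
  have fom: "first_order T (\<lambda>t _. m e f t) (\<lambda>_. integral {0..T} (\<lambda>u. e u * f0 u)) (\<lambda>_. integral {0..T} (\<lambda>u. e u * f1 u))"
    if "first_order T f f0 f1" "set_integrable lborel {0..T} e" for e f f0 f1
    unfolding m_def by (rule first_order_weighted_integral[OF that])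
  have r1: "first_order T (\<lambda>t _. m (\<lambda>_. 1) c t) (\<lambda>_. 0) (\<lambda>_. - a1)"
    using fom[OF foc one] intx[OF T(2)] xT by (simp add: a1_def)
  have r2: "first_order T (\<lambda>t _. m (\<lambda>_. 1) s t) (\<lambda>_. 0) (\<lambda>_. - b1)"
    using fom[OF fos one] inty[OF T(2)] xT by (simp add: b1_def)
  \<comment> \<open>By duality the matrix is the identity at \<open>t = 0\<close>, so its
    determinant starts at 1. As the closing defect is \<open>(- a1, - b1)\<close> to first order,
    the coefficients \<open>A\<close> and \<open>B\<close> must have derivatives \<open>a1\<close>
    and \<open>b1\<close>.\<close>
  note m11 = fom[OF foc e1i, unfolded e(5)] and m12 = fom[OF foc e2i, unfolded e(7)]
    and m21 = fom[OF fos e1i, unfolded e(6)] and m22 = fom[OF fos e2i, unfolded e(8)]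
  define D where "D = (\<lambda>t. m e1 c t * m e2 s t - m e2 c t * m e1 s t)"
  obtain D1 where D: "first_order T (\<lambda>t _. D t) (\<lambda>_. 1) D1"
    using first_order_diff[OF first_order_mult[OF m11 m22] first_order_mult[OF m12 m21]]
    unfolding D_def by simp
  note iD = first_order_inverse(1)[OF D]
  \<comment> \<open>Cramer's rule for the two closing conditions of the curve with speed \<open>1 + A t * e1 + B t * e2\<close>\<close>
  define A where "A = (\<lambda>t. (m (\<lambda>_. 1) s t * m e2 c t - m (\<lambda>_. 1) c t * m e2 s t) * (1 / D t))"
  define B where "B = (\<lambda>t. (m (\<lambda>_. 1) c t * m e1 s t - m (\<lambda>_. 1) s t * m e1 c t) * (1 / D t))"
  have foA: "first_order T (\<lambda>t _. A t) (\<lambda>_. 0) (\<lambda>_. a1)"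
    using first_order_mult[OF first_order_diff[OF first_order_mult[OF r2 m12] first_order_mult[OF r1 m22]] iD]
    unfolding A_def by simp
  have foB: "first_order T (\<lambda>t _. B t) (\<lambda>_. 0) (\<lambda>_. b1)"
    using first_order_mult[OF first_order_diff[OF first_order_mult[OF r1 m21] first_order_mult[OF r2 m11]] iD]
    unfolding B_def by simp
  define \<sigma> where "\<sigma> = (\<lambda>t u. 1 + A t * e1 u + B t * e2 u)"
  define \<eta> where "\<eta> = (\<lambda>u. a1 * e1 u + b1 * e2 u)"
  have fo\<sigma>: "first_order T \<sigma> (\<lambda>_. 1) \<eta>"
    using first_order_add[OF first_order_add[OF first_order_const[OF continuous_on_const[of _ 1]]
        first_order_mult[OF foA first_order_const[OF e(1)]]] first_order_mult[OF foB first_order_const[OF e(2)]]]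
    unfolding \<sigma>_def \<eta>_def by simp
  have \<eta>c: "continuous_on {0..T} \<eta>" unfolding \<eta>_def by (intro continuous_intros e)
  note i\<sigma> = first_order_inverse(1)[OF fo\<sigma>]
  define Y where "Y = (\<lambda>t u. integral {0..u} (\<lambda>v. \<sigma> t v * s t v))"
  define X where "X = (\<lambda>t u. integral {0..u} (\<lambda>v. \<sigma> t v * c t v))"
  define y1 where "y1 = (\<lambda>u. integral {0..u} (\<lambda>v. \<eta> v * sin (\<theta> v) + \<phi> v * cos (\<theta> v)))"
  have foXd: "first_order T (\<lambda>t u. \<sigma> t u * c t u) (\<lambda>u. cos (\<theta> u)) (\<lambda>u. \<eta> u * cos (\<theta> u) - \<phi> u * sin (\<theta> u))"
    using first_order_mult[OF fo\<sigma> foc] by simp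
  have foY: "first_order T Y y y1"
  proof -
    have "first_order T (\<lambda>t u. \<sigma> t u * s t u) (\<lambda>u. sin (\<theta> u)) (\<lambda>u. \<eta> u * sin (\<theta> u) + \<phi> u * cos (\<theta> u))"
      using first_order_mult[OF fo\<sigma> fos] by simp
    from first_order_integral[OF this] show ?thesis
      by (rule first_order_cong) (auto simp: Y_def y1_def inty)
  qed
  \<comment> \<open>This is the energy of the density \<open>k + t * w\<close> with the square
    expanded: powers of \<open>t\<close> stand outside because weights may not depend on
    \<open>t\<close>. The last term is of second order and leaves no trace in
    \<open>foEn\<close>.\<close>
  define En where "En = (\<lambda>t. 1 / 2 * m (\<lambda>u. (k u)\<^sup>2) (\<lambda>t u. 1 / \<sigma> t u) t
      + t * m (\<lambda>u. k u * w u) (\<lambda>t u. 1 / \<sigma> t u) t + 1 / 2 * (t * t) * m (\<lambda>u. (w u)\<^sup>2) (\<lambda>t u. 1 / \<sigma> t u) t)"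
  define Ar where "Ar = (\<lambda>t. m (\<lambda>_. 1) (\<lambda>t u. Y t u * (\<sigma> t u * c t u)) t)"
  have foEn: "first_order T (\<lambda>t _. En t) (\<lambda>_. 1 / 2 * integral {0..T} (\<lambda>u. (k u)\<^sup>2))
      (\<lambda>_. - (1 / 2) * integral {0..T} (\<lambda>u. (k u)\<^sup>2 * \<eta> u) + integral {0..T} (\<lambda>u. k u * w u))"
    using first_order_add[OF first_order_add[OF
        first_order_mult[OF first_order_const[OF continuous_on_const[of _ "1/2"]] fom[OF i\<sigma> k(3)]]
        first_order_mult[OF first_order_param fom[OF i\<sigma> kw]]]
        first_order_mult[OF first_order_mult[OF first_order_const[OF continuous_on_const[of _ "1/2"]]
            first_order_mult[OF first_order_param first_order_param]] fom[OF i\<sigma> w2]]]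
    unfolding En_def by simp
  have foAr: "first_order T (\<lambda>t _. Ar t) (\<lambda>_. integral {0..T} (\<lambda>u. y u * cos (\<theta> u)))
      (\<lambda>_. integral {0..T} (\<lambda>u. y1 u * cos (\<theta> u) + y u * (\<eta> u * cos (\<theta> u) - \<phi> u * sin (\<theta> u))))"
    using fom[OF first_order_mult[OF foY foXd] one] unfolding Ar_def by simp
  have foJ: "first_order T (\<lambda>t _. En t - \<mu> * Ar t)
      (\<lambda>_. 1 / 2 * integral {0..T} (\<lambda>u. (k u)\<^sup>2) - \<mu> * integral {0..T} (\<lambda>u. y u * cos (\<theta> u)))
      (\<lambda>_. (- (1 / 2) * integral {0..T} (\<lambda>u. (k u)\<^sup>2 * \<eta> u) + integral {0..T} (\<lambda>u. k u * w u))
        - \<mu> * integral {0..T} (\<lambda>u. y1 u * cos (\<theta> u) + y u * (\<eta> u * cos (\<theta> u) - \<phi> u * sin (\<theta> u))))"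
    using first_order_diff[OF foEn first_order_mult[OF first_order_const[OF continuous_on_const[of _ \<mu>]] foAr]]
    by simp
  have ge: "1 / 2 * integral {0..T} (\<lambda>u. (k u)\<^sup>2) - \<mu> * integral {0..T} (\<lambda>u. y u * cos (\<theta> u)) \<le> En t - \<mu> * Ar t"
    if t: "0 < t" "t < 1" and D0: "D t \<noteq> 0" and \<sigma>p: "\<forall>u\<in>{0..T}. 0 < \<sigma> t u" for t
  proof -
    define \<kappa> where "\<kappa> = (\<lambda>u. (1 - t) * k u + t * \<psi> u)"
    \<comment> \<open>The convex combination shows the sign, and this form shows the expansion in
      \<open>t\<close>.\<close>
    have \<kappa>w: "\<kappa> u = k u + t * w u" for u by (simp add: \<kappa>_def w_def algebra_simps)
    have \<kappa>0: "0 \<le> \<kappa> u" for u unfolding \<kappa>_def using t k(1) \<psi>(1) by simp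
    have \<kappa>i: "set_integrable lborel {0..T} \<kappa>" unfolding \<kappa>_def
      by (intro set_integral_add(1) set_integrable_mult_right k(2) \<psi>(2))
    have \<kappa>2: "set_integrable lborel {0..T} (\<lambda>u. (\<kappa> u)\<^sup>2)" unfolding \<kappa>_def
      by (rule set_integrable_square_combination[OF k(3) \<psi>(4,3)])
    define \<Theta> where "\<Theta> = (\<lambda>u. \<theta> u + t * \<phi> u)"
    have \<phi>0: "\<phi> 0 = 0" by (simp add: \<phi>_def)
    have \<Theta>i: "\<Theta> u = \<Theta> 0 + integral {0..u} \<kappa>" if u: "u \<in> {0..T}" for u
    proof -
      have sub: "{0..u} \<subseteq> {0..T}" using u by auto
      have "integral {0..u} \<kappa> = integral {0..u} k + integral {0..u} (\<lambda>u. t * w u)"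
        unfolding \<kappa>w by (rule integral_add)
          (auto intro!: integrable_on_mult_right integrable_on_subinterval[OF wi sub] integrable_on_subinterval[OF ki sub])
      then show ?thesis using \<theta>[OF u] \<phi>0 by (simp add: \<Theta>_def \<phi>_def)
    qed
    have \<Theta>T: "\<Theta> T = \<Theta> 0 + 2 * pi" using a(4) \<phi>T \<phi>0 by (simp add: \<Theta>_def)
    have ct: "continuous_on {0..T} (c t)" "continuous_on {0..T} (s t)"
      unfolding c_def s_def by (intro continuous_intros a \<phi>c)+
    have \<sigma>c: "continuous_on {0..T} (\<sigma> t)" unfolding \<sigma>_def by (intro continuous_intros e)
    have hi: "(f has_integral integral {0..T} f) {0..T}" if "continuous_on {0..T} f" for f :: "real \<Rightarrow> real"
      using integrable_integral[OF integrable_continuous_real[OF that]] .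
    have \<sigma>T: "integral {0..T} (\<sigma> t) = T"
    proof (rule integral_unique)
      have "((\<lambda>_. 1::real) has_integral T) {0..T}" using has_integral_const_real[of "1::real" 0 T] T by simp
      from has_integral_add[OF has_integral_add[OF this has_integral_mult_right[OF hi[OF e(1)], of "A t"]]
          has_integral_mult_right[OF hi[OF e(2)], of "B t"]]
      show "(\<sigma> t has_integral T) {0..T}" unfolding \<sigma>_def e(3,4) by simp
    qed
    have lin: "integral {0..T} (\<lambda>u. \<sigma> t u * f u) = integral {0..T} f
        + A t * integral {0..T} (\<lambda>u. e1 u * f u) + B t * integral {0..T} (\<lambda>u. e2 u * f u)"
      if f: "continuous_on {0..T} f" for f
    proof (rule integral_unique)
      have f1: "continuous_on {0..T} (\<lambda>u. e1 u * f u)" and f2: "continuous_on {0..T} (\<lambda>u. e2 u * f u)"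
        by (intro continuous_intros e f)+
      from has_integral_add[OF has_integral_add[OF hi[OF f] has_integral_mult_right[OF hi[OF f1], of "A t"]]
          has_integral_mult_right[OF hi[OF f2], of "B t"]]
      show "((\<lambda>u. \<sigma> t u * f u) has_integral integral {0..T} f
        + A t * integral {0..T} (\<lambda>u. e1 u * f u) + B t * integral {0..T} (\<lambda>u. e2 u * f u)) {0..T}"
        unfolding \<sigma>_def by (simp add: algebra_simps)
    qed
    have XT: "X t T = 0"
    proof -
      have "X t T = m (\<lambda>_. 1) c t + A t * m e1 c t + B t * m e2 c t"
        unfolding X_def lin[OF ct(1)] by (simp add: m_def)
      also have "\<dots> = 0" unfolding A_def B_def using D0 unfolding D_def by (simp add: field_simps)
      finally show ?thesis .
    qed
    have YT: "Y t T = 0"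
    proof -
      have "Y t T = m (\<lambda>_. 1) s t + A t * m e1 s t + B t * m e2 s t"
        unfolding Y_def lin[OF ct(2)] by (simp add: m_def)
      also have "\<dots> = 0" unfolding A_def B_def using D0 unfolding D_def by (simp add: field_simps)
      finally show ?thesis .
    qed
    have Xd: "(X t has_real_derivative \<sigma> t u * cos (\<Theta> u)) (at u within {0..T})" if "u \<in> {0..T}" for u
    proof -
      have "continuous_on {0..T} (\<lambda>v. \<sigma> t v * c t v)" by (intro continuous_intros \<sigma>c ct)
      from integral_has_real_derivative[OF this that] show ?thesis by (simp add: X_def c_def \<Theta>_def)
    qed
    have Yd: "(Y t has_real_derivative \<sigma> t u * sin (\<Theta> u)) (at u within {0..T})" if "u \<in> {0..T}" for u
    proof -
      have "continuous_on {0..T} (\<lambda>v. \<sigma> t v * s t v)" by (intro continuous_intros \<sigma>c ct)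
      from integral_has_real_derivative[OF this that] show ?thesis by (simp add: Y_def s_def \<Theta>_def)
    qed
    have X0: "X t T = X t 0" "Y t T = Y t 0" using XT YT by (simp_all add: X_def Y_def)
    have \<sigma>p': "\<And>u. u \<in> {0..T} \<Longrightarrow> 0 < \<sigma> t u" using \<sigma>p by blast
    obtain \<Omega>' \<theta>' k' where adm: "admissible \<Omega>' T \<theta>' k'"
      and en: "energy T k' = 1 / 2 * integral {0..T} (\<lambda>u. (\<kappa> u)\<^sup>2 * (1 / \<sigma> t u))"
      and ar: "area \<Omega>' = - integral {0..T} (\<lambda>u. Y t u * (\<sigma> t u * cos (\<Theta> u)))"
      by (rule admissible_competitor[OF T(1) \<kappa>0 \<kappa>i \<kappa>2 \<Theta>i \<Theta>T \<sigma>c \<sigma>p' \<sigma>T Xd X0(1) Yd X0(2)])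
    have ar': "area \<Omega>' = - Ar t" unfolding ar Ar_def m_def by (simp add: \<Theta>_def c_def)
    have en': "energy T k' = En t"
    proof -
      have ic: "continuous_on {0..T} (\<lambda>u. 1 / \<sigma> t u)"
        using \<sigma>p by (intro continuous_intros \<sigma>c) auto
      have si: "((\<lambda>u. f u * (1 / \<sigma> t u)) has_integral m f (\<lambda>t u. 1 / \<sigma> t u) t) {0..T}"
        if "set_integrable lborel {0..T} f" for f
        using integrable_integral[OF set_borel_integral_eq_integral(1)[OF set_integrable_mult_continuous[OF that ic]]]
        by (simp add: m_def)
      have "((\<lambda>u. (\<kappa> u)\<^sup>2 * (1 / \<sigma> t u)) has_integral 2 * En t) {0..T}"
      proof (rule has_integral_eq[rotated])
        show "((\<lambda>u. (k u)\<^sup>2 * (1 / \<sigma> t u) + (2 * t) * (k u * w u * (1 / \<sigma> t u)) + t\<^sup>2 * ((w u)\<^sup>2 * (1 / \<sigma> t u)))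
            has_integral 2 * En t) {0..T}"
          using has_integral_add[OF has_integral_add[OF si[OF k(3)] has_integral_mult_right[OF si[OF kw], of "2 * t"]]
              has_integral_mult_right[OF si[OF w2], of "t\<^sup>2"]]
          unfolding En_def by (simp add: power2_eq_square algebra_simps)
        show "(k u)\<^sup>2 * (1 / \<sigma> t u) + (2 * t) * (k u * w u * (1 / \<sigma> t u)) + t\<^sup>2 * ((w u)\<^sup>2 * (1 / \<sigma> t u))
            = (\<kappa> u)\<^sup>2 * (1 / \<sigma> t u)" for u
          unfolding \<kappa>w by (simp add: power2_eq_square add_divide_distrib[symmetric] algebra_simps)
      qed
      then show ?thesis unfolding en by (simp add: integral_unique)
    qed
    show ?thesis using min[OF adm] unfolding J_def en' ar' by simp
  qed
  have "\<forall>\<^sub>F t in at_right 0. 1 / 2 * integral {0..T} (\<lambda>u. (k u)\<^sup>2) - \<mu> * integral {0..T} (\<lambda>u. y u * cos (\<theta> u)) \<le> En t - \<mu> * Ar t"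
    using first_order_inverse(2)[OF D] first_order_inverse(2)[OF fo\<sigma>] eventually_at_right_real[OF zero_less_one]
  proof eventually_elim
    case (elim t)
    show ?case by (rule ge) (use elim T in auto)
  qed
  from first_order_nonneg[OF foJ T(3) this]
  have nn: "0 \<le> - (1 / 2) * integral {0..T} (\<lambda>u. (k u)\<^sup>2 * \<eta> u) + integral {0..T} (\<lambda>u. k u * w u)
        - \<mu> * integral {0..T} (\<lambda>u. y1 u * cos (\<theta> u) + y u * (\<eta> u * cos (\<theta> u) - \<phi> u * sin (\<theta> u)))" .

  have hi: "(f has_integral integral {0..T} f) {0..T}" if "continuous_on {0..T} f" for f :: "real \<Rightarrow> real"
    using integrable_integral[OF integrable_continuous_real[OF that]] .
  have wf: "((\<lambda>u. f u * g u) has_integral integral {0..T} (\<lambda>u. f u * g u)) {0..T}"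
    if "set_integrable lborel {0..T} f" "continuous_on {0..T} g" for f g :: "real \<Rightarrow> real"
    using integrable_integral[OF set_borel_integral_eq_integral(1)[OF set_integrable_mult_continuous[OF that]]] .
  \<comment> \<open>The boundary term vanishes because \<open>\<psi>\<close> and \<open>k\<close>
    have the same mass, that is, \<open>\<phi> T = 0\<close>.\<close>
  have parts: "integral {0..T} (\<lambda>u. \<phi> u * g u) = - integral {0..T} (\<lambda>u. w u * G u)"
    if "\<And>u. u \<in> {0..T} \<Longrightarrow> (G has_real_derivative g u) (at u within {0..T})" "continuous_on {0..T} g" for G g
    using integral_by_parts_indefinite[OF less_imp_le[OF T(1)] w that] \<phi>T by (simp add: \<phi>_def)
  have a1: "a1 = - integral {0..T} (\<lambda>u. w u * y u)"
    unfolding a1_def by (rule parts[OF a(8) sc])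
  have b1: "b1 = integral {0..T} (\<lambda>u. w u * x u)"
    unfolding b1_def using parts[OF a(7) cc] by simp
  \<comment> \<open>Half the squared distance to the origin is the primitive of the factor that
    multiplies \<open>\<phi>\<close> in the area variation. The term
    \<open>\<mu> / 2 * (x\<^sup>2 + y\<^sup>2)\<close> of the multiplier function comes from
    here.\<close>
  define R where "R = (\<lambda>u. 1 / 2 * ((x u)\<^sup>2 + (y u)\<^sup>2))"
  have Rc: "continuous_on {0..T} R" unfolding R_def by (intro continuous_intros a)
  have p3: "integral {0..T} (\<lambda>u. \<phi> u * (x u * cos (\<theta> u) + y u * sin (\<theta> u))) = - integral {0..T} (\<lambda>u. w u * R u)"
  proof (rule parts)
    show "continuous_on {0..T} (\<lambda>u. x u * cos (\<theta> u) + y u * sin (\<theta> u))" by (intro continuous_intros a)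
    show "(R has_real_derivative x u * cos (\<theta> u) + y u * sin (\<theta> u)) (at u within {0..T})" if "u \<in> {0..T}" for u
      unfolding R_def using a(7)[OF that] a(8)[OF that] by (auto intro!: derivative_eq_intros)
  qed
  \<comment> \<open>Integrating \<open>y1\<close> against the derivative of \<open>x\<close> removes
    the nested integral; the boundary term vanishes because the closed arc starts at the
    origin.\<close>
  have p4: "integral {0..T} (\<lambda>u. y1 u * cos (\<theta> u)) = - integral {0..T} (\<lambda>u. (\<eta> u * sin (\<theta> u) + \<phi> u * cos (\<theta> u)) * x u)"
  proof -
    have c: "continuous_on {0..T} (\<lambda>u. \<eta> u * sin (\<theta> u) + \<phi> u * cos (\<theta> u))"
      by (intro continuous_intros \<eta>c \<phi>c a)
    show ?thesis
      using integral_by_parts_indefinite[OF less_imp_le[OF T(1)] borel_integrable_atLeastAtMost'[OF c] a(7) cc] xT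
      by (simp add: y1_def)
  qed
  \<comment> \<open>\<open>Z\<close> is \<open>x * y' - y * x'\<close>, the density of twice the
    area swept from the origin. Its integral against \<open>e\<close> is the change of area caused
    by a change \<open>e\<close> of the speed.\<close>
  define Z where "Z = (\<lambda>u. x u * sin (\<theta> u) - y u * cos (\<theta> u))"
  have Zc: "continuous_on {0..T} Z" unfolding Z_def by (intro continuous_intros a)
  have y1c: "continuous_on {0..T} y1" unfolding y1_def
    by (intro indefinite_integral_continuous_1 integrable_continuous_real continuous_intros \<eta>c \<phi>c a)
  have area1: "integral {0..T} (\<lambda>u. y1 u * cos (\<theta> u) + y u * (\<eta> u * cos (\<theta> u) - \<phi> u * sin (\<theta> u)))
      = integral {0..T} (\<lambda>u. w u * R u) - a1 * integral {0..T} (\<lambda>u. e1 u * Z u) - b1 * integral {0..T} (\<lambda>u. e2 u * Z u)"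
  proof -
    have c1: "continuous_on {0..T} (\<lambda>u. y1 u * cos (\<theta> u))"
      and c2: "continuous_on {0..T} (\<lambda>u. y u * (\<eta> u * cos (\<theta> u) - \<phi> u * sin (\<theta> u)))"
      and c3: "continuous_on {0..T} (\<lambda>u. (\<eta> u * sin (\<theta> u) + \<phi> u * cos (\<theta> u)) * x u)"
      and c4: "continuous_on {0..T} (\<lambda>u. \<phi> u * (x u * cos (\<theta> u) + y u * sin (\<theta> u)))"
      and c5: "continuous_on {0..T} (\<lambda>u. e1 u * Z u)" and c6: "continuous_on {0..T} (\<lambda>u. e2 u * Z u)"
      by (intro continuous_intros y1c \<eta>c \<phi>c a e Zc)+
    have h1: "((\<lambda>u. \<phi> u * (x u * cos (\<theta> u) + y u * sin (\<theta> u)) + a1 * (e1 u * Z u) + b1 * (e2 u * Z u)) has_integral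
        integral {0..T} (\<lambda>u. \<phi> u * (x u * cos (\<theta> u) + y u * sin (\<theta> u)))
        + a1 * integral {0..T} (\<lambda>u. e1 u * Z u) + b1 * integral {0..T} (\<lambda>u. e2 u * Z u)) {0..T}"
      by (intro has_integral_add has_integral_mult_right hi c4 c5 c6)
    have h2: "((\<lambda>u. (\<eta> u * sin (\<theta> u) + \<phi> u * cos (\<theta> u)) * x u - y u * (\<eta> u * cos (\<theta> u) - \<phi> u * sin (\<theta> u))) has_integral
        integral {0..T} (\<lambda>u. (\<eta> u * sin (\<theta> u) + \<phi> u * cos (\<theta> u)) * x u)
        - integral {0..T} (\<lambda>u. y u * (\<eta> u * cos (\<theta> u) - \<phi> u * sin (\<theta> u)))) {0..T}"
      by (intro has_integral_diff hi c2 c3)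
    have h3: "(\<lambda>u. (\<eta> u * sin (\<theta> u) + \<phi> u * cos (\<theta> u)) * x u - y u * (\<eta> u * cos (\<theta> u) - \<phi> u * sin (\<theta> u)))
        = (\<lambda>u. \<phi> u * (x u * cos (\<theta> u) + y u * sin (\<theta> u)) + a1 * (e1 u * Z u) + b1 * (e2 u * Z u))"
      by (rule ext) (simp add: \<eta>_def Z_def algebra_simps)
    have eq: "integral {0..T} (\<lambda>u. (\<eta> u * sin (\<theta> u) + \<phi> u * cos (\<theta> u)) * x u)
        - integral {0..T} (\<lambda>u. y u * (\<eta> u * cos (\<theta> u) - \<phi> u * sin (\<theta> u)))
        = integral {0..T} (\<lambda>u. \<phi> u * (x u * cos (\<theta> u) + y u * sin (\<theta> u)))
        + a1 * integral {0..T} (\<lambda>u. e1 u * Z u) + b1 * integral {0..T} (\<lambda>u. e2 u * Z u)"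
      by (rule has_integral_unique[OF h2[unfolded h3] h1])
    have "integral {0..T} (\<lambda>u. y1 u * cos (\<theta> u) + y u * (\<eta> u * cos (\<theta> u) - \<phi> u * sin (\<theta> u)))
        = integral {0..T} (\<lambda>u. y1 u * cos (\<theta> u)) + integral {0..T} (\<lambda>u. y u * (\<eta> u * cos (\<theta> u) - \<phi> u * sin (\<theta> u)))"
      by (rule integral_unique, intro has_integral_add hi c1 c2)
    then show ?thesis using eq p3 p4 by linarith
  qed
  have k\<eta>: "integral {0..T} (\<lambda>u. (k u)\<^sup>2 * \<eta> u)
      = a1 * integral {0..T} (\<lambda>u. (k u)\<^sup>2 * e1 u) + b1 * integral {0..T} (\<lambda>u. (k u)\<^sup>2 * e2 u)"
  proof (rule integral_unique)
    have "((\<lambda>u. a1 * ((k u)\<^sup>2 * e1 u) + b1 * ((k u)\<^sup>2 * e2 u)) has_integral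
        a1 * integral {0..T} (\<lambda>u. (k u)\<^sup>2 * e1 u) + b1 * integral {0..T} (\<lambda>u. (k u)\<^sup>2 * e2 u)) {0..T}"
      by (intro has_integral_add has_integral_mult_right wf k(3) e)
    then show "((\<lambda>u. (k u)\<^sup>2 * \<eta> u) has_integral
        a1 * integral {0..T} (\<lambda>u. (k u)\<^sup>2 * e1 u) + b1 * integral {0..T} (\<lambda>u. (k u)\<^sup>2 * e2 u)) {0..T}"
      by (simp add: \<eta>_def algebra_simps)
  qed
  have Q: "Q e = \<mu> * integral {0..T} (\<lambda>u. e u * Z u) - 1 / 2 * integral {0..T} (\<lambda>u. (k u)\<^sup>2 * e u)" for e
    by (simp add: Q_def Z_def)
  have "integral {0..T} (\<lambda>u. w u * (k u - \<mu> / 2 * ((x u)\<^sup>2 + (y u)\<^sup>2) - Q e1 * y u + Q e2 * x u))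
      = integral {0..T} (\<lambda>u. k u * w u) - \<mu> * integral {0..T} (\<lambda>u. w u * R u)
        - Q e1 * integral {0..T} (\<lambda>u. w u * y u) + Q e2 * integral {0..T} (\<lambda>u. w u * x u)"
  proof (rule integral_unique)
    have "((\<lambda>u. k u * w u - \<mu> * (w u * R u) - Q e1 * (w u * y u) + Q e2 * (w u * x u)) has_integral
        integral {0..T} (\<lambda>u. k u * w u) - \<mu> * integral {0..T} (\<lambda>u. w u * R u)
        - Q e1 * integral {0..T} (\<lambda>u. w u * y u) + Q e2 * integral {0..T} (\<lambda>u. w u * x u)) {0..T}"
      by (intro has_integral_add has_integral_diff has_integral_mult_right wf w Rc a
          integrable_integral set_borel_integral_eq_integral(1) kw)
    moreover have "(\<lambda>u. k u * w u - \<mu> * (w u * R u) - Q e1 * (w u * y u) + Q e2 * (w u * x u))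
        = (\<lambda>u. w u * (k u - \<mu> / 2 * ((x u)\<^sup>2 + (y u)\<^sup>2) - Q e1 * y u + Q e2 * x u))"
      by (rule ext) (simp add: R_def algebra_simps)
    ultimately show "((\<lambda>u. w u * (k u - \<mu> / 2 * ((x u)\<^sup>2 + (y u)\<^sup>2) - Q e1 * y u + Q e2 * x u)) has_integral
        integral {0..T} (\<lambda>u. k u * w u) - \<mu> * integral {0..T} (\<lambda>u. w u * R u)
        - Q e1 * integral {0..T} (\<lambda>u. w u * y u) + Q e2 * integral {0..T} (\<lambda>u. w u * x u)) {0..T}" by simp
  qed
  also have "\<dots> = integral {0..T} (\<lambda>u. k u * w u) - \<mu> * integral {0..T} (\<lambda>u. w u * R u) + Q e1 * a1 + Q e2 * b1"
    by (simp add: a1 b1)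
  also have "\<dots> = - (1 / 2) * integral {0..T} (\<lambda>u. (k u)\<^sup>2 * \<eta> u) + integral {0..T} (\<lambda>u. k u * w u)
        - \<mu> * integral {0..T} (\<lambda>u. y1 u * cos (\<theta> u) + y u * (\<eta> u * cos (\<theta> u) - \<phi> u * sin (\<theta> u)))"
    unfolding area1 k\<eta> Q by (simp add: algebra_simps)
  finally show ?thesis using nn by (simp add: w_def)
qed

section \<open>Mean-zero functions dual to the two closing conditions\<close>

lemma convex_arc_cos_sin_independent:
  assumes arc: "convex_arc T \<theta> x y"
    and z: "integral {0..T} (\<lambda>u. (a * cos (\<theta> u) + b * sin (\<theta> u))\<^sup>2) = 0"
  shows "a = 0" "b = 0"
proof -
  note d = convex_arcD[OF arc]
  have "continuous_on {0..T} (\<lambda>u. (a * cos (\<theta> u) + b * sin (\<theta> u))\<^sup>2)"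
    by (intro continuous_intros d)
  then have "\<forall>u\<in>{0..T}. (a * cos (\<theta> u) + b * sin (\<theta> u))\<^sup>2 = 0"
    using integral_eq_0_iff[of 0 T "\<lambda>u. (a * cos (\<theta> u) + b * sin (\<theta> u))\<^sup>2"] d(1) z by simp
  then have 0: "a * cos (\<theta> u) + b * sin (\<theta> u) = 0" if "u \<in> {0..T}" for u using that by simp
  \<comment> \<open>The combination vanishes everywhere by continuity, and the arc attains the
    directions \<open>0\<close> and \<open>pi/2\<close>, each of which isolates one
    coefficient.\<close>
  obtain u where "u \<in> {0..T}" "cos (\<theta> u) = cos 0" "sin (\<theta> u) = sin 0"
    by (rule convex_arc_attains_direction[OF arc])
  then show "a = 0" using 0[of u] by simp
  obtain v where "v \<in> {0..T}" "cos (\<theta> v) = cos (pi/2)" "sin (\<theta> v) = sin (pi/2)"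
    by (rule convex_arc_attains_direction[OF arc])
  then show "b = 0" using 0[of v] by simp
qed

text \<open>The dual pair is the inverse Gram matrix of \<open>cos \<theta>\<close> and
  \<open>sin \<theta>\<close> applied to these two functions. Mean zero comes for free, since
  closedness of the arc says that both of them have integral zero.\<close>

lemma convex_arc_dual_functions:
  assumes arc: "convex_arc T \<theta> x y"
  obtains e1 e2 where "continuous_on {0..T} e1" "continuous_on {0..T} e2"
      "integral {0..T} e1 = 0" "integral {0..T} e2 = 0"
      "integral {0..T} (\<lambda>u. e1 u * cos (\<theta> u)) = 1" "integral {0..T} (\<lambda>u. e1 u * sin (\<theta> u)) = 0"
      "integral {0..T} (\<lambda>u. e2 u * cos (\<theta> u)) = 0" "integral {0..T} (\<lambda>u. e2 u * sin (\<theta> u)) = 1"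
proof -
  note d = convex_arcD[OF arc]
  have T: "T \<in> {0..T}" using d(1) by simp
  define A where "A = integral {0..T} (\<lambda>u. cos (\<theta> u) * cos (\<theta> u))"
  define B where "B = integral {0..T} (\<lambda>u. cos (\<theta> u) * sin (\<theta> u))"
  define C where "C = integral {0..T} (\<lambda>u. sin (\<theta> u) * sin (\<theta> u))"
  have cont: "continuous_on {0..T} (\<lambda>u. cos (\<theta> u))" "continuous_on {0..T} (\<lambda>u. sin (\<theta> u))"
    by (intro continuous_intros d)+
  have hi: "(f has_integral integral {0..T} f) {0..T}" if "continuous_on {0..T} f" for f :: "real \<Rightarrow> real"
    using integrable_integral[OF integrable_continuous_real[OF that]] .
  have hA: "((\<lambda>u. cos (\<theta> u) * cos (\<theta> u)) has_integral A) {0..T}"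
    and hB: "((\<lambda>u. cos (\<theta> u) * sin (\<theta> u)) has_integral B) {0..T}"
    and hC: "((\<lambda>u. sin (\<theta> u) * sin (\<theta> u)) has_integral C) {0..T}"
    unfolding A_def B_def C_def by (intro hi continuous_intros cont)+
  have h0: "((\<lambda>u. cos (\<theta> u)) has_integral 0) {0..T}" "((\<lambda>u. sin (\<theta> u)) has_integral 0) {0..T}"
    using hi[OF cont(1)] hi[OF cont(2)] convex_arc_curve(1,2)[OF arc T] d(5,6)
      LBINT_eq_integral_continuous[OF cont(1) T] LBINT_eq_integral_continuous[OF cont(2) T] by auto
  have quad: "integral {0..T} (\<lambda>u. (a * cos (\<theta> u) + b * sin (\<theta> u))\<^sup>2) = a\<^sup>2 * A + 2 * a * b * B + b\<^sup>2 * C" for a b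
  proof (rule integral_unique)
    have "((\<lambda>u. a\<^sup>2 * (cos (\<theta> u) * cos (\<theta> u)) + 2 * a * b * (cos (\<theta> u) * sin (\<theta> u)) + b\<^sup>2 * (sin (\<theta> u) * sin (\<theta> u)))
        has_integral a\<^sup>2 * A + 2 * a * b * B + b\<^sup>2 * C) {0..T}"
      by (intro has_integral_add has_integral_mult_right hA hB hC)
    moreover have "(\<lambda>u. a\<^sup>2 * (cos (\<theta> u) * cos (\<theta> u)) + 2 * a * b * (cos (\<theta> u) * sin (\<theta> u)) + b\<^sup>2 * (sin (\<theta> u) * sin (\<theta> u)))
        = (\<lambda>u. (a * cos (\<theta> u) + b * sin (\<theta> u))\<^sup>2)"
      by (rule ext) (simp add: power2_eq_square algebra_simps)
    ultimately show "((\<lambda>u. (a * cos (\<theta> u) + b * sin (\<theta> u))\<^sup>2) has_integral a\<^sup>2 * A + 2 * a * b * B + b\<^sup>2 * C) {0..T}"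
      by simp
  qed
  have C0: "C \<noteq> 0" using convex_arc_cos_sin_independent(2)[OF arc, of 0 1] quad[of 0 1] by auto
  define D where "D = A * C - B * B"
  have D0: "D \<noteq> 0"
  proof
    assume D: "D = 0"
    have "C\<^sup>2 * A + 2 * C * (- B) * B + (- B)\<^sup>2 * C = C * D"
      by (simp add: D_def power2_eq_square algebra_simps)
    \<comment> \<open>The vector \<open>(C, - B)\<close> is the test: the quadratic form of the Gram
      matrix takes the value \<open>C * D\<close> on it, so a vanishing determinant would force
      \<open>C = 0\<close>.\<close>
    then have "C = 0" using convex_arc_cos_sin_independent(1)[OF arc, of C "- B"] quad[of C "- B"] D by simp
    then show False using C0 by simp
  qed
  define e1 where "e1 = (\<lambda>u. C / D * cos (\<theta> u) + - B / D * sin (\<theta> u))"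
  define e2 where "e2 = (\<lambda>u. - B / D * cos (\<theta> u) + A / D * sin (\<theta> u))"
  have lin: "((\<lambda>u. (a * cos (\<theta> u) + b * sin (\<theta> u))) has_integral 0) {0..T}"
    "((\<lambda>u. (a * cos (\<theta> u) + b * sin (\<theta> u)) * cos (\<theta> u)) has_integral a * A + b * B) {0..T}"
    "((\<lambda>u. (a * cos (\<theta> u) + b * sin (\<theta> u)) * sin (\<theta> u)) has_integral a * B + b * C) {0..T}" for a b
  proof -
    show "((\<lambda>u. (a * cos (\<theta> u) + b * sin (\<theta> u))) has_integral 0) {0..T}"
      using has_integral_add[OF has_integral_mult_right[OF h0(1), of a] has_integral_mult_right[OF h0(2), of b]] by simp
    show "((\<lambda>u. (a * cos (\<theta> u) + b * sin (\<theta> u)) * cos (\<theta> u)) has_integral a * A + b * B) {0..T}"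
      using has_integral_add[OF has_integral_mult_right[OF hA, of a] has_integral_mult_right[OF hB, of b]]
      by (simp add: algebra_simps)
    show "((\<lambda>u. (a * cos (\<theta> u) + b * sin (\<theta> u)) * sin (\<theta> u)) has_integral a * B + b * C) {0..T}"
      using has_integral_add[OF has_integral_mult_right[OF hB, of a] has_integral_mult_right[OF hC, of b]]
      by (simp add: algebra_simps)
  qed
  have alg: "C / D * A + - B / D * B = 1" "C / D * B + - B / D * C = 0"
    "- B / D * A + A / D * B = 0" "- B / D * B + A / D * C = 1"
    using D0 by (simp_all add: D_def divide_simps)
  show thesis
  proof (rule that[of e1 e2])
    show "continuous_on {0..T} e1" "continuous_on {0..T} e2"
      unfolding e1_def e2_def by (intro continuous_intros d)+
    show "integral {0..T} e1 = 0" "integral {0..T} e2 = 0"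
      unfolding e1_def e2_def by (rule integral_unique, rule lin)+
    show "integral {0..T} (\<lambda>u. e1 u * cos (\<theta> u)) = 1" "integral {0..T} (\<lambda>u. e1 u * sin (\<theta> u)) = 0"
      "integral {0..T} (\<lambda>u. e2 u * cos (\<theta> u)) = 0" "integral {0..T} (\<lambda>u. e2 u * sin (\<theta> u)) = 1"
      unfolding e1_def e2_def by (subst integral_unique[OF lin(2)] integral_unique[OF lin(3)], rule alg)+
  qed
qed

section \<open>From the variational inequality to a pointwise formula\<close>

lemma AE_lborel_imp_negligible:
  fixes P :: "real \<Rightarrow> bool"
  assumes "AE s in lborel. P s"
  shows "negligible {s. \<not> P s}"
proof -
  obtain N where N: "{s \<in> space lborel. \<not> P s} \<subseteq> N" "emeasure lborel N = 0" "N \<in> sets lborel"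
    using AE_E[OF assms] by blast
  then have "N \<in> null_sets lebesgue" by (intro null_sets_completionI) auto
  then have "negligible N" by (simp add: negligible_iff_null_sets)
  then show ?thesis by (rule negligible_subset) (use N(1) in auto)
qed

lemma set_integral_zero_imp_AE_zero:
  fixes f :: "real \<Rightarrow> real"
  assumes f: "set_integrable lborel S f" and nn: "AE s in lborel. s \<in> S \<longrightarrow> 0 \<le> f s"
    and z: "integral S f \<le> 0"
  shows "AE s in lborel. s \<in> S \<longrightarrow> f s = 0"
proof -
  let ?f = "\<lambda>s. indicator S s *\<^sub>R f s"
  have fi: "integrable lborel ?f" using f by (simp add: set_integrable_def)
  have nn': "AE s in lborel. 0 \<le> ?f s" using nn by eventually_elim (auto simp: indicator_def)
  have "integral\<^sup>L lborel ?f = integral S f"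
    using set_borel_integral_eq_integral(2)[OF f] by (simp add: set_lebesgue_integral_def)
  then have "integral\<^sup>L lborel ?f = 0" using z integral_nonneg_AE[OF nn'] by simp
  then have "AE s in lborel. ?f s = 0" using integral_nonneg_eq_0_iff_AE[OF fi nn'] by simp
  then show ?thesis by eventually_elim (auto simp: indicator_def split: if_splits)
qed

text \<open>Testing with the normalised indicator of the set where \<open>k - g + c < 0\<close> shows that this
  set is null; the choice of \<open>c\<close> makes \<open>k * (k - g + c)\<close> integrate to zero.\<close>

lemma complementarity_of_variational_inequality:
  fixes k g :: "real \<Rightarrow> real"
  assumes T: "0 < T" and m: "0 < m"
    and k: "\<And>u. 0 \<le> k u" "set_integrable lborel {0..T} k" "set_integrable lborel {0..T} (\<lambda>u. (k u)\<^sup>2)"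
      "integral {0..T} k = m"
    and g: "continuous_on {0..T} g"
    and vi: "\<And>\<psi>. (\<And>u. 0 \<le> \<psi> u) \<Longrightarrow> set_integrable lborel {0..T} \<psi> \<Longrightarrow>
      set_integrable lborel {0..T} (\<lambda>u. (\<psi> u)\<^sup>2) \<Longrightarrow> set_integrable lborel {0..T} (\<lambda>u. k u * \<psi> u) \<Longrightarrow>
      integral {0..T} \<psi> = m \<Longrightarrow> 0 \<le> integral {0..T} (\<lambda>u. (\<psi> u - k u) * (k u - g u))"
  obtains c where "AE u in lborel. u \<in> {0..T} \<longrightarrow> k u = max (g u - c) 0"
proof -
  note hkint = set_borel_integral_eq_integral(1)
  have gk: "set_integrable lborel {0..T} (\<lambda>u. k u * g u)" by (rule set_integrable_mult_continuous[OF k(2) g])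
  have kkg: "set_integrable lborel {0..T} (\<lambda>u. (k u)\<^sup>2 - k u * g u)" using k(3) gk by (rule set_integral_diff(1))
  define c where "c = - integral {0..T} (\<lambda>u. (k u)\<^sup>2 - k u * g u) / m"
  define v where "v = (\<lambda>u. k u - g u + c)"
  have gi: "set_integrable lborel {0..T} g" by (rule borel_integrable_atLeastAtMost'[OF g])
  have ci: "set_integrable lborel {0..T} (\<lambda>_. c)" by (rule borel_integrable_atLeastAtMost') simp
  have vi': "set_integrable lborel {0..T} v" unfolding v_def
    by (intro set_integral_add(1) set_integral_diff(1) k(2) gi ci)
  have vm: "(\<lambda>u. indicator {0..T} u *\<^sub>R v u) \<in> borel_measurable borel"
    using vi' by (simp add: set_integrable_def)
  \<comment> \<open>Measurability of \<open>v\<close> is known only on the interval, so the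
    indicator is part of the definition.\<close>
  define B where "B = {u. indicator {0..T} u *\<^sub>R v u < 0}"
  have B: "B \<in> sets borel" unfolding B_def using vm by measurable
  have BT: "B \<subseteq> {0..T}" "\<And>u. u \<in> B \<Longrightarrow> v u < 0" "\<And>u. u \<in> {0..T} \<Longrightarrow> u \<notin> B \<Longrightarrow> 0 \<le> v u"
  proof -
    show sub: "B \<subseteq> {0..T}" by (auto simp: B_def indicator_def split: if_splits)
    show "v u < 0" if "u \<in> B" for u using that subsetD[OF sub that] by (simp add: B_def)
    show "0 \<le> v u" if "u \<in> {0..T}" "u \<notin> B" for u using that by (simp add: B_def)
  qed
  have mB: "set_integrable lborel {0..T} (\<lambda>u. f u * indicator B u)" if "set_integrable lborel {0..T} f" for f :: "real \<Rightarrow> real"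
  proof -
    have "integrable lborel (\<lambda>u. indicator B u *\<^sub>R (indicator {0..T} u *\<^sub>R f u))"
      by (rule integrable_mult_indicator) (use B that in \<open>auto simp: set_integrable_def\<close>)
    then show ?thesis unfolding set_integrable_def by (simp add: mult_ac)
  qed
  have vnn: "AE u in lborel. u \<in> {0..T} \<longrightarrow> 0 \<le> v u"
  proof -
    have oneB: "set_integrable lborel {0..T} (indicator B :: real \<Rightarrow> real)"
      using mB[of "\<lambda>_. 1"] borel_integrable_atLeastAtMost'[of 0 T "\<lambda>_. 1::real"] by simp
    define \<beta> where "\<beta> = integral {0..T} (indicator B :: real \<Rightarrow> real)"
    have \<beta>0: "0 \<le> \<beta>" unfolding \<beta>_def by (rule integral_nonneg) (use hkint[OF oneB] in auto)
    show ?thesis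
    proof (cases "\<beta> = 0")
      case True
      then have "AE u in lborel. u \<in> {0..T} \<longrightarrow> indicator B u = (0::real)"
        by (intro set_integral_zero_imp_AE_zero[OF oneB]) (auto simp: \<beta>_def)
      then show ?thesis by eventually_elim (use BT in \<open>auto simp: indicator_def\<close>)
    next
      case False
      define \<psi> where "\<psi> = (\<lambda>u. m / \<beta> * indicator B u :: real)"
      have \<psi>i: "set_integrable lborel {0..T} \<psi>" unfolding \<psi>_def by (intro set_integrable_mult_right oneB)
      have \<psi>2: "set_integrable lborel {0..T} (\<lambda>u. (\<psi> u)\<^sup>2)"
      proof -
        have "(\<lambda>u. (\<psi> u)\<^sup>2) = (\<lambda>u. (m / \<beta>)\<^sup>2 * indicator B u)"
          by (rule ext) (auto simp: \<psi>_def indicator_def)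
        then show ?thesis using oneB by simp
      qed
      have f\<psi>: "set_integrable lborel {0..T} (\<lambda>u. f u * \<psi> u)" if "set_integrable lborel {0..T} f" for f
      proof -
        have "(\<lambda>u. f u * \<psi> u) = (\<lambda>u. m / \<beta> * (f u * indicator B u))"
          by (rule ext) (auto simp: \<psi>_def)
        then show ?thesis using mB[OF that] by simp
      qed
      have \<psi>m: "integral {0..T} \<psi> = m" unfolding \<psi>_def using False by (simp add: \<beta>_def)
      have \<psi>0: "0 \<le> \<psi> u" for u unfolding \<psi>_def using m \<beta>0 by simp
      have nn: "0 \<le> integral {0..T} (\<lambda>u. (\<psi> u - k u) * (k u - g u))"
        by (rule vi) (use \<psi>i \<psi>2 f\<psi>[OF k(2)] \<psi>m \<psi>0 in auto)
      \<comment> \<open>By the choice of \<open>c\<close>, the part with \<open>k\<close> integrates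
        to \<open>c * m\<close>, which cancels the constant added to \<open>k - g\<close> because
        \<open>\<psi>\<close> has mass \<open>m\<close>. Only the integral of
        \<open>v * \<psi>\<close> survives.\<close>
      have "integral {0..T} (\<lambda>u. (\<psi> u - k u) * (k u - g u)) = integral {0..T} (\<lambda>u. v u * \<psi> u)"
      proof (rule integral_unique)
        have "((\<lambda>u. v u * \<psi> u - c * \<psi> u - ((k u)\<^sup>2 - k u * g u)) has_integral
            integral {0..T} (\<lambda>u. v u * \<psi> u) - c * m - (- c * m)) {0..T}"
        proof (intro has_integral_diff)
          show "((\<lambda>u. v u * \<psi> u) has_integral integral {0..T} (\<lambda>u. v u * \<psi> u)) {0..T}"
            using integrable_integral[OF hkint[OF f\<psi>[OF vi']]] .
          show "((\<lambda>u. c * \<psi> u) has_integral c * m) {0..T}"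
            using has_integral_mult_right[OF integrable_integral[OF hkint[OF \<psi>i]], of c] \<psi>m by simp
          show "((\<lambda>u. (k u)\<^sup>2 - k u * g u) has_integral - c * m) {0..T}"
            using integrable_integral[OF hkint[OF kkg]] m by (simp add: c_def)
        qed
        moreover have "(\<lambda>u. v u * \<psi> u - c * \<psi> u - ((k u)\<^sup>2 - k u * g u)) = (\<lambda>u. (\<psi> u - k u) * (k u - g u))"
          by (rule ext) (simp add: v_def power2_eq_square algebra_simps)
        ultimately show "((\<lambda>u. (\<psi> u - k u) * (k u - g u)) has_integral integral {0..T} (\<lambda>u. v u * \<psi> u)) {0..T}"
          by simp
      qed
      then have "0 \<le> integral {0..T} (\<lambda>u. v u * \<psi> u)" using nn by simp
      then have le: "integral {0..T} (\<lambda>u. - v u * \<psi> u) \<le> 0" by simp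
      have neg: "set_integrable lborel {0..T} (\<lambda>u. - v u * \<psi> u)"
        using set_integrable_mult_right[OF f\<psi>[OF vi'], of "-1"] by simp
      have "AE u in lborel. u \<in> {0..T} \<longrightarrow> - v u * \<psi> u = 0"
      proof (rule set_integral_zero_imp_AE_zero[OF neg _ le], rule AE_I2, rule impI)
        fix u show "0 \<le> - v u * \<psi> u"
        proof (cases "u \<in> B")
          case True
          then show ?thesis using mult_nonneg_nonneg[of "- v u" "\<psi> u"] BT(2)[of u] \<psi>0[of u] by simp
        qed (simp add: \<psi>_def)
      qed
      then show ?thesis
      proof eventually_elim
        case (elim u)
        show ?case
        proof
          assume u: "u \<in> {0..T}"
          have "u \<notin> B" using elim u BT(2)[of u] m False by (auto simp: \<psi>_def)
          then show "0 \<le> v u" using BT(3) u by blast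
        qed
      qed
    qed
  qed
  have kv: "set_integrable lborel {0..T} (\<lambda>u. k u * v u)"
  proof -
    have "set_integrable lborel {0..T} (\<lambda>u. (k u)\<^sup>2 - k u * g u + c * k u)"
      by (intro set_integral_add(1) kkg set_integrable_mult_right k(2))
    moreover have "(\<lambda>u. (k u)\<^sup>2 - k u * g u + c * k u) = (\<lambda>u. k u * v u)"
      by (rule ext) (simp add: v_def power2_eq_square algebra_simps)
    ultimately show ?thesis by simp
  qed
  have "integral {0..T} (\<lambda>u. k u * v u) = 0"
  proof (rule integral_unique)
    have "((\<lambda>u. (k u)\<^sup>2 - k u * g u + c * k u) has_integral - c * m + c * m) {0..T}"
    proof (rule has_integral_add)
      show "((\<lambda>u. (k u)\<^sup>2 - k u * g u) has_integral - c * m) {0..T}"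
        using integrable_integral[OF hkint[OF kkg]] m by (simp add: c_def)
      show "((\<lambda>u. c * k u) has_integral c * m) {0..T}"
        using has_integral_mult_right[OF integrable_integral[OF hkint[OF k(2)]], of c] k(4) by simp
    qed
    moreover have "(\<lambda>u. (k u)\<^sup>2 - k u * g u + c * k u) = (\<lambda>u. k u * v u)"
      by (rule ext) (simp add: v_def power2_eq_square algebra_simps)
    ultimately show "((\<lambda>u. k u * v u) has_integral 0) {0..T}" by simp
  qed
  moreover have "AE u in lborel. u \<in> {0..T} \<longrightarrow> 0 \<le> k u * v u"
    using vnn by eventually_elim (use k(1) in auto)
  ultimately have "AE u in lborel. u \<in> {0..T} \<longrightarrow> k u * v u = 0"
    by (intro set_integral_zero_imp_AE_zero[OF kv]) auto
  \<comment> \<open>Where \<open>k\<close> vanishes, \<open>v\<close> nonnegative says that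
    \<open>g - c\<close> is at most 0. Where \<open>k\<close> is positive, \<open>v\<close> vanishes
    and \<open>k = g - c\<close>.\<close>
  with vnn have "AE u in lborel. u \<in> {0..T} \<longrightarrow> k u = max (g u - c) 0"
  proof eventually_elim
    case (elim u)
    then show ?case using k(1)[of u] by (cases "k u = 0") (auto simp: v_def max_def)
  qed
  then show thesis by (rule that)
qed

section \<open>Curvature of an optimal domain\<close>

lemma set_integrable_positive_part:
  fixes k :: "real \<Rightarrow> real"
  assumes k: "set_integrable lborel S k" and k2: "set_integrable lborel S (\<lambda>s. (k s)\<^sup>2)"
  shows "set_integrable lborel S (\<lambda>s. max (k s) 0)" "set_integrable lborel S (\<lambda>s. (max (k s) 0)\<^sup>2)"
proof -
  have "set_integrable lborel S (\<lambda>s. 1 / 2 * (k s + \<bar>k s\<bar>))"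
    by (intro set_integrable_mult_right set_integral_add(1) set_integrable_abs k)
  moreover have "(\<lambda>s. 1 / 2 * (k s + \<bar>k s\<bar>)) = (\<lambda>s. max (k s) 0)" by (rule ext) auto
  ultimately show 1: "set_integrable lborel S (\<lambda>s. max (k s) 0)" by (simp only:)
  have "(\<lambda>s. (indicator S s *\<^sub>R max (k s) 0)\<^sup>2) \<in> borel_measurable lborel"
    using 1 by (intro borel_measurable_power) (auto simp: set_integrable_def)
  moreover have "(\<lambda>s. (indicator S s *\<^sub>R max (k s) 0)\<^sup>2) = (\<lambda>s. indicator S s *\<^sub>R (max (k s) 0)\<^sup>2)"
    by (rule ext) (auto simp: indicator_def)
  ultimately have m: "(\<lambda>s. indicator S s *\<^sub>R (max (k s) 0)\<^sup>2) \<in> borel_measurable lborel" by simp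
  have k2': "integrable lborel (\<lambda>s. indicator S s *\<^sub>R (k s)\<^sup>2)" using k2 by (simp add: set_integrable_def)
  show "set_integrable lborel S (\<lambda>s. (max (k s) 0)\<^sup>2)"
    unfolding set_integrable_def
    by (rule Bochner_Integration.integrable_bound[OF k2' m])
      (rule AE_I2, auto simp: indicator_def max_def)
qed

theorem mainTheorem2:
  fixes \<mu> :: real and \<Omega> :: "(real \<times> real) set" and \<theta> k :: "real \<Rightarrow> real"
  assumes "\<mu> > 0"
    and "optimal_domain \<mu> \<Omega> \<theta> k"
    and "frontier \<Omega> = curve \<theta> (0, 0) ` {0..2 * pi}"
  shows "W2inf \<theta> 0 (2 * pi) \<and>
    (\<exists>l1 l2 c. \<forall>s\<in>{0..2 * pi}.
       (\<theta> has_real_derivative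
          (\<mu> / 2) * neg_part ((l1\<^sup>2 + l2\<^sup>2) / \<mu>\<^sup>2 + 2 * c / \<mu>
             - (fst (curve \<theta> (0, 0) s) - l2 / \<mu>)\<^sup>2
             - (snd (curve \<theta> (0, 0) s) + l1 / \<mu>)\<^sup>2))
        (at s within {0..2 * pi}))"
proof -
  define T where "T = 2 * pi"
  have T: "0 < T" "T \<in> {0..T}" by (auto simp: T_def)
  from assms(2) have adm: "admissible \<Omega> T \<theta> k"
    and opt: "\<And>\<Omega>' \<theta>' k'. admissible \<Omega>' T \<theta>' k' \<Longrightarrow> J \<mu> \<Omega> T k \<le> J \<mu> \<Omega>' T k'"
    unfolding optimal_domain_def T_def by blast+
  from adm have dom: "open \<Omega>" "bounded \<Omega>" "convex \<Omega>"
    and k: "set_integrable lborel {0..T} k" "set_integrable lborel {0..T} (\<lambda>s. (k s)\<^sup>2)"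
    and \<theta>L: "\<And>s. s \<in> {0..T} \<Longrightarrow> \<theta> s = \<theta> 0 + (LBINT t=0..s. k t)"
    and kae: "AE s in lborel. s \<in> {0..T} \<longrightarrow> k s \<ge> 0"
    and \<theta>T: "\<theta> T = \<theta> 0 + 2 * pi"
    and closed: "(LBINT s=0..T. cos (\<theta> s)) = 0" "(LBINT s=0..T. sin (\<theta> s)) = 0"
    unfolding admissible_def W12_with_deriv_def by blast+
  \<comment> \<open>Admissibility makes \<open>k\<close> nonnegative only almost everywhere. This
    representative is nonnegative everywhere and has the same primitive and the same energy.\<close>
  define k0 where "k0 = (\<lambda>s. max (k s) 0)"
  have k0: "\<And>u. 0 \<le> k0 u" "set_integrable lborel {0..T} k0" "set_integrable lborel {0..T} (\<lambda>u. (k0 u)\<^sup>2)"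
    using set_integrable_positive_part[OF k] by (auto simp: k0_def)
  have neg: "negligible {s. \<not> (s \<in> {0..T} \<longrightarrow> k s \<ge> 0)}" by (rule AE_lborel_imp_negligible[OF kae])
  have \<theta>i: "\<theta> s = \<theta> 0 + integral {0..s} k0" if s: "s \<in> {0..T}" for s
  proof -
    have "integral {0..s} k = integral {0..s} k0"
      by (rule integral_spike[OF neg]) (use s in \<open>auto simp: k0_def\<close>)
    then show ?thesis using \<theta>L[OF s] LBINT_eq_integral_subinterval[OF k(1) s] by simp
  qed
  have k2: "integral {0..T} (\<lambda>s. (k s)\<^sup>2) = integral {0..T} (\<lambda>s. (k0 s)\<^sup>2)"
    by (rule integral_spike[OF neg]) (auto simp: k0_def)
  have k0i: "k0 integrable_on {0..T}" by (rule set_borel_integral_eq_integral(1)[OF k0(2)])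
  have \<theta>c: "continuous_on {0..T} \<theta>"
  proof -
    have "continuous_on {0..T} (\<lambda>u. \<theta> 0 + integral {0..u} k0)"
      by (intro continuous_intros indefinite_integral_continuous_1 k0i)
    then show ?thesis by (rule continuous_on_eq) (rule \<theta>i[symmetric])
  qed
  have \<theta>m: "mono_on {0..T} \<theta>"
  proof (rule mono_onI)
    fix r s assume rs: "r \<in> {0..T}" "s \<in> {0..T}" "r \<le> s"
    have "integral {0..r} k0 \<le> integral {0..s} k0"
      by (rule integral_subset_le) (use rs k0(1) integrable_on_subinterval[OF k0i] in auto)
    then show "\<theta> r \<le> \<theta> s" using \<theta>i[OF rs(1)] \<theta>i[OF rs(2)] by simp
  qed
  define x where "x = (\<lambda>s::real. LBINT t=0..s. cos (\<theta> t))"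
  define y where "y = (\<lambda>s::real. LBINT t=0..s. sin (\<theta> t))"
  have cs: "continuous_on {0..T} (\<lambda>t. cos (\<theta> t))" "continuous_on {0..T} (\<lambda>t. sin (\<theta> t))"
    by (intro continuous_intros \<theta>c)+
  have x0: "x 0 = 0" and y0: "y 0 = 0" by (simp_all add: x_def y_def zero_ereal_def)
  have xd: "(x has_real_derivative cos (\<theta> s)) (at s within {0..T})"
    and yd: "(y has_real_derivative sin (\<theta> s)) (at s within {0..T})" if "s \<in> {0..T}" for s
    unfolding x_def y_def using LBINT_has_real_derivative[OF cs(1) that] LBINT_has_real_derivative[OF cs(2) that] by auto
  have xT: "x T = 0" "y T = 0" using closed by (simp_all add: x_def y_def)
  have arc: "convex_arc T \<theta> x y"
    unfolding convex_arc_def using T \<theta>c \<theta>m \<theta>T x0 y0 xT xd yd by auto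
  have curve: "curve \<theta> (0, 0) s = (x s, y s)" for s by (simp add: curve_def x_def y_def)
  have fr: "frontier \<Omega> = (\<lambda>s. (x s, y s)) ` {0..T}" using assms(3) by (simp add: curve T_def)
  \<comment> \<open>The area formula removes the set \<open>\<Omega>\<close> from the functional;
    from here on optimality is used only as an inequality for \<open>k0\<close> and the arc.\<close>
  have Jk: "J \<mu> \<Omega> T k = 1 / 2 * integral {0..T} (\<lambda>u. (k0 u)\<^sup>2) - \<mu> * integral {0..T} (\<lambda>u. y u * cos (\<theta> u))"
    unfolding J_def energy_def area_def convex_arc_area[OF arc dom fr] LBINT_eq_integral_subinterval[OF k(2) T(2)] k2
    by simp
  obtain e1 e2 where e: "continuous_on {0..T} e1" "continuous_on {0..T} e2"
      "integral {0..T} e1 = 0" "integral {0..T} e2 = 0"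
      "integral {0..T} (\<lambda>u. e1 u * cos (\<theta> u)) = 1" "integral {0..T} (\<lambda>u. e1 u * sin (\<theta> u)) = 0"
      "integral {0..T} (\<lambda>u. e2 u * cos (\<theta> u)) = 0" "integral {0..T} (\<lambda>u. e2 u * sin (\<theta> u)) = 1"
    by (rule convex_arc_dual_functions[OF arc])
  define Q where "Q = (\<lambda>e. \<mu> * integral {0..T} (\<lambda>u. e u * (x u * sin (\<theta> u) - y u * cos (\<theta> u)))
      - 1 / 2 * integral {0..T} (\<lambda>u. (k0 u)\<^sup>2 * e u))"
  define g where "g = (\<lambda>u. \<mu> / 2 * ((x u)\<^sup>2 + (y u)\<^sup>2) + Q e1 * y u - Q e2 * x u)"
  have gc: "continuous_on {0..T} g" unfolding g_def by (intro continuous_intros convex_arcD(9,10)[OF arc])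
  have k0T: "integral {0..T} k0 = 2 * pi" using \<theta>i[OF T(2)] \<theta>T by simp
  obtain c where c: "AE u in lborel. u \<in> {0..T} \<longrightarrow> k0 u = max (g u - c) 0"
  proof (rule complementarity_of_variational_inequality[OF T(1) _ k0 k0T gc])
    fix \<psi> :: "real \<Rightarrow> real"
    assume \<psi>: "\<And>u. 0 \<le> \<psi> u" "set_integrable lborel {0..T} \<psi>" "set_integrable lborel {0..T} (\<lambda>u. (\<psi> u)\<^sup>2)"
      "set_integrable lborel {0..T} (\<lambda>u. k0 u * \<psi> u)" "integral {0..T} \<psi> = 2 * pi"
    have min: "1 / 2 * integral {0..T} (\<lambda>u. (k0 u)\<^sup>2) - \<mu> * integral {0..T} (\<lambda>u. y u * cos (\<theta> u)) \<le> J \<mu> \<Omega>' T k'"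
      if "admissible \<Omega>' T \<theta>' k'" for \<Omega>' \<theta>' k'
      using opt[OF that] Jk by simp
    have "0 \<le> integral {0..T} (\<lambda>u. (\<psi> u - k0 u) * (k0 u - \<mu> / 2 * ((x u)\<^sup>2 + (y u)\<^sup>2) - Q e1 * y u + Q e2 * x u))"
      unfolding Q_def by (rule first_variation_nonneg[OF arc x0 y0 k0 \<theta>i \<psi> min e])
    then show "0 \<le> integral {0..T} (\<lambda>u. (\<psi> u - k0 u) * (k0 u - g u))"
      unfolding g_def by (simp add: algebra_simps)
  qed auto
  define h where "h = (\<lambda>u. max (g u - c) 0)"
  have hc: "continuous_on {0..T} h" unfolding h_def by (intro continuous_intros gc)
  \<comment> \<open>The formula for the curvature holds almost everywhere, but
    \<open>\<theta>\<close> is a primitive of the curvature and hence of the continuous function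
    \<open>h\<close>. It is therefore differentiable at every point, with one-sided derivatives at
    the ends.\<close>
  have \<theta>d: "(\<theta> has_real_derivative h s) (at s within {0..T})" if s: "s \<in> {0..T}" for s
  proof -
    have neg2: "negligible {u. \<not> (u \<in> {0..T} \<longrightarrow> k0 u = max (g u - c) 0)}" by (rule AE_lborel_imp_negligible[OF c])
    have eq: "\<theta> u = \<theta> 0 + integral {0..u} h" if u: "u \<in> {0..T}" for u
    proof -
      have "integral {0..u} k0 = integral {0..u} h"
        by (rule integral_spike[OF neg2]) (use u in \<open>auto simp: h_def\<close>)
      then show ?thesis using \<theta>i[OF u] by simp
    qed
    have "((\<lambda>u. \<theta> 0 + integral {0..u} h) has_real_derivative h s) (at s within {0..T})"
      using integral_has_real_derivative[OF hc s] by (auto intro!: derivative_eq_intros)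
    then show ?thesis
      by (rule has_field_derivative_transform_within[OF _ zero_less_one s]) (rule eq[symmetric])
  qed
  have W: "W2inf \<theta> 0 T"
  proof -
    \<comment> \<open>The function \<open>g\<close> has a continuous and hence bounded derivative,
      and taking the positive part does not increase a Lipschitz constant.\<close>
    define g' where "g' = (\<lambda>u. \<mu> * (x u * cos (\<theta> u) + y u * sin (\<theta> u)) + Q e1 * sin (\<theta> u) - Q e2 * cos (\<theta> u))"
    have g'c: "continuous_on {0..T} g'" unfolding g'_def by (intro continuous_intros convex_arcD(9,10)[OF arc] \<theta>c)
    obtain L where L: "0 \<le> L" "\<And>u. u \<in> {0..T} \<Longrightarrow> \<bar>g' u\<bar> \<le> L" using continuous_on_Icc_bound[OF g'c] by blast
    have gd: "(g has_real_derivative g' u) (at u within {0..T})" if "u \<in> {0..T}" for u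
      unfolding g_def g'_def using xd[OF that] yd[OF that]
      by (auto intro!: derivative_eq_intros simp: algebra_simps)
    have "L-lipschitz_on {0..T} h"
    proof (rule lipschitz_onI[OF _ L(1)])
      fix u v assume uv: "u \<in> {0..T}" "v \<in> {0..T}"
      have "norm (g u - g v) \<le> L * norm (u - v)"
        by (rule field_differentiable_bound[of "{0..T}" g g']) (use gd L uv in auto)
      then show "dist (h u) (h v) \<le> L * dist u v" by (auto simp: h_def dist_real_def max_def)
    qed
    then show ?thesis unfolding W2inf_def using \<theta>d by blast
  qed
  have hs: "h s = (\<mu> / 2) * neg_part (((Q e1)\<^sup>2 + (Q e2)\<^sup>2) / \<mu>\<^sup>2 + 2 * c / \<mu>
             - (fst (curve \<theta> (0, 0) s) - Q e2 / \<mu>)\<^sup>2 - (snd (curve \<theta> (0, 0) s) + Q e1 / \<mu>)\<^sup>2)" for s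
  proof -
    let ?R = "((Q e1)\<^sup>2 + (Q e2)\<^sup>2) / \<mu>\<^sup>2 + 2 * c / \<mu> - (x s - Q e2 / \<mu>)\<^sup>2 - (y s + Q e1 / \<mu>)\<^sup>2"
    \<comment> \<open>Completing the squares in \<open>g - c\<close> gives the centre
      \<open>(Q e2 / \<mu>, - Q e1 / \<mu>)\<close> and the constant. Thus \<open>Q e1\<close> and
      \<open>Q e2\<close> are the multipliers of the theorem, and positivity of \<open>\<mu>\<close>
      lets the factor \<open>\<mu> / 2\<close> be pulled out of the maximum.\<close>
    have gR: "g s - c = \<mu> / 2 * (- ?R)"
      unfolding g_def using assms(1) by (simp add: field_simps power2_eq_square)
    have "h s = max (\<mu> / 2 * (- ?R)) (\<mu> / 2 * 0)" unfolding h_def gR by (simp only: mult_zero_right)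
    also have "\<dots> = \<mu> / 2 * max (- ?R) 0"
      using assms(1) by (subst max_mult_distrib_left) auto
    finally show ?thesis by (simp add: curve neg_part_def)
  qed
  show ?thesis
  proof
    show "W2inf \<theta> 0 (2 * pi)" using W by (simp add: T_def)
    have "(\<theta> has_real_derivative (\<mu> / 2) * neg_part (((Q e1)\<^sup>2 + (Q e2)\<^sup>2) / \<mu>\<^sup>2 + 2 * c / \<mu>
             - (fst (curve \<theta> (0, 0) s) - Q e2 / \<mu>)\<^sup>2 - (snd (curve \<theta> (0, 0) s) + Q e1 / \<mu>)\<^sup>2))
        (at s within {0..2 * pi})" if "s \<in> {0..2 * pi}" for s
      unfolding hs[symmetric] using \<theta>d that by (simp add: T_def)
    then show "\<exists>l1 l2 c. \<forall>s\<in>{0..2 * pi}.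
       (\<theta> has_real_derivative
          (\<mu> / 2) * neg_part ((l1\<^sup>2 + l2\<^sup>2) / \<mu>\<^sup>2 + 2 * c / \<mu>
             - (fst (curve \<theta> (0, 0) s) - l2 / \<mu>)\<^sup>2
             - (snd (curve \<theta> (0, 0) s) + l1 / \<mu>)\<^sup>2))
        (at s within {0..2 * pi})" by blast
  qed
qed

end
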